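(* Let $2\le n<\infty$ and let $\mathfrak{N}_n$ be the set of all nonperiodic vectors in $\bigcup_{m\ge1}(\mathcal{V}_{n,m})_1$. For any $g\in U(n)$ and $z\in\mathfrak{N}_n$, $$\alpha_g^*(\tilde{\omega}_z)=\tilde{\omega}_{\Gamma_g z}.$$
   Context: $\mathcal{O}_n$ ($2\le n<\infty$) is the Cuntz algebra, the universal C$^*$-algebra generated by $s_1,\ldots,s_n$ with $s_i^*s_j=\delta_{ij}I$ and $\sum_{i=1}^n s_is_i^*=I$. For $J=(j_1,\ldots,j_k)\in\{1,\ldots,n\}^k$, $s_J:=s_{j_1}\cdots s_{j_k}$. $\mathcal{V}_{n,m}:=\ell^2(\{1,\ldots,n\}^m)$ is the Hilbert space with orthonormal basis $\{e_J: J\in\{1,\ldots,n\}^m\}$, identified with $(\mathbb{C}^n)^{\otimes m}$ via $e_J\leftrightarrow e_{j_1}\otimes\cdots\otimes e_{j_m}$. $(\mathcal{V}_{n,m})_1$ is the set of unit vectors. For $z=\sum z_Je_J\in(\mathcal{V}_{n,m})_1$, a sub-Cuntz state on $\mathcal{O}_n$ by $z$ is a state $\omega$ on $\mathcal{O}_n$ with $\omega(s_J)=\overline{z_J}$ for all $J\in\{1,\ldots,n\}^m$. $z$ is nonperiodic if $z=x^{\otimes p}$ for some $p\ge 1$ and some $x\in\bigcup_{k\ge1}\mathcal{V}_{n,k}$ implies $p=1$. For a nonperiodic unit vector $z$ there is exactly one sub-Cuntz state by $z$, denoted $\tilde{\omega}_z$. For $g=(g_{ij})\in U(n)$, $\alpha_g$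 is the automorphism of $\mathcal{O}_n$ with $\alpha_g(s_i)=\sum_{j=1}^n g_{ji}s_j$ ($i=1,\ldots,n$), and $\alpha_g^*(f):=f\circ\alpha_{g^*}$ for $f$ in the dual of $\mathcal{O}_n$. The unitary $\gamma_g$ on $\mathbb{C}^n=\mathcal{V}_{n,1}$ is $\gamma_ge_i:=\sum_{j=1}^n g_{ji}e_j$, and $\Gamma_gz:=(\gamma_g)^{\otimes m}z$ for $z\in(\mathcal{V}_{n,m})_1$; $\Gamma_g$ maps nonperiodic unit vectors to nonperiodic unit vectors. *)

theory Defs
  imports "HOL-Analysis.Analysis" "HOL-Library.Poly_Mapping"
begin

section \<open>Unital C*-algebras, homomorphisms and states\<close>

class scaleC =
  fixes scaleC :: "complex \<Rightarrow> 'a \<Rightarrow> 'a" (infixr "*\<^sub>C" 75)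

class star =
  fixes star :: "'a \<Rightarrow> 'a"

text \<open>The zero algebra is allowed, hence no assumption on the norm of the unit.\<close>

class unital_cstar_algebra = banach + real_normed_algebra + monoid_mult + scaleC + star +
  assumes scaleC_of_real: "complex_of_real r *\<^sub>C x = r *\<^sub>R x"
    and scaleC_add_right: "c *\<^sub>C (x + y) = c *\<^sub>C x + c *\<^sub>C y"
    and scaleC_add_left: "(c + d) *\<^sub>C x = c *\<^sub>C x + d *\<^sub>C x"
    and scaleC_scaleC: "c *\<^sub>C d *\<^sub>C x = (c * d) *\<^sub>C x"
    and mult_scaleC_left: "(c *\<^sub>C x) * y = c *\<^sub>C (x * y)"
    and mult_scaleC_right: "x * (c *\<^sub>C y) = c *\<^sub>C (x * y)"
    and norm_scaleC: "norm (c *\<^sub>C x) = cmod c * norm x"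
    and star_star: "star (star x) = x"
    and star_add: "star (x + y) = star x + star y"
    and star_scaleC: "star (c *\<^sub>C x) = cnj c *\<^sub>C star x"
    and star_mult: "star (x * y) = star y * star x"
    and cstar_identity: "norm (star x * x) = (norm x)\<^sup>2"

definition unital_star_hom :: "('a::unital_cstar_algebra \<Rightarrow> 'b::unital_cstar_algebra) \<Rightarrow> bool" where
  "unital_star_hom \<phi> \<longleftrightarrow>
     (\<forall>x y. \<phi> (x + y) = \<phi> x + \<phi> y) \<and> (\<forall>c x. \<phi> (c *\<^sub>C x) = c *\<^sub>C \<phi> x) \<and>
     (\<forall>x y. \<phi> (x * y) = \<phi> x * \<phi> y) \<and> (\<forall>x. \<phi> (star x) = star (\<phi> x)) \<and> \<phi> 1 = 1"

definition star_automorphism :: "('a::unital_cstar_algebra \<Rightarrow> 'a) \<Rightarrow> bool" where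
  "star_automorphism \<phi> \<longleftrightarrow> unital_star_hom \<phi> \<and> bij \<phi>"

definition state :: "('a::unital_cstar_algebra \<Rightarrow> complex) \<Rightarrow> bool" where
  "state \<omega> \<longleftrightarrow>
     (\<forall>x y. \<omega> (x + y) = \<omega> x + \<omega> y) \<and> (\<forall>c x. \<omega> (c *\<^sub>C x) = c * \<omega> x) \<and>
     (\<forall>x. \<omega> (star x * x) \<in> \<real>\<^sub>\<ge>\<^sub>0) \<and> \<omega> 1 = 1"


lemma star_one [simp]: "star (1 :: 'a::unital_cstar_algebra) = 1"
  by (metis mult.right_neutral star_mult star_star)

lemma star_scaleR: "star (r *\<^sub>R x) = r *\<^sub>R star (x :: 'a::unital_cstar_algebra)"
  using star_scaleC[of "complex_of_real r" x] by (simp add: scaleC_of_real)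

lemma star_zero [simp]: "star (0 :: 'a::unital_cstar_algebra) = 0"
  using star_scaleR[of 0] by simp

lemma scaleC_one [simp]: "1 *\<^sub>C x = (x :: 'a::unital_cstar_algebra)"
  using scaleC_of_real[of 1 x] by simp

lemma scaleC_zero_left [simp]: "0 *\<^sub>C x = (0 :: 'a::unital_cstar_algebra)"
  using scaleC_of_real[of 0 x] by simp

lemma scaleC_zero_right [simp]: "c *\<^sub>C (0 :: 'a::unital_cstar_algebra) = 0"
  using scaleC_add_right[of c "0 :: 'a" 0] by simp

lemma norm_star [simp]: "norm (star x) = norm (x :: 'a::unital_cstar_algebra)"
proof -
  have *: "norm y \<le> norm (star y)" for y :: 'a
  proof (cases "norm y = 0")
    case False
    then have "norm y * norm y \<le> norm (star y) * norm y"
      using cstar_identity[of y] norm_mult_ineq[of "star y" y] by (simp add: power2_eq_square)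
    then show ?thesis using False by simp
  qed simp
  from *[of x] *[of "star x"] show ?thesis by (simp add: star_star)
qed

lemma bounded_linear_star: "bounded_linear (star :: 'a::unital_cstar_algebra \<Rightarrow> 'a)"
  by (rule bounded_linear_intro[where K = 1]) (simp_all add: star_add star_scaleR)

lemma bounded_linear_scaleC: "bounded_linear (\<lambda>x :: 'a::unital_cstar_algebra. c *\<^sub>C x)"
proof (rule bounded_linear_intro[where K = "cmod c"])
  fix r and x :: 'a
  show "c *\<^sub>C r *\<^sub>R x = r *\<^sub>R c *\<^sub>C x"
    unfolding scaleC_of_real[symmetric] by (simp add: scaleC_scaleC mult.commute)
qed (simp_all add: scaleC_add_right norm_scaleC mult.commute)

lemma norm_one_cstar: "norm (1 :: 'a::unital_cstar_algebra) \<le> 1"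
proof -
  have "norm (1 :: 'a) = norm (1 :: 'a) * norm (1 :: 'a)"
    using cstar_identity[of "1 :: 'a"] by (simp add: power2_eq_square)
  then have "norm (1 :: 'a) = 0 \<or> norm (1 :: 'a) = 1" by simp
  then show ?thesis by auto
qed

lemma norm_power_cstar: "norm ((x :: 'a::unital_cstar_algebra) ^ k) \<le> norm x ^ k"
proof (induction k)
  case (Suc k)
  have "norm (x * x ^ k) \<le> norm x * norm (x ^ k)" by (rule norm_mult_ineq)
  also have "\<dots> \<le> norm x * norm x ^ k" using Suc by (simp add: mult_left_mono)
  finally show ?case by simp
qed (simp add: norm_one_cstar)

lemma star_power: "star ((x :: 'a::unital_cstar_algebra) ^ k) = star x ^ k"
  by (induction k) (simp_all add: star_mult power_commutes)

text \<open>The binomial series for the square root of \<open>1 - h\<^sup>2\<close>.\<close>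

lemma cstar_sqrt_exists:
  fixes h :: "'a::unital_cstar_algebra"
  assumes h: "star h = h" "norm h < 1"
  obtains s where "star s = s" "h * s = s * h" "s * s = 1 - h * h"
proof -
  define a where "a k = ((-1) ^ k * ((1/2 :: real) gchoose k)) *\<^sub>R (h * h) ^ k" for k
  define s where "s = suminf a"
  have half: "(1/2 :: real) \<notin> \<nat>"
  proof
    assume "(1/2 :: real) \<in> \<nat>"
    then obtain n where "(1/2 :: real) = real n" by (auto elim: Nats_cases)
    then have "real (2 * n) = real 1" by simp
    then have "2 * n = 1" using of_nat_eq_iff by blast
    then show False by presburger
  qed
  have "norm (h * h) < 1"
    using norm_mult_ineq[of h h] h(2) mult_strict_mono'[of "norm h" 1 "norm h" 1] by simp
  then have "summable (\<lambda>k. norm (((1/2 :: real) gchoose k) * norm (h * h) ^ k))"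
    by (intro abs_summable_in_conv_radius) (simp add: conv_radius_gchoose half one_ereal_def)
  then have sa: "summable (\<lambda>k. norm (a k))"
    by (rule summable_comparison_test'[of _ 0])
       (simp add: a_def abs_mult power_abs mult_left_mono norm_power_cstar)
  then have "summable a" by (rule summable_norm_cancel)
  have "star (a k) = a k" for k
    by (simp add: a_def star_scaleR star_power star_mult h)
  then have 1: "star s = s"
    unfolding s_def using bounded_linear.suminf[OF bounded_linear_star \<open>summable a\<close>] by simp
  have "h * (h * h) ^ k = (h * h) ^ k * h" for k
    by (rule power_commuting_commutes[symmetric]) (simp add: mult.assoc)
  then have "h * a k = a k * h" for k
    by (simp add: a_def)
  then have 2: "h * s = s * h"
    unfolding s_def
    using bounded_linear.suminf[OF bounded_linear_mult_right \<open>summable a\<close>, of h]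
      bounded_linear.suminf[OF bounded_linear_mult_left \<open>summable a\<close>, of h] by simp
  have "(\<Sum>i\<le>k. a i * a (k - i)) = ((-1) ^ k * ((1 :: real) gchoose k)) *\<^sub>R (h * h) ^ k" for k
  proof -
    have "(\<Sum>i\<le>k. a i * a (k - i)) =
        (\<Sum>i\<le>k. ((-1) ^ k * (((1/2 :: real) gchoose i) * ((1/2) gchoose (k - i)))) *\<^sub>R (h * h) ^ k)"
    proof (rule sum.cong)
      fix i assume "i \<in> {..k}"
      then have "(h * h) ^ i * (h * h) ^ (k - i) = (h * h) ^ k"
        "(-1 :: real) ^ i * (-1) ^ (k - i) = (-1) ^ k"
        by (simp_all flip: power_add)
      moreover have "a i * a (k - i) = (((-1) ^ i * (-1) ^ (k - i)) *
          (((1/2 :: real) gchoose i) * ((1/2) gchoose (k - i)))) *\<^sub>R ((h * h) ^ i * (h * h) ^ (k - i))"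
        by (simp add: a_def ac_simps)
      ultimately show "a i * a (k - i) =
          ((-1) ^ k * (((1/2 :: real) gchoose i) * ((1/2) gchoose (k - i)))) *\<^sub>R (h * h) ^ k"
        by simp
    qed simp
    also have "\<dots> = ((-1) ^ k * (\<Sum>i\<le>k. ((1/2 :: real) gchoose i) * ((1/2) gchoose (k - i)))) *\<^sub>R (h * h) ^ k"
      by (simp add: scaleR_left.sum sum_distrib_left)
    also have "(\<Sum>i\<le>k. ((1/2 :: real) gchoose i) * ((1/2) gchoose (k - i))) = ((1 :: real) gchoose k)"
      using gbinomial_Vandermonde[of "1/2 :: real" "1/2" k] by (simp add: atMost_atLeast0)
    finally show ?thesis .
  qed
  then have "(\<lambda>k. ((-1) ^ k * ((1 :: real) gchoose k)) *\<^sub>R (h * h) ^ k) sums (s * s)"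
    using Cauchy_product_sums[OF sa sa] unfolding s_def by simp
  moreover have "(1 :: real) gchoose k = 0" if "k \<notin> {0, 1}" for k
    using that binomial_gbinomial[of 1 k, where ?'a = real] by (simp add: binomial_eq_0)
  then have "(\<lambda>k. ((-1) ^ k * ((1 :: real) gchoose k)) *\<^sub>R (h * h) ^ k) sums
      (\<Sum>k\<in>{0, 1}. ((-1) ^ k * ((1 :: real) gchoose k)) *\<^sub>R (h * h) ^ k)"
    by (intro sums_finite) auto
  ultimately have "s * s = (\<Sum>k\<in>{0, 1}. ((-1) ^ k * ((1 :: real) gchoose k)) *\<^sub>R (h * h) ^ k)"
    by (rule sums_unique2)
  then have "s * s = 1 - h * h" by simp
  with 1 2 that show thesis by blast
qed

lemma
  assumes "unital_star_hom \<phi>"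
  shows star_hom_add: "\<phi> (x + y) = \<phi> x + \<phi> y"
    and star_hom_scaleC: "\<phi> (c *\<^sub>C x) = c *\<^sub>C \<phi> x"
    and star_hom_mult: "\<phi> (x * y) = \<phi> x * \<phi> y"
    and star_hom_star: "\<phi> (star x) = star (\<phi> x)"
    and star_hom_one: "\<phi> 1 = 1"
  using assms unfolding unital_star_hom_def by blast+

lemma star_hom_contractive:
  fixes \<phi> :: "'a::unital_cstar_algebra \<Rightarrow> 'b::unital_cstar_algebra"
  assumes \<phi>: "unital_star_hom \<phi>"
  shows "norm (\<phi> x) \<le> norm x"
proof -
  note hom = star_hom_add[OF \<phi>] star_hom_scaleC[OF \<phi>] star_hom_mult[OF \<phi>] star_hom_star[OF \<phi>]
    star_hom_one[OF \<phi>]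
  have scaleR: "\<phi> (r *\<^sub>R y) = r *\<^sub>R \<phi> y" for r y
    using hom(2)[of "complex_of_real r" y] by (simp add: scaleC_of_real)
  have unit: "norm (\<phi> h) \<le> 1" if h: "star h = h" "norm h < 1" for h
  proof -
    obtain s where s: "star s = s" "h * s = s * h" "s * s = 1 - h * h"
      using cstar_sqrt_exists[OF h] .
    define u where "u = h + \<i> *\<^sub>C s"
    have su: "star u = h + (- \<i>) *\<^sub>C s"
      by (simp add: u_def star_add star_scaleC h s)
    have "star u * u = h * h + s * s + (\<i> *\<^sub>C (h * s) + (- \<i>) *\<^sub>C (s * h))"
      unfolding su unfolding u_def
      by (simp add: distrib_left distrib_right mult_scaleC_left mult_scaleC_right scaleC_scaleC scaleC_add_right add_ac)
    also have "\<dots> = 1"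
      using s by (simp flip: scaleC_add_left)
    finally have "(norm (\<phi> u))\<^sup>2 = norm (1 :: 'b)"
      by (metis hom(3-5) cstar_identity)
    then have nu: "norm (\<phi> u) \<le> 1"
      by (metis abs_norm_cancel abs_square_le_1 norm_one_cstar)
    have "u + star u = h + h + (\<i> + - \<i>) *\<^sub>C s"
      unfolding su unfolding u_def scaleC_add_left by (simp only: add_ac)
    then have "h + h = u + star u" by simp
    then have "\<phi> h + \<phi> h = \<phi> u + star (\<phi> u)"
      by (metis hom(1,4))
    then have "2 * norm (\<phi> h) = norm (\<phi> u + star (\<phi> u))"
      by (metis norm_scaleR scaleR_2 abs_numeral)
    also have "\<dots> \<le> 2"
      using norm_triangle_ineq[of "\<phi> u" "star (\<phi> u)"] nu by simp
    finally show ?thesis by simp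
  qed
  have sa: "norm (\<phi> h) \<le> norm h" if h: "star h = h" for h
  proof (rule ccontr)
    assume "\<not> norm (\<phi> h) \<le> norm h"
    then obtain r where r: "norm h < r" "r < norm (\<phi> h)"
      using dense by (metis not_le)
    then have "r > 0" using norm_ge_zero[of h] by linarith
    then have "norm (\<phi> (inverse r *\<^sub>R h)) \<le> 1"
      using r by (intro unit) (simp_all add: star_scaleR h field_simps)
    then show False using r \<open>r > 0\<close> by (simp add: scaleR field_simps)
  qed
  have "(norm (\<phi> x))\<^sup>2 \<le> norm (star x * x)"
    using sa[of "star x * x"] by (simp add: hom star_mult star_star cstar_identity)
  then have "(norm (\<phi> x))\<^sup>2 \<le> (norm x)\<^sup>2" by (simp add: cstar_identity)
  then show ?thesis by (rule power2_le_imp_le) simp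
qed


section \<open>The free unital *-algebra on a family of generators\<close>

datatype 'n gen = Gen 'n | Gen_star 'n

datatype 'n word = Word (letters: "'n gen list")

instantiation word :: (type) monoid_add
begin

definition "0 = Word []"
definition "v + w = Word (letters v @ letters w)"

instance
  by standard (auto simp: zero_word_def plus_word_def)

end

type_synonym 'n free = "'n word \<Rightarrow>\<^sub>0 complex"

fun gen_star :: "'n gen \<Rightarrow> 'n gen" where
  "gen_star (Gen i) = Gen_star i"
| "gen_star (Gen_star i) = Gen i"

definition word_star :: "'n word \<Rightarrow> 'n word" where
  "word_star w = Word (rev (map gen_star (letters w)))"

lemma gen_star_gen_star [simp]: "gen_star (gen_star x) = x"
  by (cases x) auto

lemma word_star_word_star [simp]: "word_star (word_star w) = w"
proof -
  have "gen_star \<circ> gen_star = (id :: 'a gen \<Rightarrow> 'a gen)"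
    by (rule ext) simp
  then show ?thesis
    by (simp add: word_star_def rev_map)
qed

lemma word_star_add: "word_star (v + w) = word_star w + word_star v"
  by (simp add: word_star_def plus_word_def)

lemma word_star_zero [simp]: "word_star 0 = 0"
  by (simp add: word_star_def zero_word_def)

lift_definition free_star :: "'n free \<Rightarrow> 'n free" is
  "\<lambda>a w. cnj (a (word_star w))"
proof -
  fix a :: "'n word \<Rightarrow> complex"
  assume "finite {w. a w \<noteq> 0}"
  moreover have "{w. cnj (a (word_star w)) \<noteq> 0} \<subseteq> word_star ` {w. a w \<noteq> 0}"
  proof
    fix w assume "w \<in> {w. cnj (a (word_star w)) \<noteq> 0}"
    then have "word_star w \<in> {w. a w \<noteq> 0}" by simp
    then have "word_star (word_star w) \<in> word_star ` {w. a w \<noteq> 0}" by (rule imageI)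
    then show "w \<in> word_star ` {w. a w \<noteq> 0}" by simp
  qed
  ultimately show "finite {w. cnj (a (word_star w)) \<noteq> 0}"
    using finite_surj by blast
qed

lifting_forget poly_mapping.lifting

definition free_scale :: "complex \<Rightarrow> 'n free \<Rightarrow> 'n free" where
  "free_scale c a = Poly_Mapping.single 0 c * a"

definition free_gen :: "'n \<Rightarrow> 'n free" where
  "free_gen i = Poly_Mapping.single (Word [Gen i]) 1"

lemma free_induct [case_names single add]:
  fixes a :: "'n free"
  assumes "\<And>w c. P (Poly_Mapping.single w c)" and "\<And>a b. P a \<Longrightarrow> P b \<Longrightarrow> P (a + b)"
  shows "P a"
proof -
  have "P (\<Sum>w\<in>K. Poly_Mapping.single w (Poly_Mapping.lookup a w))" if "finite K" for K
    using that
  proof (induction K)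
    case empty
    have "P (Poly_Mapping.single 0 0)" by (rule assms(1))
    then show ?case by simp
  next
    case (insert w K)
    then show ?case using assms by simp
  qed
  moreover have "(\<Sum>w\<in>Poly_Mapping.keys a. Poly_Mapping.single w (Poly_Mapping.lookup a w)) = a"
  proof (rule poly_mapping_eqI)
    fix k
    have "(\<Sum>w\<in>Poly_Mapping.keys a. if w = k then Poly_Mapping.lookup a w else 0) = (if k \<in> Poly_Mapping.keys a then Poly_Mapping.lookup a k else 0)"
      by (rule sum.delta) simp
    then show "Poly_Mapping.lookup (\<Sum>w\<in>Poly_Mapping.keys a. Poly_Mapping.single w (Poly_Mapping.lookup a w)) k = Poly_Mapping.lookup a k"
      by (simp add: lookup_sum lookup_single when_def in_keys_iff)
  qed
  ultimately show ?thesis by (metis finite_keys)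
qed

lemma free_star_single: "free_star (Poly_Mapping.single w c) = Poly_Mapping.single (word_star w) (cnj c)"
  by (rule poly_mapping_eqI)
     (auto simp: free_star.rep_eq lookup_single when_def)

lemma free_star_add: "free_star (a + b) = free_star a + free_star b"
  by (rule poly_mapping_eqI) (simp add: free_star.rep_eq lookup_add)

lemma free_star_free_star [simp]: "free_star (free_star a) = a"
  by (rule poly_mapping_eqI) (simp add: free_star.rep_eq)

lemma free_star_mult: "free_star (a * b) = free_star b * free_star a"
proof (induction a rule: free_induct)
  case (single v c)
  show ?case
    by (induction b rule: free_induct)
       (simp_all add: mult_single free_star_single word_star_add mult.commute
          distrib_left distrib_right free_star_add)
next
  case (add a a')
  then show ?case by (simp add: distrib_left distrib_right free_star_add)
qed

lemma free_const_commute: "Poly_Mapping.single 0 c * a = a * Poly_Mapping.single 0 c"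
  for a :: "'n free"
  by (induction a rule: free_induct) (simp_all add: mult_single mult.commute distrib_left distrib_right)

lemma free_scale_mult_left: "free_scale c a * b = free_scale c (a * b)"
  by (simp add: free_scale_def mult.assoc)

lemma free_scale_mult_right: "a * free_scale c b = free_scale c (a * b)"
  unfolding free_scale_def by (metis free_const_commute mult.assoc)

lemma free_star_scale: "free_star (free_scale c a) = free_scale (cnj c) (free_star a)"
  unfolding free_scale_def
  by (simp add: free_star_mult free_star_single free_const_commute)

lemma free_scale_simps:
  "free_scale c (a + b) = free_scale c a + free_scale c b"
  "free_scale c (a - b) = free_scale c a - free_scale c b"
  "free_scale (c + d) a = free_scale c a + free_scale d a"
  "free_scale c (free_scale d a) = free_scale (c * d) a"
  "free_scale 1 a = a"
  by (simp_all add: free_scale_def distrib_left distrib_right single_add right_diff_distrib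
       mult_single flip: mult.assoc)

lemma free_star_diff: "free_star (a - b) = free_star a - free_star b"
  by (rule poly_mapping_eqI) (simp add: free_star.rep_eq lookup_minus)


section \<open>The Cuntz algebra\<close>

text \<open>
  As usual for a universal C*-algebra given by generators and relations, the Cuntz algebra is the
  Hausdorff completion of the free unital *-algebra with respect to the largest C*-seminorm for
  which the relations hold. The generators are indexed by a finite type
  instead of the numbers from 1 to n. The universal property with respect to arbitrary unital
  C*-algebras is the lemma \<open>cuntz_universal\<close> below.
\<close>

definition cuntz_seminorm :: "('n::finite free \<Rightarrow> real) \<Rightarrow> bool" where
  "cuntz_seminorm p \<longleftrightarrow>
     (\<forall>a b. p (a + b) \<le> p a + p b) \<and> (\<forall>c a. p (free_scale c a) = cmod c * p a) \<and>
     (\<forall>a b. p (a * b) \<le> p a * p b) \<and> (\<forall>a. p (free_star a * a) = (p a)\<^sup>2) \<and>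
     (\<forall>i j. p (free_star (free_gen i) * free_gen j - (if i = j then 1 else 0)) = 0) \<and>
     p ((\<Sum>i\<in>UNIV. free_gen i * free_star (free_gen i)) - 1) = 0"

definition cuntz_norm :: "'n::finite free \<Rightarrow> real" where
  "cuntz_norm a = Sup {p a |p. cuntz_seminorm p}"

context
  fixes p :: "'n::finite free \<Rightarrow> real"
  assumes p: "cuntz_seminorm p"
begin

lemma seminorm_add: "p (a + b) \<le> p a + p b"
  and seminorm_scale: "p (free_scale c a) = cmod c * p a"
  and seminorm_mult: "p (a * b) \<le> p a * p b"
  and seminorm_cstar: "p (free_star a * a) = (p a)\<^sup>2"
  and seminorm_rel1: "p (free_star (free_gen i) * free_gen j - (if i = j then 1 else 0)) = 0"
  and seminorm_rel2: "p ((\<Sum>i\<in>UNIV. free_gen i * free_star (free_gen i)) - 1) = 0"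
  using p unfolding cuntz_seminorm_def by blast+

lemma seminorm_zero: "p 0 = 0"
  using seminorm_scale[of 0 0] by (simp add: free_scale_def)

lemma seminorm_minus: "p (- a) = p a"
  using seminorm_scale[of "-1" a] by (simp add: free_scale_def single_uminus)

lemma seminorm_nonneg: "0 \<le> p a"
  using seminorm_add[of a "- a"] seminorm_minus[of a] seminorm_zero by simp

lemma seminorm_star: "p (free_star a) = p a"
proof -
  have *: "p b \<le> p (free_star b)" for b
  proof (cases "p b = 0")
    case False
    then have "0 < p b" using seminorm_nonneg[of b] by simp
    moreover have "p b * p b \<le> p (free_star b) * p b"
      using seminorm_cstar[of b] seminorm_mult[of "free_star b" b] by (simp add: power2_eq_square)
    ultimately show ?thesis by simp
  qed (simp add: seminorm_nonneg)
  from *[of a] *[of "free_star a"] show ?thesis by simp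
qed

lemma seminorm_one: "p 1 \<le> 1"
proof -
  have "free_star (1 :: 'n free) = 1"
    by (simp add: free_star_single flip: single_one)
  then have "p 1 = (p 1)\<^sup>2" using seminorm_cstar[of 1] by simp
  then have "p 1 = 0 \<or> p 1 = 1" by (simp add: power2_eq_square)
  then show ?thesis by auto
qed

lemma seminorm_gen: "p (free_gen i) \<le> 1"
proof -
  have "(p (free_gen i))\<^sup>2 = p ((free_star (free_gen i) * free_gen i - 1) + 1)"
    by (simp add: seminorm_cstar)
  also have "\<dots> \<le> p (free_star (free_gen i) * free_gen i - 1) + p 1"
    by (rule seminorm_add)
  also have "\<dots> \<le> 1" using seminorm_rel1[of i i] seminorm_one by simp
  finally show ?thesis
    by (simp add: abs_square_le_1)
qed

lemma seminorm_word: "p (Poly_Mapping.single (Word l) 1) \<le> 1"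
proof (induction l)
  case Nil
  then show ?case using seminorm_one by (simp flip: zero_word_def)
next
  case (Cons x l)
  have "p (Poly_Mapping.single (Word [x]) 1) \<le> 1"
  proof (cases x)
    case (Gen i)
    then show ?thesis using seminorm_gen[of i] by (simp add: free_gen_def)
  next
    case (Gen_star i)
    then have "Poly_Mapping.single (Word [x]) 1 = free_star (free_gen i)"
      by (simp add: free_gen_def free_star_single word_star_def)
    then show ?thesis using seminorm_gen[of i] by (simp add: seminorm_star)
  qed
  then have "p (Poly_Mapping.single (Word [x]) 1) * p (Poly_Mapping.single (Word l) 1) \<le> 1"
    using Cons by (simp add: mult_le_one seminorm_nonneg)
  moreover have "Poly_Mapping.single (Word (x # l)) (1::complex) =
      Poly_Mapping.single (Word [x]) 1 * Poly_Mapping.single (Word l) 1"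
    by (simp add: mult_single plus_word_def)
  ultimately show ?case
    using seminorm_mult[of "Poly_Mapping.single (Word [x]) 1" "Poly_Mapping.single (Word l) 1"] by simp
qed

lemma seminorm_single: "p (Poly_Mapping.single w c) \<le> cmod c"
proof -
  have "Poly_Mapping.single w c = free_scale c (Poly_Mapping.single w 1)"
    by (simp add: free_scale_def mult_single)
  then show ?thesis
    using seminorm_word[of "letters w"] by (simp add: seminorm_scale mult_left_le)
qed

end

lemma cuntz_seminorm_zero: "cuntz_seminorm (\<lambda>a. 0)"
  by (simp add: cuntz_seminorm_def)

lemma cuntz_seminorms_bounded: "\<exists>C. \<forall>p. cuntz_seminorm p \<longrightarrow> p a \<le> C"
proof (induction a rule: free_induct)
  case (single w c)
  then show ?case using seminorm_single by blast
next
  case (add a b)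
  then obtain C D where "\<forall>p. cuntz_seminorm p \<longrightarrow> p a \<le> C" "\<forall>p. cuntz_seminorm p \<longrightarrow> p b \<le> D"
    by blast
  then have "\<forall>p. cuntz_seminorm p \<longrightarrow> p (a + b) \<le> C + D"
    using seminorm_add by (metis add_mono order_trans)
  then show ?case by blast
qed

lemma cuntz_norm_upper: "cuntz_seminorm p \<Longrightarrow> p a \<le> cuntz_norm a"
  unfolding cuntz_norm_def
  using cuntz_seminorms_bounded[of a] by (intro cSup_upper) (auto simp: bdd_above_def)

lemma cuntz_norm_least: "(\<And>p. cuntz_seminorm p \<Longrightarrow> p a \<le> C) \<Longrightarrow> cuntz_norm a \<le> C"
  unfolding cuntz_norm_def
  using cuntz_seminorm_zero by (intro cSup_least) auto

lemma cuntz_norm_nonneg: "0 \<le> cuntz_norm a"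
  using cuntz_norm_upper[OF cuntz_seminorm_zero] .

lemma cuntz_seminorm_cuntz_norm: "cuntz_seminorm cuntz_norm"
  unfolding cuntz_seminorm_def
proof (intro conjI allI)
  fix a b :: "'n::finite free" and c :: complex and i j :: 'n
  show "cuntz_norm (a + b) \<le> cuntz_norm a + cuntz_norm b"
    by (rule cuntz_norm_least) (meson add_mono cuntz_norm_upper order_trans seminorm_add)
  show "cuntz_norm (a * b) \<le> cuntz_norm a * cuntz_norm b"
    by (rule cuntz_norm_least)
       (meson mult_mono cuntz_norm_upper order_trans seminorm_mult cuntz_norm_nonneg seminorm_nonneg)
  have scale: "cuntz_norm (free_scale c a) \<le> cmod c * cuntz_norm a" for c and a :: "'n free"
    by (rule cuntz_norm_least) (simp add: seminorm_scale cuntz_norm_upper mult_left_mono)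
  show "cuntz_norm (free_scale c a) = cmod c * cuntz_norm a"
  proof (cases "c = 0")
    case True
    then show ?thesis
      using scale[of 0 a] cuntz_norm_nonneg[of "free_scale 0 a"] by simp
  next
    case False
    then have "cuntz_norm a \<le> cmod (inverse c) * cuntz_norm (free_scale c a)"
      using scale[of "inverse c" "free_scale c a"] by (simp add: free_scale_simps)
    then show ?thesis
      using scale[of c a] False by (simp add: norm_inverse norm_divide field_simps)
  qed
  show "cuntz_norm (free_star a * a) = (cuntz_norm a)\<^sup>2"
  proof (rule antisym)
    show "cuntz_norm (free_star a * a) \<le> (cuntz_norm a)\<^sup>2"
      by (rule cuntz_norm_least)
         (simp add: seminorm_cstar cuntz_norm_upper seminorm_nonneg power_mono)
    have "cuntz_norm a \<le> sqrt (cuntz_norm (free_star a * a))"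
    proof (rule cuntz_norm_least)
      fix p :: "'n free \<Rightarrow> real" assume p: "cuntz_seminorm p"
      have "(p a)\<^sup>2 \<le> cuntz_norm (free_star a * a)"
        using cuntz_norm_upper[OF p, of "free_star a * a"] by (simp add: seminorm_cstar[OF p])
      then show "p a \<le> sqrt (cuntz_norm (free_star a * a))"
        by (rule real_le_rsqrt)
    qed
    then show "(cuntz_norm a)\<^sup>2 \<le> cuntz_norm (free_star a * a)"
      using cuntz_norm_nonneg real_le_rsqrt
      by (metis power_mono real_sqrt_pow2)
  qed
  show "cuntz_norm (free_star (free_gen i) * free_gen j - (if i = j then 1 else 0)) = 0"
    by (rule antisym[OF cuntz_norm_least cuntz_norm_nonneg]) (simp only: seminorm_rel1)
  show "cuntz_norm ((\<Sum>i\<in>(UNIV :: 'n set). free_gen i * free_star (free_gen i)) - 1) = 0"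
    by (rule antisym[OF cuntz_norm_least cuntz_norm_nonneg]) (simp only: seminorm_rel2)
qed

lemmas cn_add = seminorm_add[OF cuntz_seminorm_cuntz_norm]
  and cn_scale = seminorm_scale[OF cuntz_seminorm_cuntz_norm]
  and cn_mult = seminorm_mult[OF cuntz_seminorm_cuntz_norm]
  and cn_cstar = seminorm_cstar[OF cuntz_seminorm_cuntz_norm]
  and cn_rel1 = seminorm_rel1[OF cuntz_seminorm_cuntz_norm]
  and cn_rel2 = seminorm_rel2[OF cuntz_seminorm_cuntz_norm]
  and cn_zero [simp] = seminorm_zero[OF cuntz_seminorm_cuntz_norm]
  and cn_minus = seminorm_minus[OF cuntz_seminorm_cuntz_norm]
  and cn_star = seminorm_star[OF cuntz_seminorm_cuntz_norm]
  and cn_one = seminorm_one[OF cuntz_seminorm_cuntz_norm]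

lemma cn_commute: "cuntz_norm (a - b) = cuntz_norm (b - a)"
  using cn_minus[of "a - b"] by simp

lemma cn_uminus_diff: "cuntz_norm (- a - - b) = cuntz_norm (a - b)"
  using cn_commute[of a b] by simp

lemma cn_triangle: "cuntz_norm (a - c) \<le> cuntz_norm (a - b) + cuntz_norm (b - c)"
  using cn_add[of "a - b" "b - c"] by simp

lemma cn_diff: "\<bar>cuntz_norm a - cuntz_norm b\<bar> \<le> cuntz_norm (a - b)"
  using cn_add[of "a - b" b] cn_add[of "b - a" a] cn_commute[of a b] by simp

definition cuntz_Cauchy :: "(nat \<Rightarrow> 'n::finite free) \<Rightarrow> bool" where
  "cuntz_Cauchy X \<longleftrightarrow> (\<forall>e>0. \<exists>M. \<forall>m\<ge>M. \<forall>k\<ge>M. cuntz_norm (X m - X k) < e)"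

definition cuntz_rel :: "(nat \<Rightarrow> 'n::finite free) \<Rightarrow> (nat \<Rightarrow> 'n free) \<Rightarrow> bool" where
  "cuntz_rel X Y \<longleftrightarrow>
     cuntz_Cauchy X \<and> cuntz_Cauchy Y \<and> (\<lambda>k. cuntz_norm (X k - Y k)) \<longlonglongrightarrow> 0"

lemma cuntz_Cauchy_const [simp]: "cuntz_Cauchy (\<lambda>k. a)"
  by (simp add: cuntz_Cauchy_def)

lemma cuntz_Cauchy_lipschitz:
  assumes X: "cuntz_Cauchy X" and C: "\<And>a b. cuntz_norm (f a - f b) \<le> C * cuntz_norm (a - b)"
  shows "cuntz_Cauchy (\<lambda>k. f (X k))"
  unfolding cuntz_Cauchy_def
proof (intro allI impI)
  fix e :: real assume e: "e > 0"
  define D where "D = max C 1"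
  have D: "D > 0" "cuntz_norm (f a - f b) \<le> D * cuntz_norm (a - b)" for a b
    using order_trans[OF C[of a b] mult_right_mono[of C "max C 1"]] cuntz_norm_nonneg[of "a - b"]
    by (auto simp: D_def)
  obtain M where M: "\<And>m k. m \<ge> M \<Longrightarrow> k \<ge> M \<Longrightarrow> cuntz_norm (X m - X k) < e / D"
    using X e D(1) unfolding cuntz_Cauchy_def by (meson divide_pos_pos)
  have "cuntz_norm (f (X m) - f (X k)) < e" if "m \<ge> M" "k \<ge> M" for m k
    using D(2)[of "X m" "X k"] M[OF that] D(1) by (simp add: field_simps)
  then show "\<exists>M. \<forall>m\<ge>M. \<forall>k\<ge>M. cuntz_norm (f (X m) - f (X k)) < e" by blast
qed

lemma cuntz_Cauchy_add:
  assumes "cuntz_Cauchy X" "cuntz_Cauchy Y"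
  shows "cuntz_Cauchy (\<lambda>k. X k + Y k)"
  unfolding cuntz_Cauchy_def
proof (intro allI impI)
  fix e :: real assume e: "e > 0"
  obtain M where M: "\<And>m k. m \<ge> M \<Longrightarrow> k \<ge> M \<Longrightarrow> cuntz_norm (X m - X k) < e / 2"
    using assms(1) e unfolding cuntz_Cauchy_def by (meson half_gt_zero)
  obtain N where N: "\<And>m k. m \<ge> N \<Longrightarrow> k \<ge> N \<Longrightarrow> cuntz_norm (Y m - Y k) < e / 2"
    using assms(2) e unfolding cuntz_Cauchy_def by (meson half_gt_zero)
  have "cuntz_norm ((X m + Y m) - (X k + Y k)) < e" if "m \<ge> max M N" "k \<ge> max M N" for m k
    using M[of m k] N[of m k] that cn_add[of "X m - X k" "Y m - Y k"]
    by (simp add: algebra_simps)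
  then show "\<exists>M. \<forall>m\<ge>M. \<forall>k\<ge>M. cuntz_norm ((X m + Y m) - (X k + Y k)) < e" by blast
qed

lemma cuntz_Cauchy_bounded:
  assumes "cuntz_Cauchy X"
  obtains C where "C > 0" "\<And>k. cuntz_norm (X k) \<le> C"
proof -
  obtain M where M: "\<And>m k. m \<ge> M \<Longrightarrow> k \<ge> M \<Longrightarrow> cuntz_norm (X m - X k) < 1"
    using assms unfolding cuntz_Cauchy_def by (meson zero_less_one)
  define C where "C = 1 + (\<Sum>k\<le>M. cuntz_norm (X k))"
  have le: "cuntz_norm (X k) \<le> (\<Sum>k\<le>M. cuntz_norm (X k))" if "k \<le> M" for k
    using that by (intro member_le_sum) (auto simp: cuntz_norm_nonneg)
  have "cuntz_norm (X k) \<le> C" for k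
  proof (cases "k \<le> M")
    case True
    then show ?thesis using le[of k] by (simp add: C_def)
  next
    case False
    then have "cuntz_norm (X k) \<le> 1 + cuntz_norm (X M)"
      using M[of k M] cn_add[of "X k - X M" "X M"] by simp
    then show ?thesis using le[of M] by (simp add: C_def)
  qed
  moreover have "C > 0"
    unfolding C_def by (intro add_pos_nonneg sum_nonneg) (auto simp: cuntz_norm_nonneg)
  ultimately show thesis using that by blast
qed

lemma cn_mult_diff:
  "cuntz_norm (a * b - a' * b') \<le> cuntz_norm (a - a') * cuntz_norm b + cuntz_norm a' * cuntz_norm (b - b')"
proof -
  have "a * b - a' * b' = (a - a') * b + a' * (b - b')"
    by (simp add: algebra_simps)
  then show ?thesis
    using cn_add[of "(a - a') * b" "a' * (b - b')"] cn_mult[of "a - a'" b] cn_mult[of a' "b - b'"]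
    by simp
qed

lemma cuntz_Cauchy_mult:
  assumes X: "cuntz_Cauchy X" and Y: "cuntz_Cauchy Y"
  shows "cuntz_Cauchy (\<lambda>k. X k * Y k)"
  unfolding cuntz_Cauchy_def
proof (intro allI impI)
  fix e :: real assume e: "e > 0"
  obtain C where C: "C > 0" "\<And>k. cuntz_norm (X k) \<le> C" using cuntz_Cauchy_bounded[OF X] by blast
  obtain D where D: "D > 0" "\<And>k. cuntz_norm (Y k) \<le> D" using cuntz_Cauchy_bounded[OF Y] by blast
  have "e / (2 * D) > 0" "e / (2 * C) > 0" using e C D by auto
  obtain M where M: "\<And>m k. m \<ge> M \<Longrightarrow> k \<ge> M \<Longrightarrow> cuntz_norm (X m - X k) < e / (2 * D)"
    using X \<open>e / (2 * D) > 0\<close> unfolding cuntz_Cauchy_def by meson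
  obtain N where N: "\<And>m k. m \<ge> N \<Longrightarrow> k \<ge> N \<Longrightarrow> cuntz_norm (Y m - Y k) < e / (2 * C)"
    using Y \<open>e / (2 * C) > 0\<close> unfolding cuntz_Cauchy_def by meson
  have "cuntz_norm (X m * Y m - X k * Y k) < e" if "m \<ge> max M N" "k \<ge> max M N" for m k
  proof -
    have "cuntz_norm (X m - X k) * cuntz_norm (Y m) \<le> cuntz_norm (X m - X k) * D"
      by (intro mult_left_mono D cuntz_norm_nonneg)
    also have "\<dots> < e / 2"
      using M[of m k] that D(1) by (simp add: field_simps)
    finally have 1: "cuntz_norm (X m - X k) * cuntz_norm (Y m) < e / 2" .
    have "cuntz_norm (X k) * cuntz_norm (Y m - Y k) \<le> C * cuntz_norm (Y m - Y k)"
      by (intro mult_right_mono C cuntz_norm_nonneg)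
    also have "\<dots> < e / 2"
      using N[of m k] that C(1) by (simp add: field_simps)
    finally show ?thesis using 1 cn_mult_diff[of "X m" "Y m" "X k" "Y k"] by simp
  qed
  then show "\<exists>M. \<forall>m\<ge>M. \<forall>k\<ge>M. cuntz_norm (X m * Y m - X k * Y k) < e" by blast
qed

lemma cuntz_rel_refl [simp]: "cuntz_rel X X \<longleftrightarrow> cuntz_Cauchy X"
  by (simp add: cuntz_rel_def)

lemma cuntz_null_le:
  assumes "X \<longlonglongrightarrow> 0" "\<And>k. cuntz_norm (Y k) \<le> X k"
  shows "(\<lambda>k. cuntz_norm (Y k)) \<longlonglongrightarrow> 0"
  by (rule Lim_null_comparison[OF _ assms(1)]) (simp add: assms(2) cuntz_norm_nonneg)

lemma part_equivp_cuntz_rel: "part_equivp (cuntz_rel :: (nat \<Rightarrow> 'n::finite free) \<Rightarrow> _)"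
proof (rule part_equivpI)
  have "cuntz_rel (\<lambda>k. 0 :: 'n free) (\<lambda>k. 0)" by simp
  then show "\<exists>X :: nat \<Rightarrow> 'n free. cuntz_rel X X" by blast
  show "symp (cuntz_rel :: (nat \<Rightarrow> 'n free) \<Rightarrow> _)"
    by (rule sympI) (simp add: cuntz_rel_def cn_commute)
  show "transp (cuntz_rel :: (nat \<Rightarrow> 'n free) \<Rightarrow> _)"
  proof (rule transpI)
    fix X Y Z :: "nat \<Rightarrow> 'n free" assume *: "cuntz_rel X Y" "cuntz_rel Y Z"
    then have "(\<lambda>k. cuntz_norm (X k - Y k) + cuntz_norm (Y k - Z k)) \<longlonglongrightarrow> 0 + 0"
      unfolding cuntz_rel_def by (intro tendsto_add) auto
    then have "(\<lambda>k. cuntz_norm (X k - Z k)) \<longlonglongrightarrow> 0"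
      by (intro cuntz_null_le) (auto simp: cn_triangle)
    with * show "cuntz_rel X Z" by (simp add: cuntz_rel_def)
  qed
qed

quotient_type 'n cuntz = "nat \<Rightarrow> 'n::finite free" / partial: cuntz_rel
  by (rule part_equivp_cuntz_rel)

lemma cuntz_rel_lipschitz:
  assumes "cuntz_rel X Y" "\<And>a b. cuntz_norm (f a - f b) \<le> C * cuntz_norm (a - b)"
  shows "cuntz_rel (\<lambda>k. f (X k)) (\<lambda>k. f (Y k))"
proof -
  have "(\<lambda>k. C * cuntz_norm (X k - Y k)) \<longlonglongrightarrow> C * 0"
    using assms(1) unfolding cuntz_rel_def by (intro tendsto_intros) auto
  then have "(\<lambda>k. cuntz_norm (f (X k) - f (Y k))) \<longlonglongrightarrow> 0"
    by (intro cuntz_null_le[OF _ assms(2)]) simp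
  then show ?thesis
    using assms cuntz_Cauchy_lipschitz[OF _ assms(2)] unfolding cuntz_rel_def by blast
qed

lemma cuntz_rel_uminus: "cuntz_rel X Y \<Longrightarrow> cuntz_rel (\<lambda>k. - X k) (\<lambda>k. - Y k)"
  by (erule cuntz_rel_lipschitz[where f = uminus and C = 1]) (simp only: cn_uminus_diff mult_1_left order_refl)

lemma cuntz_rel_scale:
  "cuntz_rel X Y \<Longrightarrow> cuntz_rel (\<lambda>k. free_scale c (X k)) (\<lambda>k. free_scale c (Y k))"
  by (erule cuntz_rel_lipschitz[where f = "free_scale c" and C = "cmod c"])
     (simp add: cn_scale flip: free_scale_simps)

lemma cuntz_rel_star: "cuntz_rel X Y \<Longrightarrow> cuntz_rel (\<lambda>k. free_star (X k)) (\<lambda>k. free_star (Y k))"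
  by (erule cuntz_rel_lipschitz[where f = free_star and C = 1])
     (simp add: cn_star flip: free_star_diff)

lemma cuntz_Cauchy_uminus: "cuntz_Cauchy X \<Longrightarrow> cuntz_Cauchy (\<lambda>k. - X k)"
  using cuntz_rel_uminus[of X X] by (simp add: cuntz_rel_def)

lemma cuntz_Cauchy_scale: "cuntz_Cauchy X \<Longrightarrow> cuntz_Cauchy (\<lambda>k. free_scale c (X k))"
  using cuntz_rel_scale[of X X] by (simp add: cuntz_rel_def)

lemma cuntz_Cauchy_star: "cuntz_Cauchy X \<Longrightarrow> cuntz_Cauchy (\<lambda>k. free_star (X k))"
  using cuntz_rel_star[of X X] by (simp add: cuntz_rel_def)

lemmas cuntz_Cauchy_intros =
  cuntz_Cauchy_add cuntz_Cauchy_mult cuntz_Cauchy_uminus cuntz_Cauchy_scale cuntz_Cauchy_star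

lemma cuntz_rel_add:
  assumes "cuntz_rel X X'" "cuntz_rel Y Y'"
  shows "cuntz_rel (\<lambda>k. X k + Y k) (\<lambda>k. X' k + Y' k)"
proof -
  have "(\<lambda>k. cuntz_norm (X k - X' k) + cuntz_norm (Y k - Y' k)) \<longlonglongrightarrow> 0 + 0"
    using assms unfolding cuntz_rel_def by (intro tendsto_add) auto
  moreover have "cuntz_norm ((X k + Y k) - (X' k + Y' k)) \<le>
      cuntz_norm (X k - X' k) + cuntz_norm (Y k - Y' k)" for k
    using cn_add[of "X k - X' k" "Y k - Y' k"] by (simp add: algebra_simps)
  ultimately have "(\<lambda>k. cuntz_norm ((X k + Y k) - (X' k + Y' k))) \<longlonglongrightarrow> 0"
    by (intro cuntz_null_le) auto
  then show ?thesis using assms cuntz_Cauchy_add unfolding cuntz_rel_def by blast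
qed

lemma cuntz_rel_mult:
  assumes "cuntz_rel X X'" "cuntz_rel Y Y'"
  shows "cuntz_rel (\<lambda>k. X k * Y k) (\<lambda>k. X' k * Y' k)"
proof -
  have "cuntz_Cauchy X'" "cuntz_Cauchy Y"
    using assms unfolding cuntz_rel_def by auto
  obtain C where C: "\<And>k. cuntz_norm (X' k) \<le> C"
    using cuntz_Cauchy_bounded[OF \<open>cuntz_Cauchy X'\<close>] by metis
  obtain D where D: "\<And>k. cuntz_norm (Y k) \<le> D"
    using cuntz_Cauchy_bounded[OF \<open>cuntz_Cauchy Y\<close>] by metis
  have "(\<lambda>k. cuntz_norm (X k - X' k) * D + C * cuntz_norm (Y k - Y' k)) \<longlonglongrightarrow> 0 * D + C * 0"
    using assms unfolding cuntz_rel_def by (intro tendsto_intros) auto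
  moreover have "cuntz_norm (X k * Y k - X' k * Y' k) \<le>
      cuntz_norm (X k - X' k) * D + C * cuntz_norm (Y k - Y' k)" for k
    by (rule order_trans[OF cn_mult_diff])
       (intro add_mono mult_left_mono mult_right_mono C D cuntz_norm_nonneg)
  ultimately have "(\<lambda>k. cuntz_norm (X k * Y k - X' k * Y' k)) \<longlonglongrightarrow> 0"
    by (intro cuntz_null_le) auto
  then show ?thesis using assms cuntz_Cauchy_mult unfolding cuntz_rel_def by blast
qed

lemma cuntz_norm_convergent:
  assumes "cuntz_Cauchy X"
  shows "convergent (\<lambda>k. cuntz_norm (X k))"
proof (rule Cauchy_convergent, rule CauchyI)
  fix e :: real assume "e > 0"
  then obtain M where "\<And>m k. m \<ge> M \<Longrightarrow> k \<ge> M \<Longrightarrow> cuntz_norm (X m - X k) < e"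
    using assms unfolding cuntz_Cauchy_def by meson
  then have "norm (cuntz_norm (X m) - cuntz_norm (X k)) < e" if "m \<ge> M" "k \<ge> M" for m k
    using that cn_diff[of "X m" "X k"] by (smt (verit) real_norm_def)
  then show "\<exists>M. \<forall>m\<ge>M. \<forall>k\<ge>M. norm (cuntz_norm (X m) - cuntz_norm (X k)) < e" by blast
qed

lemma cuntz_norm_tendsto_lim:
  "cuntz_Cauchy X \<Longrightarrow> (\<lambda>k. cuntz_norm (X k)) \<longlonglongrightarrow> lim (\<lambda>k. cuntz_norm (X k))"
  using cuntz_norm_convergent convergent_LIMSEQ_iff by blast

lift_definition cuntz_of_free :: "'n::finite free \<Rightarrow> 'n cuntz" is "\<lambda>a k. a"
  by simp

instantiation cuntz :: (finite) "{ring, monoid_mult}"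
begin

lift_definition zero_cuntz :: "'a cuntz" is "\<lambda>k. 0" by simp
lift_definition one_cuntz :: "'a cuntz" is "\<lambda>k. 1" by simp
lift_definition plus_cuntz :: "'a cuntz \<Rightarrow> 'a cuntz \<Rightarrow> 'a cuntz" is "\<lambda>X Y k. X k + Y k"
  by (rule cuntz_rel_add)
lift_definition uminus_cuntz :: "'a cuntz \<Rightarrow> 'a cuntz" is "\<lambda>X k. - X k"
  by (rule cuntz_rel_uminus)
lift_definition times_cuntz :: "'a cuntz \<Rightarrow> 'a cuntz \<Rightarrow> 'a cuntz" is "\<lambda>X Y k. X k * Y k"
  by (rule cuntz_rel_mult)
definition "x - y = x + - (y :: 'a cuntz)"

instance
proof
  fix a b c :: "'a cuntz"
  show "a + b + c = a + (b + c)" by transfer (simp add: add.assoc cuntz_Cauchy_add)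
  show "a + b = b + a" by transfer (simp add: add.commute cuntz_Cauchy_add)
  show "0 + a = a" by transfer simp
  show "- a + a = 0" by transfer simp
  show "a - b = a + - b" by (simp add: minus_cuntz_def)
  show "a * b * c = a * (b * c)" by transfer (simp add: mult.assoc cuntz_Cauchy_mult)
  show "1 * a = a" "a * 1 = a" by (transfer; simp)+
  show "(a + b) * c = a * c + b * c" "a * (b + c) = a * b + a * c"
    by (transfer; simp add: distrib_left distrib_right cuntz_Cauchy_add cuntz_Cauchy_mult)+
qed

end

instantiation cuntz :: (finite) "{scaleC, star}"
begin

lift_definition scaleC_cuntz :: "complex \<Rightarrow> 'a cuntz \<Rightarrow> 'a cuntz" is "\<lambda>c X k. free_scale c (X k)"
  by (rule cuntz_rel_scale)

lift_definition star_cuntz :: "'a cuntz \<Rightarrow> 'a cuntz" is "\<lambda>X k. free_star (X k)"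
  by (rule cuntz_rel_star)

instance ..

end

lift_definition cuntz_completion_norm :: "'n::finite cuntz \<Rightarrow> real" is "\<lambda>X. lim (\<lambda>k. cuntz_norm (X k))"
proof -
  fix X Y :: "nat \<Rightarrow> 'n free" assume *: "cuntz_rel X Y"
  then have "(\<lambda>k. cuntz_norm (X k) - cuntz_norm (Y k)) \<longlonglongrightarrow>
      lim (\<lambda>k. cuntz_norm (X k)) - lim (\<lambda>k. cuntz_norm (Y k))"
    unfolding cuntz_rel_def by (intro tendsto_diff cuntz_norm_tendsto_lim) auto
  moreover have "(\<lambda>k. cuntz_norm (X k) - cuntz_norm (Y k)) \<longlonglongrightarrow> 0"
    using * unfolding cuntz_rel_def
    by (elim conjE, rule_tac Lim_null_comparison[where g = "\<lambda>k. cuntz_norm (X k - Y k)"]) (simp_all add: cn_diff)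
  ultimately show "lim (\<lambda>k. cuntz_norm (X k)) = lim (\<lambda>k. cuntz_norm (Y k))"
    using LIMSEQ_unique by fastforce
qed

lemma norm_cuntz_eqI: "cuntz_Cauchy X \<Longrightarrow> (\<lambda>k. cuntz_norm (X k)) \<longlonglongrightarrow> l \<Longrightarrow> cuntz_completion_norm (abs_cuntz X) = l"
  by (simp add: cuntz_completion_norm.abs_eq limI)

lemma cuntz_exhaust:
  obtains X where "cuntz_Cauchy X" "x = abs_cuntz X"
  by (metis Quotient3_cuntz Quotient3_def cuntz_rel_refl)

lemma tendsto_norm_abs_cuntz:
  "cuntz_Cauchy X \<Longrightarrow> (\<lambda>k. cuntz_norm (X k)) \<longlonglongrightarrow> cuntz_completion_norm (abs_cuntz X)"
  by (simp add: cuntz_completion_norm.abs_eq cuntz_norm_tendsto_lim)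

lemma scaleC_cuntz_laws:
  fixes x y :: "'n::finite cuntz"
  shows "c *\<^sub>C (x + y) = c *\<^sub>C x + c *\<^sub>C y" "(c + d) *\<^sub>C x = c *\<^sub>C x + d *\<^sub>C x"
    "c *\<^sub>C d *\<^sub>C x = (c * d) *\<^sub>C x" "1 *\<^sub>C x = x"
    "(c *\<^sub>C x) * y = c *\<^sub>C (x * y)" "x * (c *\<^sub>C y) = c *\<^sub>C (x * y)"
  by (transfer; simp add: free_scale_simps free_scale_mult_left free_scale_mult_right cuntz_Cauchy_intros)+

lemma norm_cuntz_laws:
  fixes x y :: "'n::finite cuntz"
  shows "cuntz_completion_norm x = 0 \<longleftrightarrow> x = 0" "cuntz_completion_norm (x + y) \<le> cuntz_completion_norm x + cuntz_completion_norm y" "cuntz_completion_norm (c *\<^sub>C x) = cmod c * cuntz_completion_norm x"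
    "cuntz_completion_norm (x * y) \<le> cuntz_completion_norm x * cuntz_completion_norm y" "cuntz_completion_norm (star x * x) = (cuntz_completion_norm x)\<^sup>2"
proof -
  obtain X where X: "cuntz_Cauchy X" "x = abs_cuntz X" by (rule cuntz_exhaust)
  obtain Y where Y: "cuntz_Cauchy Y" "y = abs_cuntz Y" by (rule cuntz_exhaust)
  note nX = tendsto_norm_abs_cuntz[OF X(1), folded X(2)]
  note nY = tendsto_norm_abs_cuntz[OF Y(1), folded Y(2)]
  have "x = 0 \<longleftrightarrow> cuntz_rel X (\<lambda>k. 0)"
    unfolding X(2) zero_cuntz_def
    using Quotient3_rel[OF Quotient3_cuntz, of X "\<lambda>k. 0"] X(1) by simp
  also have "\<dots> \<longleftrightarrow> (\<lambda>k. cuntz_norm (X k)) \<longlonglongrightarrow> 0"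
    using X by (simp add: cuntz_rel_def)
  finally show "cuntz_completion_norm x = 0 \<longleftrightarrow> x = 0"
    using nX LIMSEQ_unique by auto
  have "x + y = abs_cuntz (\<lambda>k. X k + Y k)"
    using X Y by (simp add: plus_cuntz.abs_eq)
  then have "(\<lambda>k. cuntz_norm (X k + Y k)) \<longlonglongrightarrow> cuntz_completion_norm (x + y)"
    using tendsto_norm_abs_cuntz[OF cuntz_Cauchy_add[OF X(1) Y(1)]] by simp
  then show "cuntz_completion_norm (x + y) \<le> cuntz_completion_norm x + cuntz_completion_norm y"
    by (rule LIMSEQ_le[OF _ tendsto_add[OF nX nY]]) (auto simp: cn_add)
  have "x * y = abs_cuntz (\<lambda>k. X k * Y k)"
    using X Y by (simp add: times_cuntz.abs_eq)
  then have "(\<lambda>k. cuntz_norm (X k * Y k)) \<longlonglongrightarrow> cuntz_completion_norm (x * y)"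
    using tendsto_norm_abs_cuntz[OF cuntz_Cauchy_mult[OF X(1) Y(1)]] by simp
  then show "cuntz_completion_norm (x * y) \<le> cuntz_completion_norm x * cuntz_completion_norm y"
    by (rule LIMSEQ_le[OF _ tendsto_mult[OF nX nY]]) (auto simp: cn_mult)
  have "c *\<^sub>C x = abs_cuntz (\<lambda>k. free_scale c (X k))"
    using X by (simp add: scaleC_cuntz.abs_eq)
  then have "(\<lambda>k. cuntz_norm (free_scale c (X k))) \<longlonglongrightarrow> cuntz_completion_norm (c *\<^sub>C x)"
    using tendsto_norm_abs_cuntz[OF cuntz_Cauchy_scale[OF X(1)]] by simp
  then show "cuntz_completion_norm (c *\<^sub>C x) = cmod c * cuntz_completion_norm x"
    unfolding cn_scale using LIMSEQ_unique tendsto_mult_left[OF nX] by blast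
  have "star x * x = abs_cuntz (\<lambda>k. free_star (X k) * X k)"
    using X by (simp add: star_cuntz.abs_eq times_cuntz.abs_eq cuntz_Cauchy_star)
  then have "(\<lambda>k. cuntz_norm (free_star (X k) * X k)) \<longlonglongrightarrow> cuntz_completion_norm (star x * x)"
    using tendsto_norm_abs_cuntz[OF cuntz_Cauchy_mult[OF cuntz_Cauchy_star[OF X(1)] X(1)]] by simp
  then show "cuntz_completion_norm (star x * x) = (cuntz_completion_norm x)\<^sup>2"
    unfolding cn_cstar using LIMSEQ_unique tendsto_power[OF nX] by blast
qed

instantiation cuntz :: (finite) real_normed_algebra
begin

definition norm_cuntz :: "'a cuntz \<Rightarrow> real" where
  "norm_cuntz = cuntz_completion_norm"
definition scaleR_cuntz :: "real \<Rightarrow> 'a cuntz \<Rightarrow> 'a cuntz" where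
  "scaleR_cuntz r x = complex_of_real r *\<^sub>C x"
definition dist_cuntz :: "'a cuntz \<Rightarrow> 'a cuntz \<Rightarrow> real" where
  "dist_cuntz x y = norm (x - y)"
definition sgn_cuntz :: "'a cuntz \<Rightarrow> 'a cuntz" where
  "sgn_cuntz x = inverse (norm x) *\<^sub>R x"
definition uniformity_cuntz :: "('a cuntz \<times> 'a cuntz) filter" where
  "uniformity_cuntz = (INF e\<in>{0 <..}. principal {(x, y). dist x y < e})"
definition open_cuntz :: "'a cuntz set \<Rightarrow> bool" where
  "open_cuntz U = (\<forall>x\<in>U. \<forall>\<^sub>F (x', y) in uniformity. x' = x \<longrightarrow> y \<in> U)"

instance
  by standard
     (auto simp: dist_cuntz_def sgn_cuntz_def uniformity_cuntz_def open_cuntz_def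
        scaleR_cuntz_def scaleC_cuntz_laws norm_cuntz_def norm_cuntz_laws)

end

lemma norm_abs_cuntz_tendsto:
  "cuntz_Cauchy X \<Longrightarrow> (\<lambda>k. cuntz_norm (X k)) \<longlonglongrightarrow> norm (abs_cuntz X)"
  by (simp add: norm_cuntz_def tendsto_norm_abs_cuntz)

lemma cuntz_of_free_simps:
  "cuntz_of_free 0 = 0" "cuntz_of_free 1 = 1"
  "cuntz_of_free (a + b) = cuntz_of_free a + cuntz_of_free b"
  "cuntz_of_free (a * b) = cuntz_of_free a * cuntz_of_free b"
  "cuntz_of_free (free_scale c a) = c *\<^sub>C cuntz_of_free a"
  "cuntz_of_free (free_star a) = star (cuntz_of_free a)"
  "cuntz_of_free (- a) = - cuntz_of_free a"
  by (transfer; simp)+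

lemma cuntz_of_free_diff: "cuntz_of_free (a - b) = cuntz_of_free a - cuntz_of_free b"
  using cuntz_of_free_simps(3)[of a "- b"] by (simp add: cuntz_of_free_simps)

lemma norm_cuntz_of_free: "norm (cuntz_of_free a) = cuntz_norm a"
  by (simp add: cuntz_of_free.abs_eq norm_cuntz_def norm_cuntz_eqI)

lemma cuntz_of_free_tendsto:
  assumes X: "cuntz_Cauchy X"
  shows "(\<lambda>k. cuntz_of_free (X k)) \<longlonglongrightarrow> abs_cuntz X"
proof (rule LIMSEQ_I)
  fix e :: real assume "e > 0"
  then obtain M where M: "\<And>m k. m \<ge> M \<Longrightarrow> k \<ge> M \<Longrightarrow> cuntz_norm (X m - X k) < e / 2"
    using X unfolding cuntz_Cauchy_def by (meson half_gt_zero)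
  have "norm (cuntz_of_free (X m) - abs_cuntz X) < e" if "m \<ge> M" for m
  proof -
    note C = cuntz_Cauchy_uminus[OF X]
    have C': "cuntz_Cauchy (\<lambda>k. X m + - X k)"
      using cuntz_Cauchy_add[OF _ C, of "\<lambda>k. X m"] by simp
    have "cuntz_of_free (X m) - abs_cuntz X = abs_cuntz (\<lambda>k. X m + - X k)"
      using X C by (simp add: cuntz_of_free.abs_eq minus_cuntz_def uminus_cuntz.abs_eq plus_cuntz.abs_eq)
    then have "(\<lambda>k. cuntz_norm (X m - X k)) \<longlonglongrightarrow> norm (cuntz_of_free (X m) - abs_cuntz X)"
      using norm_abs_cuntz_tendsto[OF C'] by simp
    then have "norm (cuntz_of_free (X m) - abs_cuntz X) \<le> e / 2"
      by (rule LIMSEQ_le_const2) (use M that in \<open>auto intro!: exI[of _ M] less_imp_le\<close>)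
    then show ?thesis using \<open>e > 0\<close> by simp
  qed
  then show "\<exists>M. \<forall>m\<ge>M. norm (cuntz_of_free (X m) - abs_cuntz X) < e" by blast
qed

lemma cuntz_dense:
  assumes "e > 0" obtains a where "norm (x - cuntz_of_free a) < e"
proof -
  obtain X where X: "cuntz_Cauchy X" "x = abs_cuntz X" by (rule cuntz_exhaust)
  from LIMSEQ_D[OF cuntz_of_free_tendsto[OF X(1)] assms]
  obtain k where "norm (cuntz_of_free (X k) - x) < e" using X(2) by blast
  then show thesis using that by (simp add: norm_minus_commute)
qed

instance cuntz :: (finite) banach
proof
  fix x :: "nat \<Rightarrow> 'a cuntz" assume x: "Cauchy x"
  have "\<forall>k. \<exists>a. norm (x k - cuntz_of_free a) < inverse (real (Suc k))"
    by (meson cuntz_dense inverse_positive_iff_positive of_nat_0_less_iff zero_less_Suc)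
  then obtain A where A: "\<And>k. norm (x k - cuntz_of_free (A k)) < inverse (real (Suc k))"
    by metis
  have lim: "(\<lambda>k. x k - cuntz_of_free (A k)) \<longlonglongrightarrow> 0"
    by (rule Lim_null_comparison[OF _ LIMSEQ_inverse_real_of_nat]) (intro always_eventually allI less_imp_le A)
  have "Cauchy (\<lambda>k. cuntz_of_free (A k))"
  proof (rule CauchyI)
    fix e :: real assume "e > 0"
    then have e: "e / 2 > 0" by simp
    obtain M where M: "\<And>m k. m \<ge> M \<Longrightarrow> k \<ge> M \<Longrightarrow> norm (x m - x k) < e / 2"
      using CauchyD[OF x e] by blast
    obtain N where N: "\<And>m k. m \<ge> N \<Longrightarrow> k \<ge> N \<Longrightarrow>
        norm ((x m - cuntz_of_free (A m)) - (x k - cuntz_of_free (A k))) < e / 2"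
      using CauchyD[OF LIMSEQ_imp_Cauchy[OF lim] e] by blast
    have "norm (cuntz_of_free (A m) - cuntz_of_free (A k)) < e" if "m \<ge> max M N" "k \<ge> max M N" for m k
      using norm_triangle_ineq4[of "x m - x k" "(x m - cuntz_of_free (A m)) - (x k - cuntz_of_free (A k))"]
        M[of m k] N[of m k] that by (simp add: algebra_simps)
    then show "\<exists>M. \<forall>m\<ge>M. \<forall>k\<ge>M. norm (cuntz_of_free (A m) - cuntz_of_free (A k)) < e" by blast
  qed
  then have "cuntz_Cauchy A"
    unfolding cuntz_Cauchy_def Cauchy_iff
    by (simp add: norm_cuntz_of_free flip: cuntz_of_free_diff)
  from tendsto_add[OF lim cuntz_of_free_tendsto[OF this]]
  have "x \<longlonglongrightarrow> abs_cuntz A" by simp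
  then show "convergent x" by (rule convergentI)
qed

instance cuntz :: (finite) unital_cstar_algebra
proof
  fix x y :: "'a cuntz" and c d :: complex and r :: real
  show "complex_of_real r *\<^sub>C x = r *\<^sub>R x" by (simp add: scaleR_cuntz_def)
  show "c *\<^sub>C (x + y) = c *\<^sub>C x + c *\<^sub>C y" "(c + d) *\<^sub>C x = c *\<^sub>C x + d *\<^sub>C x"
    "c *\<^sub>C d *\<^sub>C x = (c * d) *\<^sub>C x"
    "(c *\<^sub>C x) * y = c *\<^sub>C (x * y)" "x * (c *\<^sub>C y) = c *\<^sub>C (x * y)"
    by (rule scaleC_cuntz_laws)+
  show "norm (c *\<^sub>C x) = cmod c * norm x" "norm (star x * x) = (norm x)\<^sup>2"
    unfolding norm_cuntz_def by (rule norm_cuntz_laws)+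
  show "star (star x) = x" "star (x + y) = star x + star y" "star (x * y) = star y * star x"
    "star (c *\<^sub>C x) = cnj c *\<^sub>C star x"
    by (transfer; simp add: free_star_add free_star_mult free_star_scale cuntz_Cauchy_intros)+
qed

definition cuntz_gen :: "'n::finite \<Rightarrow> 'n cuntz" where
  "cuntz_gen i = cuntz_of_free (free_gen i)"

text \<open>The defining relations of the Cuntz algebra, for a family in any unital C*-algebra.\<close>

definition cuntz_family :: "('n::finite \<Rightarrow> 'a::unital_cstar_algebra) \<Rightarrow> bool" where
  "cuntz_family t \<longleftrightarrow>
     (\<forall>i j. star (t i) * t j = (if i = j then 1 else 0)) \<and> (\<Sum>i\<in>UNIV. t i * star (t i)) = 1"

lemma cuntz_of_free_sum: "cuntz_of_free (\<Sum>i\<in>A. f i) = (\<Sum>i\<in>A. cuntz_of_free (f i))"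
  by (induction A rule: infinite_finite_induct) (simp_all add: cuntz_of_free_simps)

lemma cuntz_family_gen: "cuntz_family (cuntz_gen :: 'n::finite \<Rightarrow> 'n cuntz)"
proof -
  have "norm (star (cuntz_gen i) * cuntz_gen j - (if i = j then 1 else 0)) = 0" for i j :: 'n
    using cn_rel1[of i j] norm_cuntz_of_free[of "free_star (free_gen i) * free_gen j - (if i = j then 1 else 0)"]
    by (simp add: cuntz_gen_def cuntz_of_free_simps cuntz_of_free_diff split: if_splits)
  moreover have "norm ((\<Sum>i\<in>(UNIV::'n set). cuntz_gen i * star (cuntz_gen i)) - 1) = 0"
    using cn_rel2 norm_cuntz_of_free[of "(\<Sum>i\<in>(UNIV::'n set). free_gen i * free_star (free_gen i)) - 1"]
    by (simp add: cuntz_gen_def cuntz_of_free_simps cuntz_of_free_diff cuntz_of_free_sum)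
  ultimately show ?thesis
    by (simp add: cuntz_family_def del: norm_eq_zero) (simp split: if_splits)
qed

fun gen_eval :: "('n \<Rightarrow> 'a::unital_cstar_algebra) \<Rightarrow> 'n gen \<Rightarrow> 'a" where
  "gen_eval t (Gen i) = t i"
| "gen_eval t (Gen_star i) = star (t i)"

definition word_eval :: "('n \<Rightarrow> 'a::unital_cstar_algebra) \<Rightarrow> 'n word \<Rightarrow> 'a" where
  "word_eval t w = prod_list (map (gen_eval t) (letters w))"

definition free_eval :: "('n \<Rightarrow> 'a::unital_cstar_algebra) \<Rightarrow> 'n free \<Rightarrow> 'a" where
  "free_eval t a = (\<Sum>w\<in>Poly_Mapping.keys a. Poly_Mapping.lookup a w *\<^sub>C word_eval t w)"

lemma word_eval_simps:
  "word_eval t 0 = 1" "word_eval t (v + w) = word_eval t v * word_eval t w"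
  "word_eval t (word_star w) = star (word_eval t w)"
proof -
  show "word_eval t 0 = 1" by (simp add: word_eval_def zero_word_def)
  show "word_eval t (v + w) = word_eval t v * word_eval t w"
    by (simp add: word_eval_def plus_word_def)
  have "gen_eval t (gen_star x) = star (gen_eval t x)" for x
    by (cases x) (simp_all add: star_star)
  then have "prod_list (map (gen_eval t) (rev (map gen_star l))) = star (prod_list (map (gen_eval t) l))" for l
    by (induction l) (simp_all add: star_mult)
  then show "word_eval t (word_star w) = star (word_eval t w)"
    by (simp add: word_eval_def word_star_def)
qed

lemma free_eval_superset:
  assumes "finite K" "Poly_Mapping.keys a \<subseteq> K"
  shows "free_eval t a = (\<Sum>w\<in>K. Poly_Mapping.lookup a w *\<^sub>C word_eval t w)"
  unfolding free_eval_def using assms by (intro sum.mono_neutral_left) (auto simp: in_keys_iff)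

lemma free_eval_single: "free_eval t (Poly_Mapping.single w c) = c *\<^sub>C word_eval t w"
  by (subst free_eval_superset[of "{w}"]) auto

lemma free_eval_add: "free_eval t (a + b) = free_eval t a + free_eval t b"
proof -
  define K where "K = Poly_Mapping.keys a \<union> Poly_Mapping.keys b"
  have "finite K" "Poly_Mapping.keys a \<subseteq> K" "Poly_Mapping.keys b \<subseteq> K" "Poly_Mapping.keys (a + b) \<subseteq> K"
    using Poly_Mapping.keys_add[of a b] by (auto simp: K_def)
  then show ?thesis
    by (simp add: free_eval_superset[of K] lookup_add scaleC_add_left sum.distrib)
qed

lemma free_eval_zero: "free_eval t 0 = 0"
  using free_eval_single[of t 0 0] by simp

lemma free_eval_mult: "free_eval t (a * b) = free_eval t a * free_eval t b"
proof (induction a rule: free_induct)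
  case (single v c)
  show ?case
  proof (induction b rule: free_induct)
    case (single w d)
    then show ?case
      by (simp add: mult_single free_eval_single word_eval_simps mult_scaleC_left mult_scaleC_right
          scaleC_scaleC mult.commute)
  qed (simp add: distrib_left free_eval_add)
qed (simp add: distrib_right free_eval_add)

lemma free_eval_star: "free_eval t (free_star a) = star (free_eval t a)"
  by (induction a rule: free_induct)
     (simp_all add: free_star_single free_star_add free_eval_single free_eval_add word_eval_simps
        star_scaleC star_add)

lemma free_eval_one: "free_eval t 1 = 1"
  using free_eval_single[of t 0 1] by (simp add: word_eval_simps)

lemma free_eval_scale: "free_eval t (free_scale c a) = c *\<^sub>C free_eval t a"
  by (simp add: free_scale_def free_eval_mult free_eval_single word_eval_simps mult_scaleC_left)

lemma free_eval_gen: "free_eval t (free_gen i) = t i"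
  by (simp add: free_gen_def free_eval_single word_eval_def)

lemma free_eval_diff: "free_eval t (a - b) = free_eval t a - free_eval t b"
  using free_eval_add[of t "a - b" b] by (simp add: algebra_simps)

lemma free_eval_sum: "free_eval t (\<Sum>i\<in>A. f i) = (\<Sum>i\<in>A. free_eval t (f i))"
  by (induction A rule: infinite_finite_induct) (simp_all add: free_eval_zero free_eval_add)

lemma norm_free_eval_le:
  assumes "cuntz_family t"
  shows "norm (free_eval t a) \<le> cuntz_norm a"
proof -
  have "cuntz_seminorm (\<lambda>a. norm (free_eval t a))"
    using assms unfolding cuntz_seminorm_def cuntz_family_def
    by (auto simp: free_eval_add free_eval_scale free_eval_mult free_eval_star free_eval_diff
        free_eval_gen free_eval_one free_eval_zero free_eval_sum norm_triangle_ineq norm_scaleC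
        norm_mult_ineq cstar_identity)
  then show ?thesis by (rule cuntz_norm_upper)
qed

lemma star_hom_cuntz_of_free:
  assumes "unital_star_hom \<phi>"
  shows "\<phi> (cuntz_of_free a) = free_eval (\<lambda>i. \<phi> (cuntz_gen i)) a"
proof -
  note hom = star_hom_add[OF assms] star_hom_scaleC[OF assms] star_hom_mult[OF assms]
    star_hom_star[OF assms] star_hom_one[OF assms]
  have word: "\<phi> (cuntz_of_free (Poly_Mapping.single (Word l) 1)) = word_eval (\<lambda>i. \<phi> (cuntz_gen i)) (Word l)" for l
  proof (induction l)
    case Nil
    then show ?case
      using hom(5) by (simp add: word_eval_simps cuntz_of_free_simps flip: zero_word_def)
  next
    case (Cons x l)
    have "Poly_Mapping.single (Word (x # l)) (1::complex) =
        Poly_Mapping.single (Word [x]) 1 * Poly_Mapping.single (Word l) 1"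
      by (simp add: mult_single plus_word_def)
    moreover have "Poly_Mapping.single (Word [x]) 1 =
        (case x of Gen i \<Rightarrow> free_gen i | Gen_star i \<Rightarrow> free_star (free_gen i))"
      by (simp add: free_gen_def free_star_single word_star_def split: gen.split)
    then have "\<phi> (cuntz_of_free (Poly_Mapping.single (Word [x]) 1)) = gen_eval (\<lambda>i. \<phi> (cuntz_gen i)) x"
      by (cases x) (simp_all add: cuntz_of_free_simps hom cuntz_gen_def)
    ultimately show ?case
      using Cons by (simp add: cuntz_of_free_simps hom word_eval_def)
  qed
  show ?thesis
  proof (induction a rule: free_induct)
    case (single w c)
    have "Poly_Mapping.single w c = free_scale c (Poly_Mapping.single (Word (letters w)) 1)"
      by (simp add: free_scale_def mult_single)
    then show ?case
      using word[of "letters w"] by (simp add: cuntz_of_free_simps hom free_eval_scale free_eval_single)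
  qed (simp add: cuntz_of_free_simps hom free_eval_add)
qed

theorem cuntz_universal:
  fixes t :: "'n::finite \<Rightarrow> 'a::unital_cstar_algebra"
  assumes t: "cuntz_family t"
  shows "\<exists>!\<phi> :: 'n cuntz \<Rightarrow> 'a. unital_star_hom \<phi> \<and> (\<forall>i. \<phi> (cuntz_gen i) = t i)"
proof (rule ex_ex1I)
  have rep: "cuntz_Cauchy (rep_cuntz x) \<and> abs_cuntz (rep_cuntz x) = x" for x :: "'n cuntz"
    using Quotient3_cuntz unfolding Quotient3_def cuntz_rel_refl by blast
  have rep_tendsto: "(\<lambda>k. cuntz_of_free (rep_cuntz x k)) \<longlonglongrightarrow> x" for x :: "'n cuntz"
    using cuntz_of_free_tendsto[of "rep_cuntz x"] rep[of x] by simp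
  have norm_diff: "norm (free_eval t a - free_eval t b) \<le> norm (cuntz_of_free a - cuntz_of_free b)" for a b
    using norm_free_eval_le[OF t, of "a - b"]
    by (simp add: norm_cuntz_of_free free_eval_diff flip: cuntz_of_free_diff)
  define \<phi> where "\<phi> x = lim (\<lambda>k. free_eval t (rep_cuntz x k))" for x :: "'n cuntz"
  have lim_rep: "(\<lambda>k. free_eval t (rep_cuntz x k)) \<longlonglongrightarrow> \<phi> x" for x
  proof -
    have "Cauchy (\<lambda>k. free_eval t (rep_cuntz x k))"
    proof (rule CauchyI)
      fix e :: real assume "e > 0"
      then obtain M where "\<And>m k. m \<ge> M \<Longrightarrow> k \<ge> M \<Longrightarrow>
          norm (cuntz_of_free (rep_cuntz x m) - cuntz_of_free (rep_cuntz x k)) < e"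
        using CauchyD[OF LIMSEQ_imp_Cauchy[OF rep_tendsto[of x]]] by meson
      then show "\<exists>M. \<forall>m\<ge>M. \<forall>k\<ge>M. norm (free_eval t (rep_cuntz x m) - free_eval t (rep_cuntz x k)) < e"
        using norm_diff by (meson le_less_trans)
    qed
    then show ?thesis
      unfolding \<phi>_def using Cauchy_convergent convergent_LIMSEQ_iff by blast
  qed
  have lim: "(\<lambda>k. free_eval t (A k)) \<longlonglongrightarrow> \<phi> x" if "(\<lambda>k. cuntz_of_free (A k)) \<longlonglongrightarrow> x" for A x
  proof -
    have "(\<lambda>k. norm (cuntz_of_free (A k) - cuntz_of_free (rep_cuntz x k))) \<longlonglongrightarrow> 0"
      using tendsto_norm[OF tendsto_diff[OF that rep_tendsto[of x]]] by simp
    then have "(\<lambda>k. free_eval t (A k) - free_eval t (rep_cuntz x k)) \<longlonglongrightarrow> 0"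
      by (rule Lim_null_comparison[OF always_eventually, rotated]) (simp add: norm_diff)
    from tendsto_add[OF this lim_rep[of x]] show ?thesis by simp
  qed
  have eq: "\<phi> (cuntz_of_free a) = free_eval t a" for a
    using LIMSEQ_unique[OF lim[of "\<lambda>k. a" "cuntz_of_free a"] tendsto_const] by simp
  have "unital_star_hom \<phi>"
    unfolding unital_star_hom_def
  proof (intro conjI allI)
    fix x y and c
    note X = rep_tendsto[of x] and Y = rep_tendsto[of y]
    show "\<phi> (x + y) = \<phi> x + \<phi> y"
      using LIMSEQ_unique[OF lim[of "\<lambda>k. rep_cuntz x k + rep_cuntz y k" "x + y"]
          tendsto_add[OF lim_rep lim_rep, of x y, folded free_eval_add]] tendsto_add[OF X Y]
      by (simp add: cuntz_of_free_simps)
    show "\<phi> (x * y) = \<phi> x * \<phi> y"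
      using LIMSEQ_unique[OF lim[of "\<lambda>k. rep_cuntz x k * rep_cuntz y k" "x * y"]
          tendsto_mult[OF lim_rep lim_rep, of x y, folded free_eval_mult]] tendsto_mult[OF X Y]
      by (simp add: cuntz_of_free_simps)
    show "\<phi> (c *\<^sub>C x) = c *\<^sub>C \<phi> x"
      using LIMSEQ_unique[OF lim[of "\<lambda>k. free_scale c (rep_cuntz x k)" "c *\<^sub>C x"]
          bounded_linear.tendsto[OF bounded_linear_scaleC lim_rep, of c x, folded free_eval_scale]]
        bounded_linear.tendsto[OF bounded_linear_scaleC X, of c]
      by (simp add: cuntz_of_free_simps)
    show "\<phi> (star x) = star (\<phi> x)"
      using LIMSEQ_unique[OF lim[of "\<lambda>k. free_star (rep_cuntz x k)" "star x"]
          bounded_linear.tendsto[OF bounded_linear_star lim_rep, of x, folded free_eval_star]]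
        bounded_linear.tendsto[OF bounded_linear_star X]
      by (simp add: cuntz_of_free_simps)
    show "\<phi> 1 = 1"
      using eq[of 1] by (simp add: cuntz_of_free_simps free_eval_one)
  qed
  moreover have "\<phi> (cuntz_gen i) = t i" for i
    by (simp add: cuntz_gen_def eq free_eval_gen)
  ultimately show "\<exists>\<phi> :: 'n cuntz \<Rightarrow> 'a. unital_star_hom \<phi> \<and> (\<forall>i. \<phi> (cuntz_gen i) = t i)" by blast
next
  fix \<phi> \<psi> :: "'n cuntz \<Rightarrow> 'a"
  assume \<phi>: "unital_star_hom \<phi> \<and> (\<forall>i. \<phi> (cuntz_gen i) = t i)"
    and \<psi>: "unital_star_hom \<psi> \<and> (\<forall>i. \<psi> (cuntz_gen i) = t i)"
  have lim: "(\<lambda>k. h (x k)) \<longlonglongrightarrow> h l" if "unital_star_hom h" "x \<longlonglongrightarrow> l" for h :: "'n cuntz \<Rightarrow> 'a" and x l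
  proof -
    have "h (y - z) = h y - h z" for y z
      using star_hom_add[OF that(1), of "y - z" z] by (simp add: algebra_simps)
    then have le: "norm (h (x k) - h l) \<le> norm (x k - l)" for k
      using star_hom_contractive[OF that(1), of "x k - l"] by simp
    have "(\<lambda>k. norm (x k - l)) \<longlonglongrightarrow> 0"
      using that(2) LIM_zero tendsto_norm_zero by blast
    then have "(\<lambda>k. h (x k) - h l) \<longlonglongrightarrow> 0"
      by (rule Lim_null_comparison[OF always_eventually, rotated]) (simp add: le)
    then show ?thesis by (rule LIM_zero_cancel)
  qed
  show "\<phi> = \<psi>"
  proof
    fix x :: "'n cuntz"
    obtain X where X: "cuntz_Cauchy X" "x = abs_cuntz X" by (rule cuntz_exhaust)
    have c: "(\<lambda>k. cuntz_of_free (X k)) \<longlonglongrightarrow> x"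
      using cuntz_of_free_tendsto[OF X(1)] X(2) by simp
    have "\<phi> (cuntz_of_free a) = \<psi> (cuntz_of_free a)" for a
      using \<phi> \<psi> by (simp add: star_hom_cuntz_of_free)
    then have "(\<lambda>k. \<psi> (cuntz_of_free (X k))) \<longlonglongrightarrow> \<phi> x"
      using lim[OF conjunct1[OF \<phi>] c] by simp
    then show "\<phi> x = \<psi> x"
      using lim[OF conjunct1[OF \<psi>] c] by (rule LIMSEQ_unique)
  qed
qed

section \<open>Sub-Cuntz states and the canonical action of the unitary group\<close>

text \<open>
  A multi-index J of length m is a list, and a vector of the m-th tensor power of
  \<open>\<complex>\<^sup>n\<close> is the family of its coordinates, extended by zero to lists of other lengths.
\<close>

definition tensor_space :: "nat \<Rightarrow> ('n::finite list \<Rightarrow> complex) set" where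
  "tensor_space m = {z. \<forall>J. length J \<noteq> m \<longrightarrow> z J = 0}"

definition unit_vectors :: "nat \<Rightarrow> ('n::finite list \<Rightarrow> complex) set" where
  "unit_vectors m = {z \<in> tensor_space m. (\<Sum>J | length J = m. (cmod (z J))\<^sup>2) = 1}"

text \<open>The tensor product of a vector of degree k with a vector of arbitrary degree.\<close>

definition tensor :: "nat \<Rightarrow> ('n list \<Rightarrow> complex) \<Rightarrow> ('n list \<Rightarrow> complex) \<Rightarrow> 'n list \<Rightarrow> complex" where
  "tensor k x y = (\<lambda>J. x (take k J) * y (drop k J))"

fun tensor_power :: "nat \<Rightarrow> ('n list \<Rightarrow> complex) \<Rightarrow> nat \<Rightarrow> 'n list \<Rightarrow> complex" where
  "tensor_power k x 0 = (\<lambda>J. if J = [] then 1 else 0)"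
| "tensor_power k x (Suc p) = tensor k x (tensor_power k x p)"

definition nonperiodic :: "('n::finite list \<Rightarrow> complex) \<Rightarrow> bool" where
  "nonperiodic z \<longleftrightarrow>
     (\<forall>p\<ge>1. \<forall>k\<ge>1. \<forall>x\<in>tensor_space k. z = tensor_power k x p \<longrightarrow> p = 1)"

definition nonperiodic_vectors :: "('n::finite list \<Rightarrow> complex) set" where
  "nonperiodic_vectors = {z \<in> (\<Union>m\<in>{1..}. unit_vectors m). nonperiodic z}"

definition cuntz_monomial :: "'n::finite list \<Rightarrow> 'n cuntz" where
  "cuntz_monomial J = prod_list (map cuntz_gen J)"

definition sub_cuntz_state :: "('n::finite list \<Rightarrow> complex) \<Rightarrow> ('n cuntz \<Rightarrow> complex) \<Rightarrow> bool" where
  "sub_cuntz_state z \<omega> \<longleftrightarrow>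
     state \<omega> \<and> (\<exists>m\<ge>1. z \<in> unit_vectors m \<and> (\<forall>J. length J = m \<longrightarrow> \<omega> (cuntz_monomial J) = cnj (z J)))"

definition the_sub_cuntz_state :: "('n::finite list \<Rightarrow> complex) \<Rightarrow> 'n cuntz \<Rightarrow> complex" where
  "the_sub_cuntz_state z = (THE \<omega>. sub_cuntz_state z \<omega>)"

definition adjoint_matrix :: "complex^'n^'n \<Rightarrow> complex^'n^'n" where
  "adjoint_matrix g = (\<chi> i j. cnj (g $ j $ i))"

definition unitary :: "complex^'n^'n \<Rightarrow> bool" where
  "unitary g \<longleftrightarrow> adjoint_matrix g ** g = mat 1 \<and> g ** adjoint_matrix g = mat 1"

definition cuntz_aut :: "complex^'n^'n \<Rightarrow> 'n::finite cuntz \<Rightarrow> 'n cuntz" where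
  "cuntz_aut g = (THE \<phi>. star_automorphism \<phi> \<and>
     (\<forall>i. \<phi> (cuntz_gen i) = (\<Sum>j\<in>UNIV. (g $ j $ i) *\<^sub>C cuntz_gen j)))"

definition cuntz_aut_dual :: "complex^'n^'n \<Rightarrow> ('n::finite cuntz \<Rightarrow> complex) \<Rightarrow> 'n cuntz \<Rightarrow> complex" where
  "cuntz_aut_dual g f = f \<circ> cuntz_aut (adjoint_matrix g)"

text \<open>The coordinates of the tensor product of a list of vectors of \<open>\<complex>\<^sup>n\<close>.\<close>

definition elementary_tensor :: "(complex^'n) list \<Rightarrow> 'n list \<Rightarrow> complex" where
  "elementary_tensor vs J =
     (if length J = length vs then \<Prod>r<length vs. vs ! r $ (J ! r) else 0)"

definition gamma_op :: "complex^'n^'n \<Rightarrow> complex^'n \<Rightarrow> complex^'n" where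
  "gamma_op g v = g *v v"

text \<open>
  The m-th tensor power of \<open>gamma_op g\<close>, simultaneously for all m: the basis vector belonging to K is
  mapped to the tensor product of the images of its factors, which has the same degree as K.
\<close>

definition Gamma_op :: "complex^'n^'n \<Rightarrow> ('n::finite list \<Rightarrow> complex) \<Rightarrow> 'n list \<Rightarrow> complex" where
  "Gamma_op g z J =
     (\<Sum>K | length K = length J. z K * elementary_tensor (map (\<lambda>k. gamma_op g (axis k 1)) K) J)"

lemma gamma_op_axis: "gamma_op g (axis i 1) = (\<Sum>j\<in>UNIV. (g $ j $ i) *s axis j 1)"
  by (simp add: gamma_op_def vec_eq_iff matrix_vector_mult_def axis_def if_distrib cong: if_cong)

end

theory Submission
  imports Defs
begin

text \<open>
  Both sides of the claimed identity are the unique state with certain values on monomials of length m. The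
  automorphism attached to the adjoint of g sends a monomial to a combination of monomials whose coefficients are the
  conjugates of the matrix that defines \<open>Gamma_op g\<close>. So composing with it turns a sub-Cuntz state
  by z into one by \<open>Gamma_op g z\<close> (\<open>sub_cuntz_state_cuntz_aut_dual\<close>). As the same holds for the adjoint
  of g, the sub-Cuntz states by the two vectors correspond to each other bijectively, and the
  identity follows once it is known that there is exactly one sub-Cuntz state by a nonperiodic unit vector z. That
  \<open>Gamma_op g z\<close> has exactly one is then a consequence, without looking at its periods.

  Uniqueness (\<open>sub_cuntz_state_unique\<close>). Let s be the isometry \<open>\<Sum>J. z\<^sub>J s\<^sub>J\<close>. The prescribed values say
  that the state is 1 on s, so the GNS vector is fixed by s (\<open>state_absorbs_isometry\<close>). Multiplying an arbitrary word by
  a high power of s reduces everything to values on monomials, and inserting the adjoint of s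
  peels off m letters at a time. What remains are the values u on monomials of
  length strictly between 0 and m. Cutting z into a matrix in the two possible ways, these values satisfy a
  pair of linear relations that a matrix of Hilbert-Schmidt norm 1 allows with nonzero u only when it has rank one. So a nonzero
  u gives vectors x and w with \<open>z = x \<otimes> w = w \<otimes> x\<close>, and commuting tensors are powers of a common vector up to
  scalars (\<open>commuting_tensors\<close>). This makes z periodic (\<open>nonperiodic_rigidity\<close>).

  Existence (\<open>sub_cuntz_state_exists\<close>). Tensoring with z on the right embeds degree k isometrically into degree
  k + m. On the inductive limit of the tensor powers of \<open>\<complex>\<^sup>n\<close> along these embeddings the generators act by
  tensoring with a basis vector on the left, and the Cuntz relations hold. The class of the empty
  tensor equals that of z, so it is a fixed vector of s, and its vector state has the required values.
  It is bounded by the operator norm of the representation, hence by the universal C*-seminorm, and extends to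
  the Cuntz algebra.
\<close>

section \<open>States on unital C*-algebras\<close>

lemma
  assumes "state \<omega>"
  shows state_add: "\<omega> (x + y) = \<omega> x + \<omega> y"
    and state_scaleC: "\<omega> (c *\<^sub>C x) = c * \<omega> x"
    and state_positive: "\<omega> (star x * x) \<in> \<real>\<^sub>\<ge>\<^sub>0"
    and state_one: "\<omega> 1 = 1"
  using assms unfolding state_def by blast+

lemma state_zero: "state \<omega> \<Longrightarrow> \<omega> 0 = 0"
  using state_scaleC[of \<omega> 0 0] by simp

lemma state_diff: "state \<omega> \<Longrightarrow> \<omega> (x - y) = \<omega> x - \<omega> y"
  using state_add[of \<omega> "x - y" y] by (simp add: algebra_simps)

lemma state_sum: "state \<omega> \<Longrightarrow> \<omega> (\<Sum>i\<in>A. f i) = (\<Sum>i\<in>A. \<omega> (f i))"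
  by (induction A rule: infinite_finite_induct) (simp_all add: state_zero state_add)

lemma star_diff: "star (x - y) = star x - star (y :: 'a::unital_cstar_algebra)"
  by (rule linear_diff[OF bounded_linear.linear[OF bounded_linear_star]])

lemma star_sum: "star (\<Sum>i\<in>A. f i) = (\<Sum>i\<in>A. star (f i :: 'a::unital_cstar_algebra))"
  using bounded_linear.linear[OF bounded_linear_star] linear_sum by blast

lemma scaleC_sum: "c *\<^sub>C (\<Sum>i\<in>A. f i) = (\<Sum>i\<in>A. c *\<^sub>C (f i :: 'a::unital_cstar_algebra))"
  using bounded_linear.linear[OF bounded_linear_scaleC] linear_sum by blast

text \<open>
  The Cauchy-Schwarz inequality for a positive semidefinite hermitian form, reduced to the values
  a and b of the form on two vectors and its value h on the pair: the assumption is positivity on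
  the first vector plus c times the second. It serves both for states and for the inner product
  that is used to construct one.
\<close>

lemma quadratic_nonneg_imp_discriminant:
  fixes a b :: real and h :: complex
  assumes "b \<ge> 0" and nonneg: "\<And>c. 0 \<le> a + 2 * Re (c * h) + (cmod c)\<^sup>2 * b"
  shows "(cmod h)\<^sup>2 \<le> a * b"
proof -
  \<comment> \<open>Minimise over the phase of \<open>c\<close>: what remains is a real parabola in \<open>t\<close>.\<close>
  have quad: "0 \<le> a - 2 * t * (cmod h)\<^sup>2 + t\<^sup>2 * (cmod h)\<^sup>2 * b" for t :: real
  proof -
    have "cnj h * h = complex_of_real ((cmod h)\<^sup>2)"
      using complex_norm_square[of h] by (simp add: mult.commute)
    then have "Re (complex_of_real (- t) * cnj h * h) = - t * (cmod h)\<^sup>2"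
      unfolding mult.assoc by (metis Re_complex_of_real of_real_mult)
    with nonneg[of "complex_of_real (- t) * cnj h"]
    have "0 \<le> a + 2 * (- t * (cmod h)\<^sup>2) + (cmod (complex_of_real (- t) * cnj h))\<^sup>2 * b"
      by (simp only:)
    then show ?thesis by (simp add: norm_mult power_mult_distrib)
  qed
  show ?thesis
  proof (cases "b = 0")
    case True
    have "(cmod h)\<^sup>2 = 0"
    proof (rule ccontr)
      assume "(cmod h)\<^sup>2 \<noteq> 0"
      \<comment> \<open>The parabola is a line of negative slope, and this argument takes it to \<open>- a - 2\<close>.\<close>
      then show False using quad[of "(a + 1) / (cmod h)\<^sup>2"] True nonneg[of 0] by simp
    qed
    then show ?thesis using True by simp
  next
    case False
    then have "b > 0" using assms(1) by simp
    have "a - 2 * (1 / b) * (cmod h)\<^sup>2 + (1 / b)\<^sup>2 * (cmod h)\<^sup>2 * b = a - (cmod h)\<^sup>2 / b"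
      using \<open>b > 0\<close> by (simp add: field_simps power2_eq_square)
    then have "(cmod h)\<^sup>2 / b \<le> a"
      using quad[of "1 / b"] by simp
    then show ?thesis
      using \<open>b > 0\<close> by (simp add: field_simps)
  qed
qed

lemma state_expand:
  assumes "state \<omega>"
  shows "\<omega> (star (x + c *\<^sub>C y) * (x + c *\<^sub>C y)) =
    \<omega> (star x * x) + c * \<omega> (star x * y) + cnj c * \<omega> (star y * x) + cnj c * c * \<omega> (star y * y)"
  by (simp add: star_add star_scaleC distrib_left distrib_right mult_scaleC_left mult_scaleC_right
      state_add[OF assms] state_scaleC[OF assms] mult.assoc)

lemma state_hermitian:
  assumes "state \<omega>"
  shows "\<omega> (star y * x) = cnj (\<omega> (star x * y))"
proof -
  have real: "Im (\<omega> (star x * x)) = 0" for x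
    using state_positive[OF assms, of x] by (simp add: complex_nonneg_Reals_iff)
  have "Im (c * \<omega> (star x * y) + cnj c * \<omega> (star y * x)) = 0" for c
    using real[of "x + c *\<^sub>C y"] real[of x] real[of y]
    by (simp add: state_expand[OF assms] )
  from this[of 1] this[of "\<i>"] show ?thesis
    by (simp add: complex_eq_iff)
qed

lemma state_star: "state \<omega> \<Longrightarrow> \<omega> (star x) = cnj (\<omega> x)"
  using state_hermitian[of \<omega> x 1] by simp

lemma state_Cauchy_Schwarz:
  assumes \<omega>: "state \<omega>"
  shows "(cmod (\<omega> (star x * y)))\<^sup>2 \<le> Re (\<omega> (star x * x)) * Re (\<omega> (star y * y))"
proof (rule quadratic_nonneg_imp_discriminant)
  have pos: "0 \<le> Re (\<omega> (star v * v))" "Im (\<omega> (star v * v)) = 0" for v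
    using state_positive[OF \<omega>, of v] by (simp_all add: complex_nonneg_Reals_iff)
  show "0 \<le> Re (\<omega> (star y * y))" by (rule pos)
  fix c
  have "Re (\<omega> (star (x + c *\<^sub>C y) * (x + c *\<^sub>C y))) =
      Re (\<omega> (star x * x)) + 2 * Re (c * \<omega> (star x * y)) + (cmod c)\<^sup>2 * Re (\<omega> (star y * y))"
    unfolding state_expand[OF \<omega>] state_hermitian[OF \<omega>, of y x] cmod_power2
    by (simp add: pos algebra_simps power2_eq_square)
  then show "0 \<le> Re (\<omega> (star x * x)) + 2 * Re (c * \<omega> (star x * y)) + (cmod c)\<^sup>2 * Re (\<omega> (star y * y))"
    using pos(1)[of "x + c *\<^sub>C y"] by simp
qed

text \<open>
  Positivity of a state is only assumed on the elements \<open>star x * x\<close>, so the bound is derived from a square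
  root. For a selfadjoint h of norm less than 1 the element \<open>1 - h * h\<close> is the square of a selfadjoint
  element, whence \<open>\<omega> (h * h) \<le> 1\<close>, and the Cauchy-Schwarz inequality gives \<open>cmod (\<omega> h) \<le> 1\<close>. A general
  x is reduced to \<open>star x * x\<close> by the Cauchy-Schwarz inequality and the C*-identity.
\<close>

lemma state_contractive:
  fixes x :: "'a::unital_cstar_algebra"
  assumes \<omega>: "state \<omega>"
  shows "cmod (\<omega> x) \<le> norm x"
proof -
  have cs: "(cmod (\<omega> y))\<^sup>2 \<le> Re (\<omega> (star y * y))" for y
    using state_Cauchy_Schwarz[OF \<omega>, of 1 y] by (simp add: state_one[OF \<omega>])
  have unit: "cmod (\<omega> h) \<le> 1" if h: "star h = h" "norm h < 1" for h
  proof -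
    obtain s where s: "star s = s" "s * s = 1 - h * h"
      using cstar_sqrt_exists[OF h] .
    have "Re (\<omega> (1 - h * h)) \<ge> 0"
      using state_positive[OF \<omega>, of s] s by (simp add: complex_nonneg_Reals_iff)
    then have "(cmod (\<omega> h))\<^sup>2 \<le> 1"
      using cs[of h] h(1) by (simp add: state_diff[OF \<omega>] state_one[OF \<omega>])
    then show ?thesis by (simp add: abs_square_le_1)
  qed
  have sa: "cmod (\<omega> h) \<le> norm h" if h: "star h = h" for h
  proof (rule ccontr)
    assume "\<not> cmod (\<omega> h) \<le> norm h"
    then obtain r where r: "norm h < r" "r < cmod (\<omega> h)"
      using dense by (metis not_le)
    then have "r > 0" using norm_ge_zero[of h] by linarith
    then have "cmod (\<omega> (inverse r *\<^sub>R h)) \<le> 1"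
      using r by (intro unit) (simp_all add: star_scaleR h field_simps)
    then have "cmod (\<omega> (complex_of_real (inverse r) *\<^sub>C h)) \<le> 1"
      unfolding scaleC_of_real .
    then have "inverse r * cmod (\<omega> h) \<le> 1"
      using \<open>r > 0\<close> unfolding state_scaleC[OF \<omega>] norm_mult by (simp add: norm_inverse)
    then show False using r \<open>r > 0\<close> by (simp add: field_simps)
  qed
  have "(cmod (\<omega> x))\<^sup>2 \<le> cmod (\<omega> (star x * x))"
    using cs[of x] complex_Re_le_cmod order_trans by blast
  also have "\<dots> \<le> norm (star x * x)"
    by (rule sa) (simp add: star_mult star_star)
  finally have "(cmod (\<omega> x))\<^sup>2 \<le> (norm x)\<^sup>2" by (simp add: cstar_identity)
  then show ?thesis by (rule power2_le_imp_le) simp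
qed

lemma cuntz_of_free_eq_free_eval: "cuntz_of_free a = free_eval cuntz_gen a"
  using star_hom_cuntz_of_free[of "\<lambda>x. x" a] by (simp add: unital_star_hom_def)

text \<open>
  States are continuous, and the words in the generators and their adjoints span a dense subspace.
\<close>

lemma state_eqI:
  fixes \<omega> \<omega>' :: "'n::finite cuntz \<Rightarrow> complex"
  assumes \<omega>: "state \<omega>" and \<omega>': "state \<omega>'"
    and words: "\<And>w. \<omega> (word_eval cuntz_gen w) = \<omega>' (word_eval cuntz_gen w)"
  shows "\<omega> = \<omega>'"
proof
  fix x
  have free: "\<omega> (cuntz_of_free a) = \<omega>' (cuntz_of_free a)" for a
    unfolding cuntz_of_free_eq_free_eval
    by (induction a rule: free_induct)
       (simp_all add: free_eval_single free_eval_add state_add[OF \<omega>] state_add[OF \<omega>']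
          state_scaleC[OF \<omega>] state_scaleC[OF \<omega>'] words)
  have "cmod (\<omega> x - \<omega>' x) \<le> e" if "e > 0" for e
  proof -
    obtain a where a: "norm (x - cuntz_of_free a) < e / 2"
      using \<open>e > 0\<close> by (meson cuntz_dense half_gt_zero)
    have "\<omega> x - \<omega>' x = \<omega> (x - cuntz_of_free a) - \<omega>' (x - cuntz_of_free a)"
      by (simp add: state_diff[OF \<omega>] state_diff[OF \<omega>'] free)
    then have "cmod (\<omega> x - \<omega>' x) \<le> cmod (\<omega> (x - cuntz_of_free a)) + cmod (\<omega>' (x - cuntz_of_free a))"
      using norm_triangle_ineq4 by metis
    also have "\<dots> \<le> norm (x - cuntz_of_free a) + norm (x - cuntz_of_free a)"
      by (intro add_mono state_contractive \<omega> \<omega>')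
    finally show ?thesis using a by simp
  qed
  then have "cmod (\<omega> x - \<omega>' x) \<le> 0"
    by (meson field_le_epsilon add_0 dense_ge)
  then show "\<omega> x = \<omega>' x" by simp
qed


section \<open>Commuting tensors and nonperiodic vectors\<close>

lemma finite_lists_length [simp]: "finite {J :: 'n::finite list. length J = m}"
  using finite_lists_length_eq[of "UNIV :: 'n set" m] by simp

lemma sum_lists_append:
  fixes f :: "'n::finite list \<Rightarrow> 'a::comm_monoid_add"
  shows "(\<Sum>J | length J = k + l. f J) = (\<Sum>M | length M = k. \<Sum>L | length L = l. f (M @ L))"
proof -
  have "(\<Sum>M | length M = k. \<Sum>L | length L = l. f (M @ L)) =
      (\<Sum>(M, L)\<in>{M. length M = k} \<times> {L. length L = l}. f (M @ L))"
    by (rule sum.cartesian_product)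
  also have "\<dots> = (\<Sum>J | length J = k + l. f J)"
    by (rule sum.reindex_bij_witness[of _ "\<lambda>J. (take k J, drop k J)" "\<lambda>(M, L). M @ L"]) auto
  finally show ?thesis ..
qed

lemma sum_lists_Cons:
  fixes f :: "'n::finite list \<Rightarrow> 'a::comm_monoid_add"
  shows "(\<Sum>J | length J = Suc k. f J) = (\<Sum>i\<in>UNIV. \<Sum>L | length L = k. f (i # L))"
proof -
  have "(\<Sum>i\<in>UNIV. \<Sum>L | length L = k. f (i # L)) =
      (\<Sum>(i, L)\<in>UNIV \<times> {L. length L = k}. f (i # L))"
    by (rule sum.cartesian_product)
  also have "\<dots> = (\<Sum>J | length J = Suc k. f J)"
    by (rule sum.reindex_bij_witness[of _ "\<lambda>J. (hd J, tl J)" "\<lambda>(i, L). i # L"]) (auto simp: length_Suc_conv)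
  finally show ?thesis ..
qed

lemma tensor_append: "length M = k \<Longrightarrow> tensor k x y (M @ L) = x M * y L"
  by (simp add: tensor_def)

lemma tensor_assoc: "tensor k x (tensor l y v) = tensor (k + l) (tensor k x y) v"
  by (rule ext) (simp add: tensor_def min_def take_drop add.commute mult.assoc)

lemma tensor_in_tensor_space:
  assumes "x \<in> tensor_space k" "y \<in> tensor_space l"
  shows "tensor k x y \<in> tensor_space (k + l)"
proof -
  have "x (take k J) * y (drop k J) = 0" if "length J \<noteq> k + l" for J
  proof (cases "k \<le> length J")
    case True
    then show ?thesis using assms that by (auto simp: tensor_space_def)
  next
    case False
    then show ?thesis using assms(1) by (auto simp: tensor_space_def)
  qed
  then show ?thesis by (simp add: tensor_space_def tensor_def)
qed

lemma tensor_power_in_tensor_space: "x \<in> tensor_space k \<Longrightarrow> tensor_power k x p \<in> tensor_space (p * k)"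
  by (induction p) (auto intro!: tensor_in_tensor_space, simp add: tensor_space_def)

lemma tensor_power_one:
  assumes "x \<in> tensor_space k"
  shows "tensor_power k x 1 = x"
proof
  fix J
  show "tensor_power k x 1 J = x J"
    using assms by (cases "length J \<le> k") (auto simp: tensor_def tensor_space_def)
qed

lemma tensor_scale:
  "tensor k (\<lambda>J. a * x J) (\<lambda>J. b * y J) = (\<lambda>J. (a * b) * tensor k x y J)"
  by (simp add: tensor_def mult_ac)

lemma tensor_power_scale: "tensor_power k (\<lambda>J. c * x J) p = (\<lambda>J. c ^ p * tensor_power k x p J)"
proof (induction p)
  case (Suc p)
  show ?case by (simp only: tensor_power.simps Suc tensor_scale power_Suc)
qed auto

lemma tensor_power_add:
  "tensor (p * k) (tensor_power k x p) (tensor_power k x q) = tensor_power k x (p + q)"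
proof (induction p)
  case (Suc p)
  have "tensor (Suc p * k) (tensor_power k x (Suc p)) (tensor_power k x q) =
      tensor k x (tensor (p * k) (tensor_power k x p) (tensor_power k x q))"
    by (simp add: tensor_assoc)
  then show ?case by (simp add: Suc.IH)
qed (simp add: tensor_def)

lemma tensor_space_eqI:
  assumes "x \<in> tensor_space m" "y \<in> tensor_space m" "\<And>J. length J = m \<Longrightarrow> x J = y J"
  shows "x = y"
proof
  fix J
  show "x J = y J"
    using assms by (cases "length J = m") (auto simp: tensor_space_def)
qed

text \<open>
  Up to scalars, x (of degree k) and w (of degree l) are tensor powers of one and the same vector.
\<close>

definition common_root :: "nat \<Rightarrow> ('n::finite list \<Rightarrow> complex) \<Rightarrow> nat \<Rightarrow> ('n list \<Rightarrow> complex) \<Rightarrow> bool" where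
  "common_root k x l w \<longleftrightarrow> (\<exists>d u p q a b. 1 \<le> d \<and> 1 \<le> p \<and> 1 \<le> q \<and> u \<in> tensor_space d \<and>
     k = p * d \<and> l = q * d \<and> x = (\<lambda>J. a * tensor_power d u p J) \<and> w = (\<lambda>J. b * tensor_power d u q J))"

lemma common_root_commute: "common_root k x l w \<Longrightarrow> common_root l w k x"
  unfolding common_root_def by metis

lemma common_root_tensor: "common_root k x l w \<Longrightarrow> common_root k x (k + l) (tensor k x w)"
proof -
  assume "common_root k x l w"
  then obtain d u p q a b where *: "1 \<le> d" "1 \<le> p" "1 \<le> q" "u \<in> tensor_space d" "k = p * d" "l = q * d"
    "x = (\<lambda>J. a * tensor_power d u p J)" "w = (\<lambda>J. b * tensor_power d u q J)"
    unfolding common_root_def by blast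
  then have "tensor k x w = (\<lambda>J. (a * b) * tensor_power d u (p + q) J)" "k + l = (p + q) * d" "1 \<le> p + q"
    by (simp_all add: tensor_scale tensor_power_add distrib_right)
  with * show ?thesis
    unfolding common_root_def by blast
qed

lemma nonzero_coordinate:
  assumes "x \<in> tensor_space k" "x \<noteq> (\<lambda>J. 0)"
  obtains M where "length M = k" "x M \<noteq> 0"
  using assms by (auto simp: tensor_space_def fun_eq_iff)

text \<open>
  If x and w commute and w has the larger degree, then x is a left tensor factor of w: evaluate both sides on
  words that end with an M0 at which x does not vanish. The other factor again commutes
  with x. This is a step of the Euclidean algorithm on the pair of degrees.
\<close>

lemma commuting_tensors_divide:
  assumes x: "x \<in> tensor_space k" "x \<noteq> (\<lambda>J. 0)" and w: "w \<in> tensor_space (k + l)" "w \<noteq> (\<lambda>J. 0)"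
    and comm: "tensor k x w = tensor (k + l) w x"
  obtains w' where "w' \<in> tensor_space l" "w' \<noteq> (\<lambda>J. 0)" "w = tensor k x w'" "tensor k x w' = tensor l w' x"
proof -
  obtain M0 where M0: "length M0 = k" "x M0 \<noteq> 0"
    using nonzero_coordinate[OF x] .
  define w' where "w' K = (if length K = l then w (K @ M0) / x M0 else 0)" for K
  have w': "w' \<in> tensor_space l"
    by (simp add: w'_def tensor_space_def)
  have fac: "w = tensor k x w'"
  proof (rule tensor_space_eqI[OF w(1) tensor_in_tensor_space[OF x(1) w']])
    fix J :: "'a list" assume J: "length J = k + l"
    have "tensor k x w (J @ M0) = x (take k J) * w (drop k J @ M0)"
      "tensor (k + l) w x (J @ M0) = w J * x M0"
      using J by (simp_all add: tensor_def)
    then show "w J = tensor k x w' J"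
      using fun_cong[OF comm, of "J @ M0"] M0 J by (simp add: w'_def tensor_def[of k x w'] field_simps)
  qed
  have "tensor k x w' = tensor l w' x"
  proof (rule tensor_space_eqI[OF tensor_in_tensor_space[OF x(1) w']])
    show "tensor l w' x \<in> tensor_space (k + l)"
      using tensor_in_tensor_space[OF w' x(1)] by (simp add: add.commute)
    fix J :: "'a list" assume J: "length J = k + l"
    have "tensor k x (tensor k x w') = tensor k x (tensor l w' x)"
      using comm fac tensor_assoc by metis
    then have "x M0 * tensor k x w' J = x M0 * tensor l w' x J"
      using tensor_append[OF M0(1)] by metis
    then show "tensor k x w' J = tensor l w' x J" using M0 by simp
  qed
  moreover have "w' \<noteq> (\<lambda>J. 0)"
    using fac w(2) by (auto simp: tensor_def)
  ultimately show thesis using that w' fac by blast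
qed

lemma commuting_tensors_same_degree:
  assumes x: "x \<in> tensor_space k" "x \<noteq> (\<lambda>J. 0)" and w: "w \<in> tensor_space k" and "1 \<le> k"
    and comm: "tensor k x w = tensor k w x"
  shows "common_root k x k w"
proof -
  obtain M0 where M0: "length M0 = k" "x M0 \<noteq> 0"
    using nonzero_coordinate[OF x] .
  have "w = (\<lambda>J. (w M0 / x M0) * x J)"
  proof (rule tensor_space_eqI[OF w])
    show "(\<lambda>J. (w M0 / x M0) * x J) \<in> tensor_space k"
      using x(1) by (simp add: tensor_space_def)
    fix J :: "'a list" assume J: "length J = k"
    have "x J * w M0 = w J * x M0"
      using fun_cong[OF comm, of "J @ M0"] J by (simp add: tensor_append)
    then show "w J = (w M0 / x M0) * x J" using M0 by (simp add: field_simps)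
  qed
  moreover have "x = (\<lambda>J. 1 * x J)" by simp
  ultimately show ?thesis
    unfolding common_root_def using tensor_power_one[OF x(1)] x(1) \<open>1 \<le> k\<close>
    by (intro exI[of _ k] exI[of _ x] exI[of _ 1] exI[of _ "w M0 / x M0"]) (simp del: tensor_power.simps)
qed

text \<open>
  The tensor analogue of the fact that two words commute only if they are powers of a common word,
  by the Euclidean algorithm on the degrees.
\<close>

lemma commuting_tensors:
  assumes "x \<in> tensor_space k" "w \<in> tensor_space l" "1 \<le> k" "1 \<le> l" "x \<noteq> (\<lambda>J. 0)" "w \<noteq> (\<lambda>J. 0)"
    and "tensor k x w = tensor l w x"
  shows "common_root k x l w"
  using assms
proof (induction "k + l" arbitrary: k x l w rule: less_induct)
  case less
  note x = less.prems(1,5) and w = less.prems(2,6) and comm = less.prems(7)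
  consider "k = l" | "k < l" | "l < k" by linarith
  then show ?case
  proof cases
    case 1
    then show ?thesis using commuting_tensors_same_degree less.prems by metis
  next
    case 2
    then obtain r where l: "l = k + r" "1 \<le> r"
      by (metis less_imp_add_positive One_nat_def Suc_le_eq)
    obtain w' where w': "w' \<in> tensor_space r" "w' \<noteq> (\<lambda>J. 0)" "w = tensor k x w'" "tensor k x w' = tensor r w' x"
      using commuting_tensors_divide[OF x w(1)[unfolded l] w(2) comm[unfolded l]] .
    have "common_root k x r w'"
      by (rule less.hyps) (use l w' less.prems in auto)
    then show ?thesis unfolding l w'(3) by (rule common_root_tensor)
  next
    case 3
    then obtain r where k: "k = l + r" "1 \<le> r"
      by (metis less_imp_add_positive One_nat_def Suc_le_eq)
    obtain x' where x': "x' \<in> tensor_space r" "x' \<noteq> (\<lambda>J. 0)" "x = tensor l w x'" "tensor l w x' = tensor r x' w"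
      using commuting_tensors_divide[OF w x(1)[unfolded k] x(2) comm[unfolded k, symmetric]] .
    have "common_root l w r x'"
      by (rule less.hyps) (use k x' less.prems in auto)
    then show ?thesis unfolding k x'(3) by (rule common_root_commute[OF common_root_tensor])
  qed
qed

text \<open>
  A common root u of x and w makes their product a scalar multiple of a power of u with exponent at
  least 2; since the complex numbers contain all roots, the scalar can be absorbed into u.
\<close>

lemma commuting_tensors_periodic:
  assumes x: "x \<in> tensor_space k" "1 \<le> k" and w: "w \<in> tensor_space l" "1 \<le> l"
    and nz: "tensor k x w \<noteq> (\<lambda>J. 0)" and comm: "tensor k x w = tensor l w x"
  shows "\<not> nonperiodic (tensor k x w)"
proof -
  have "x \<noteq> (\<lambda>J. 0)" "w \<noteq> (\<lambda>J. 0)"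
    using nz by (auto simp: tensor_def)
  then obtain d u p q a b where *: "1 \<le> d" "1 \<le> p" "1 \<le> q" "u \<in> tensor_space d" "k = p * d"
    "x = (\<lambda>J. a * tensor_power d u p J)" "w = (\<lambda>J. b * tensor_power d u q J)"
    using commuting_tensors[OF x(1) w(1) x(2) w(2) _ _ comm] unfolding common_root_def by blast
  have "p + q > 0" using * by simp
  then obtain c where c: "c ^ (p + q) = a * b"
    using exists_complex_root[of "p + q" "a * b"] by (metis not_gr_zero)
  have "tensor k x w = tensor_power d (\<lambda>J. c * u J) (p + q)"
    unfolding tensor_power_scale c using * by (simp add: tensor_scale tensor_power_add)
  moreover have "(\<lambda>J. c * u J) \<in> tensor_space d" using *(4) by (simp add: tensor_space_def)
  moreover have "1 \<le> p + q" "p + q \<noteq> 1" using * by auto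
  ultimately show ?thesis
    unfolding nonperiodic_def using *(1) by blast
qed

text \<open>
  View z as a matrix with rows indexed by words of length k and columns indexed by words of length l.
  The hypothesis says that this matrix sends the l-part of u to the conjugate of its k-part, and the
  identity computes the Hilbert-Schmidt distance of z to t times a matrix of rank one. The mixed term
  collapses to the squared norm of the k-part.
\<close>

lemma rank_one_distance:
  fixes z u :: "'n::finite list \<Rightarrow> complex"
  assumes z: "z \<in> unit_vectors (k + l)"
    and u: "\<And>M. length M = k \<Longrightarrow> cnj (u M) = (\<Sum>L | length L = l. z (M @ L) * u L)"
  shows "(\<Sum>M | length M = k. \<Sum>L | length L = l. (cmod (z (M @ L) - complex_of_real t * cnj (u M * u L)))\<^sup>2) =
     1 - 2 * t * (\<Sum>M | length M = k. (cmod (u M))\<^sup>2) +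
     t\<^sup>2 * (\<Sum>M | length M = k. (cmod (u M))\<^sup>2) * (\<Sum>L | length L = l. (cmod (u L))\<^sup>2)" (is "?lhs = _")
proof -
  have norm_z: "(\<Sum>M | length M = k. \<Sum>L | length L = l. (cmod (z (M @ L)))\<^sup>2) = 1"
    using z by (simp add: unit_vectors_def sum_lists_append)
  have "complex_of_real (cmod (u M))^2 = (\<Sum>L | length L = l. z (M @ L) * (u M * u L))" if "length M = k" for M
  proof -
    have "complex_of_real (cmod (u M))^2 = u M * cnj (u M)" using complex_norm_square[of "u M"] by simp
    also have "\<dots> = (\<Sum>L | length L = l. z (M @ L) * (u M * u L))"
      unfolding u[OF that] by (simp add: sum_distrib_left mult_ac)
    finally show ?thesis .
  qed
  then have "(cmod (u M))^2 = (\<Sum>L | length L = l. Re (z (M @ L) * (u M * u L)))" if "length M = k" for M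
    using that by (metis (no_types, lifting) Re_complex_of_real Re_sum of_real_power sum.cong)
  then have mixed: "(\<Sum>M | length M = k. (cmod (u M))\<^sup>2) =
      (\<Sum>M | length M = k. \<Sum>L | length L = l. Re (z (M @ L) * (u M * u L)))"
    by simp
  have "(cmod (v - complex_of_real t * cnj y))\<^sup>2 = (cmod v)\<^sup>2 - 2 * t * Re (v * y) + t\<^sup>2 * (cmod y)\<^sup>2" for v y
    unfolding cmod_power2 by (simp add: algebra_simps power2_eq_square)
  then have "?lhs = (\<Sum>M | length M = k. \<Sum>L | length L = l. (cmod (z (M @ L)))\<^sup>2
      - 2 * t * Re (z (M @ L) * (u M * u L)) + t\<^sup>2 * ((cmod (u M))\<^sup>2 * (cmod (u L))\<^sup>2))"
    by (simp only: norm_mult power_mult_distrib complex_mod_cnj)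
  also have "\<dots> = 1 - 2 * t * (\<Sum>M | length M = k. (cmod (u M))\<^sup>2) +
      t\<^sup>2 * (\<Sum>M | length M = k. \<Sum>L | length L = l. (cmod (u M))\<^sup>2 * (cmod (u L))\<^sup>2)"
    by (simp only: sum.distrib sum_subtractf norm_z mixed flip: sum_distrib_left)
  also have "(\<Sum>M | length M = k. \<Sum>L | length L = l. (cmod (u M))\<^sup>2 * (cmod (u L))\<^sup>2) =
      (\<Sum>M | length M = k. (cmod (u M))\<^sup>2) * (\<Sum>L | length L = l. (cmod (u L))\<^sup>2)"
    by (simp only: sum_product)
  finally show ?thesis by (simp only: mult.assoc)
qed

text \<open>
  A matrix of Hilbert-Schmidt norm 1 is a contraction, and it preserves the norm of some nonzero vector
  only if it has rank one. By the two hypotheses on u, both matrices obtained by cutting z into k + l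
  and into l + k letters would do so if u did not vanish. Then z would be a product x \<open>\<otimes>\<close> w and
  at the same time w \<open>\<otimes>\<close> x, hence periodic.
\<close>

lemma nonperiodic_rigidity:
  fixes z u :: "'n::finite list \<Rightarrow> complex"
  assumes z: "z \<in> unit_vectors (k + l)" "nonperiodic z" and kl: "1 \<le> k" "1 \<le> l"
    and u: "\<And>M. length M = k \<Longrightarrow> cnj (u M) = (\<Sum>L | length L = l. z (M @ L) * u L)"
      "\<And>L. length L = l \<Longrightarrow> cnj (u L) = (\<Sum>M | length M = k. z (L @ M) * u M)"
    and M: "length M = k"
  shows "u M = 0"
proof (rule ccontr)
  assume "u M \<noteq> 0"
  define A B where "A = (\<Sum>M | length M = k. (cmod (u M))\<^sup>2)" and "B = (\<Sum>L | length L = l. (cmod (u L))\<^sup>2)"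
  define d1 d2 where "d1 t = (\<Sum>M | length M = k. \<Sum>L | length L = l. (cmod (z (M @ L) - complex_of_real t * cnj (u M * u L)))\<^sup>2)"
    and "d2 t = (\<Sum>L | length L = l. \<Sum>M | length M = k. (cmod (z (L @ M) - complex_of_real t * cnj (u L * u M)))\<^sup>2)" for t
  have d: "d1 t = 1 - 2 * t * A + t\<^sup>2 * A * B" "d2 t = 1 - 2 * t * B + t\<^sup>2 * B * A" for t
    unfolding d1_def d2_def A_def B_def
    using rank_one_distance[OF z(1) u(1), where t = t] rank_one_distance[OF _ u(2), where t = t] z(1)
    by (simp_all add: add.commute)
  have d_nonneg: "d1 t \<ge> 0" "d2 t \<ge> 0" for t
    unfolding d1_def d2_def by (auto intro!: sum_nonneg)
  have "A > 0"
    unfolding A_def by (rule sum_pos2[of _ M]) (use M \<open>u M \<noteq> 0\<close> in auto)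
  have "B > 0"
  proof -
    have "d1 (1 / A) = B / A - 1"
      using \<open>A > 0\<close> by (simp add: d field_simps power2_eq_square)
    then have "0 \<le> B / A - 1" using d_nonneg(1)[of "1 / A"] by simp
    then have "B \<ge> A" using \<open>A > 0\<close> by (simp add: field_simps)
    then show ?thesis using \<open>A > 0\<close> by simp
  qed
  \<comment> \<open>Nonnegative distances to the rank one matrices force \<open>A = B\<close>, and then both distances vanish.\<close>
  have "d1 (1 / A) = B / A - 1" "d2 (1 / B) = A / B - 1"
    using \<open>A > 0\<close> \<open>B > 0\<close> by (simp_all add: d field_simps power2_eq_square)
  then have "0 \<le> B / A - 1" "0 \<le> A / B - 1"
    using d_nonneg(1)[of "1 / A"] d_nonneg(2)[of "1 / B"] by simp_all
  then have "A = B"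
    using \<open>A > 0\<close> \<open>B > 0\<close> by (simp add: field_simps)
  then have d0: "d1 (1 / A) = 0" "d2 (1 / A) = 0"
    using \<open>A > 0\<close> by (simp_all add: d field_simps power2_eq_square)
  define x where "x J = (if length J = k then cnj (u J) / A else 0)" for J
  define w where "w J = (if length J = l then cnj (u J) else 0)" for J
  have xw: "x \<in> tensor_space k" "w \<in> tensor_space l"
    by (simp_all add: x_def w_def tensor_space_def)
  have zt: "z \<in> tensor_space (k + l)" using z(1) by (simp add: unit_vectors_def)
  have 1: "z (M @ L) = x M * w L" "z (L @ M) = w L * x M" if "length M = k" "length L = l" for M L
    using d0 that \<open>A > 0\<close> unfolding d1_def d2_def x_def w_def
    by (auto simp: sum_nonneg_eq_0_iff sum_nonneg)
  have "z = tensor k x w"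
    by (rule tensor_space_eqI[OF zt tensor_in_tensor_space[OF xw]])
       (use 1(1)[of "take k J" "drop k J" for J] in \<open>simp add: tensor_def\<close>)
  moreover have "z = tensor l w x"
    by (rule tensor_space_eqI[OF zt tensor_in_tensor_space[OF xw(2,1), unfolded add.commute[of l k]]])
       (use 1(2)[of "drop l J" "take l J" for J] in \<open>simp add: tensor_def\<close>)
  moreover have "z \<noteq> (\<lambda>J. 0)"
    using z(1) by (auto simp: unit_vectors_def)
  ultimately show False
    using commuting_tensors_periodic[OF xw(1) kl(1) xw(2) kl(2)] z(2) by metis
qed


section \<open>Uniqueness of the sub-Cuntz state by a nonperiodic vector\<close>

lemma cuntz_monomial_Nil [simp]: "cuntz_monomial [] = 1"
  by (simp add: cuntz_monomial_def)

lemma cuntz_monomial_Cons: "cuntz_monomial (i # J) = cuntz_gen i * cuntz_monomial J"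
  by (simp add: cuntz_monomial_def)

lemma cuntz_monomial_append: "cuntz_monomial (J @ K) = cuntz_monomial J * cuntz_monomial K"
  by (simp add: cuntz_monomial_def)

lemma star_cuntz_gen_mult: "star (cuntz_gen i) * cuntz_gen j = (if i = j then 1 else 0)"
  using cuntz_family_gen unfolding cuntz_family_def by blast

lemma star_monomial_mult:
  "length J = length K \<Longrightarrow> star (cuntz_monomial J) * cuntz_monomial K = (if J = K then 1 else 0)"
proof (induction J K rule: list_induct2)
  case (Cons i J j K)
  have "star (cuntz_monomial (i # J)) * cuntz_monomial (j # K) =
      star (cuntz_monomial J) * (star (cuntz_gen i) * cuntz_gen j) * cuntz_monomial K"
    by (simp only: cuntz_monomial_Cons star_mult mult.assoc)
  then show ?case using Cons by (auto simp: star_cuntz_gen_mult)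
qed simp

lemma star_monomial_mult_append:
  assumes "length J = length K"
  shows "star (cuntz_monomial J) * cuntz_monomial (K @ L) = (if J = K then cuntz_monomial L else 0)"
    and "star (cuntz_monomial (K @ L)) * cuntz_monomial J = (if J = K then star (cuntz_monomial L) else 0)"
proof -
  show *: "star (cuntz_monomial J) * cuntz_monomial (K @ L) = (if J = K then cuntz_monomial L else 0)"
    using star_monomial_mult[OF assms] by (simp add: cuntz_monomial_append flip: mult.assoc)
  show "star (cuntz_monomial (K @ L)) * cuntz_monomial J = (if J = K then star (cuntz_monomial L) else 0)"
    using arg_cong[OF *, of star] by (simp add: star_mult star_star split: if_splits)
qed

text \<open>
  The adjoints of generators in a word cancel against the letters of a monomial that is long enough to
  absorb all of them.
\<close>

lemma word_mult_monomial:
  "length l \<le> length L \<Longrightarrow> word_eval cuntz_gen (Word l) * cuntz_monomial L = 0 \<or>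
    (\<exists>M. length L \<le> length M + length l \<and> word_eval cuntz_gen (Word l) * cuntz_monomial L = cuntz_monomial M)"
proof (induction l)
  case Nil
  then show ?case by (auto simp: word_eval_def)
next
  case (Cons x l)
  have split: "word_eval cuntz_gen (Word (x # l)) * cuntz_monomial L =
      gen_eval cuntz_gen x * (word_eval cuntz_gen (Word l) * cuntz_monomial L)"
    by (simp add: word_eval_def mult.assoc)
  consider "word_eval cuntz_gen (Word l) * cuntz_monomial L = 0" |
    M where "length L \<le> length M + length l" "word_eval cuntz_gen (Word l) * cuntz_monomial L = cuntz_monomial M"
    using Cons by auto
  then show ?case
  proof cases
    case 1
    then show ?thesis by (simp add: split)
  next
    case (2 M)
    show ?thesis
    proof (cases x)
      case (Gen i)
      have "word_eval cuntz_gen (Word (x # l)) * cuntz_monomial L = cuntz_monomial (i # M)"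
        unfolding split 2(2) by (simp add: Gen cuntz_monomial_Cons)
      then show ?thesis using 2(1) by (intro disjI2 exI[of _ "i # M"]) simp
    next
      case (Gen_star i)
      obtain j M' where M: "M = j # M'"
        using 2(1) Cons.prems by (cases M) auto
      have "word_eval cuntz_gen (Word (x # l)) * cuntz_monomial L = (if i = j then cuntz_monomial M' else 0)"
        unfolding split 2(2)
        by (simp add: cuntz_monomial_Cons Gen_star M star_cuntz_gen_mult flip: mult.assoc)
      then show ?thesis using 2(1) M by auto
    qed
  qed
qed

text \<open>
  The isometry of the Cuntz algebra that corresponds to a unit vector z. A state is a sub-Cuntz state by z if
  and only if it takes the value 1 on this isometry.
\<close>

definition tensor_isometry :: "nat \<Rightarrow> ('n::finite list \<Rightarrow> complex) \<Rightarrow> 'n cuntz" where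
  "tensor_isometry m z = (\<Sum>J | length J = m. z J *\<^sub>C cuntz_monomial J)"

lemma star_tensor_isometry:
  "star (tensor_isometry m z) = (\<Sum>J | length J = m. cnj (z J) *\<^sub>C star (cuntz_monomial J))"
  by (simp add: tensor_isometry_def star_sum star_scaleC)

lemma tensor_isometry_isometric:
  assumes "z \<in> unit_vectors m"
  shows "star (tensor_isometry m z) * tensor_isometry m z = 1"
proof -
  have "star (tensor_isometry m z) * tensor_isometry m z =
      (\<Sum>J | length J = m. \<Sum>K | length K = m. (cnj (z J) * z K) *\<^sub>C (star (cuntz_monomial J) * cuntz_monomial K))"
    unfolding star_tensor_isometry unfolding tensor_isometry_def sum_product
    by (simp add: mult_scaleC_left mult_scaleC_right scaleC_scaleC mult.commute)
  also have "\<dots> = (\<Sum>J | length J = m. \<Sum>K | length K = m. if J = K then complex_of_real ((cmod (z J))\<^sup>2) *\<^sub>C 1 else 0)"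
    by (intro sum.cong refl) (simp add: star_monomial_mult complex_norm_square mult.commute del: of_real_power)
  also have "\<dots> = (\<Sum>J | length J = m. complex_of_real ((cmod (z J))\<^sup>2) *\<^sub>C 1)"
    by (intro sum.cong refl) (simp add: sum.delta')
  also have "\<dots> = (\<Sum>J | length J = m. (cmod (z J))\<^sup>2) *\<^sub>R 1"
    by (simp only: scaleC_of_real scaleR_left.sum)
  finally show ?thesis using assms by (simp add: unit_vectors_def)
qed

text \<open>
  The element \<open>v - 1\<close> has length zero in the semi-inner product of the state, because both \<open>\<omega> (star v * v)\<close>
  and \<open>\<omega> v\<close> are 1. So the GNS vector of the state is fixed by v.
\<close>

lemma state_absorbs_isometry:
  assumes \<omega>: "state \<omega>" and v: "star v * v = 1" "\<omega> v = 1"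
  shows "\<omega> (y * v) = \<omega> y" and "\<omega> (star v * y) = \<omega> y"
proof -
  have "\<omega> (star (v - 1) * (v - 1)) = 0"
    by (simp add: star_diff algebra_simps v state_diff[OF \<omega>] state_one[OF \<omega>] state_star[OF \<omega>] state_add[OF \<omega>])
  then have "(cmod (\<omega> (star (star y) * (v - 1))))\<^sup>2 \<le> 0" for y
    using state_Cauchy_Schwarz[OF \<omega>, of "star y" "v - 1"] by simp
  then have "\<omega> (y * (v - 1)) = 0" for y
    by (simp add: star_star)
  then show *: "\<omega> (y * v) = \<omega> y" for y
    by (simp add: algebra_simps state_diff[OF \<omega>])
  show "\<omega> (star v * y) = \<omega> y"
    using *[of "star y"] state_star[OF \<omega>, of "star y * v"] state_star[OF \<omega>, of "star y"]
    by (simp add: star_mult star_star)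
qed

text \<open>
  A sub-Cuntz state together with the degree of z.
\<close>

locale cuntz_state_by =
  fixes \<omega> :: "'n::finite cuntz \<Rightarrow> complex" and m :: nat and z :: "'n list \<Rightarrow> complex"
  assumes state: "state \<omega>" and m: "1 \<le> m" and z: "z \<in> unit_vectors m"
    and coordinates: "\<And>J. length J = m \<Longrightarrow> \<omega> (cuntz_monomial J) = cnj (z J)"
begin

lemma isometry_value: "\<omega> (tensor_isometry m z) = 1"
proof -
  have "\<omega> (tensor_isometry m z) = complex_of_real (\<Sum>J | length J = m. (cmod (z J))\<^sup>2)"
    unfolding tensor_isometry_def
    by (simp add: state_sum[OF state] state_scaleC[OF state] coordinates complex_norm_square del: of_real_power)
  then show ?thesis using z unfolding unit_vectors_def by (simp del: of_real_sum of_real_power)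
qed

lemmas absorb = state_absorbs_isometry[OF state tensor_isometry_isometric[OF z] isometry_value]

lemma expand_right: "\<omega> y = (\<Sum>L | length L = m. z L * \<omega> (y * cuntz_monomial L))"
proof -
  have "\<omega> y = \<omega> (y * tensor_isometry m z)" by (simp add: absorb)
  then show ?thesis
    by (simp add: tensor_isometry_def sum_distrib_left mult_scaleC_right state_sum[OF state] state_scaleC[OF state])
qed

lemma expand_left: "\<omega> y = (\<Sum>J | length J = m. cnj (z J) * \<omega> (star (cuntz_monomial J) * y))"
proof -
  have "\<omega> y = \<omega> (star (tensor_isometry m z) * y)" by (simp add: absorb)
  then show ?thesis
    by (simp add: star_tensor_isometry sum_distrib_right mult_scaleC_left state_sum[OF state] state_scaleC[OF state])
qed

lemma monomial_long:
  assumes "length J = m"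
  shows "\<omega> (cuntz_monomial (J @ K)) = cnj (z J) * \<omega> (cuntz_monomial K)"
proof -
  have "\<omega> (cuntz_monomial (J @ K)) =
      (\<Sum>I | length I = m. if I = J then cnj (z J) * \<omega> (cuntz_monomial K) else 0)"
    unfolding expand_left[of "cuntz_monomial (J @ K)"]
    by (intro sum.cong refl) (simp add: star_monomial_mult_append assms state_zero[OF state])
  then show ?thesis using assms by simp
qed

text \<open>
  The relation that feeds \<open>nonperiodic_rigidity\<close>: inserting the adjoint of the isometry on the left of a
  monomial shorter than z cancels the monomial and leaves the adjoints of complementary length.
\<close>

lemma monomial_short:
  assumes "length M + l = m"
  shows "cnj (\<omega> (cuntz_monomial M)) = (\<Sum>L | length L = l. z (M @ L) * \<omega> (cuntz_monomial L))"
proof -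
  have "\<omega> (cuntz_monomial M) =
     (\<Sum>I | length I = length M. \<Sum>L | length L = l. cnj (z (I @ L)) * \<omega> (star (cuntz_monomial (I @ L)) * cuntz_monomial M))"
    using expand_left[of "cuntz_monomial M"] unfolding assms[symmetric] sum_lists_append .
  also have "\<dots> = (\<Sum>I | length I = length M. if I = M then \<Sum>L | length L = l. cnj (z (M @ L)) * cnj (\<omega> (cuntz_monomial L)) else 0)"
    by (intro sum.cong refl)
       (auto simp: star_monomial_mult_append state_star[OF state] state_zero[OF state])
  also have "\<dots> = (\<Sum>L | length L = l. cnj (z (M @ L)) * cnj (\<omega> (cuntz_monomial L)))"
    by simp
  finally show ?thesis by simp
qed

lemma monomial_short_zero:
  assumes "nonperiodic z" "0 < length M" "length M < m"
  shows "\<omega> (cuntz_monomial M) = 0"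
proof -
  obtain l where l: "m = length M + l" "1 \<le> l"
    using assms by (metis less_imp_add_positive One_nat_def Suc_le_eq)
  show ?thesis
  proof (rule nonperiodic_rigidity[where k = "length M" and l = l and z = z and u = "\<lambda>M. \<omega> (cuntz_monomial M)"])
    show "1 \<le> length M" using assms(2) by linarith
    show "z \<in> unit_vectors (length M + l)" using z l by simp
    show "cnj (\<omega> (cuntz_monomial M')) = (\<Sum>L | length L = l. z (M' @ L) * \<omega> (cuntz_monomial L))"
      if "length M' = length M" for M'
      using monomial_short that l by simp
    show "cnj (\<omega> (cuntz_monomial L)) = (\<Sum>K | length K = length M. z (L @ K) * \<omega> (cuntz_monomial K))"
      if "length L = l" for L
      using monomial_short[of L "length M"] that l by simp
  qed (use l assms in auto)
qed

end

text \<open>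
  The values on monomials are forced: a prefix of length m contributes a coordinate of z, and a remainder of
  length strictly between 0 and m contributes 0 because z is nonperiodic. Every other word
  reduces to monomials by letting it act on a high power of the isometry, which the state does not
  see.
\<close>

lemma sub_cuntz_state_unique:
  assumes "sub_cuntz_state z \<omega>" "sub_cuntz_state z \<omega>'" "nonperiodic z"
  shows "\<omega> = \<omega>'"
proof -
  obtain m where m: "cuntz_state_by \<omega> m z"
    using assms(1) unfolding sub_cuntz_state_def cuntz_state_by_def by blast
  obtain m' where m': "cuntz_state_by \<omega>' m' z"
    using assms(2) unfolding sub_cuntz_state_def cuntz_state_by_def by blast
  have "m' = m"
  proof (rule ccontr)
    assume "m' \<noteq> m"
    then have "z J = 0" if "length J = m" for J
      using cuntz_state_by.z[OF m'] that by (simp add: unit_vectors_def tensor_space_def)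
    then show False
      using cuntz_state_by.z[OF m] by (simp add: unit_vectors_def)
  qed
  then interpret s: cuntz_state_by \<omega> m z + s': cuntz_state_by \<omega>' m z
    using m m' by auto
  have monomial: "\<omega> (cuntz_monomial M) = \<omega>' (cuntz_monomial M)" for M
  proof (induction M rule: length_induct)
    case (1 M)
    consider "M = []" | "0 < length M" "length M < m" | "m \<le> length M" by fastforce
    then show ?case
    proof cases
      case 1
      then show ?thesis by (simp add: state_one[OF s.state] state_one[OF s'.state])
    next
      case 2
      then show ?thesis by (simp add: s.monomial_short_zero s'.monomial_short_zero assms(3))
    next
      case 3
      then have "length (take m M) = m" "length (drop m M) < length M"
        using s.m by auto
      then show ?thesis
        using s.monomial_long[of "take m M" "drop m M"] s'.monomial_long[of "take m M" "drop m M"] 1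
        by simp
    qed
  qed
  \<comment> \<open>A state is determined on y by its values on y times the monomials of a fixed length \<open>a * m\<close>.\<close>
  have extend: "(\<And>L. length L = a * m \<Longrightarrow> \<omega> (y * cuntz_monomial L) = \<omega>' (y * cuntz_monomial L)) \<Longrightarrow> \<omega> y = \<omega>' y" for a y
  proof (induction a arbitrary: y)
    case (Suc a)
    have "\<omega> (y * cuntz_monomial L) = \<omega>' (y * cuntz_monomial L)" if "length L = m" for L
      by (rule Suc.IH) (use Suc.prems[of "L @ L'" for L'] that in \<open>simp add: cuntz_monomial_append mult.assoc\<close>)
    then show ?case
      unfolding s.expand_right[of y] s'.expand_right[of y] by simp
  qed simp
  show ?thesis
  proof (rule state_eqI[OF s.state s'.state])
    fix w :: "'a word"
    obtain l where w: "w = Word l" by (cases w)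
    show "\<omega> (word_eval cuntz_gen w) = \<omega>' (word_eval cuntz_gen w)"
    \<comment> \<open>The length \<open>length l * m\<close> suffices to absorb all adjoints in the word.\<close>
    proof (rule extend[of "length l"])
      fix L :: "'a list" assume "length L = length l * m"
      then have "length l \<le> length L" using s.m by simp
      then show "\<omega> (word_eval cuntz_gen w * cuntz_monomial L) = \<omega>' (word_eval cuntz_gen w * cuntz_monomial L)"
        using word_mult_monomial[of l L] monomial
        by (auto simp: w state_zero[OF s.state] state_zero[OF s'.state])
    qed
  qed
qed


section \<open>A representation with a vector fixed by the isometry of z\<close>

text \<open>
  The generators act on functions on words by prepending a letter, and their adjoints by stripping it. A creation
  operator has no value to take at the empty word, so there the sum of the range projections is
  0 instead of 1; the inner product below is blind to this defect.
\<close>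

fun gen_act :: "'n gen \<Rightarrow> ('n list \<Rightarrow> complex) \<Rightarrow> 'n list \<Rightarrow> complex" where
  "gen_act (Gen i) f J = (case J of [] \<Rightarrow> 0 | j # K \<Rightarrow> if j = i then f K else 0)"
| "gen_act (Gen_star i) f J = f (i # J)"

definition word_act :: "'n word \<Rightarrow> ('n list \<Rightarrow> complex) \<Rightarrow> 'n list \<Rightarrow> complex" where
  "word_act w f = foldr gen_act (letters w) f"

definition free_act :: "'n free \<Rightarrow> ('n list \<Rightarrow> complex) \<Rightarrow> 'n list \<Rightarrow> complex" where
  "free_act a f J = (\<Sum>w\<in>Poly_Mapping.keys a. Poly_Mapping.lookup a w * word_act w f J)"

lemma gen_act_add: "gen_act x (\<lambda>J. f J + g J) = (\<lambda>J. gen_act x f J + gen_act x g J)"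
  by (cases x) (auto simp: fun_eq_iff split: list.split)

lemma gen_act_scale: "gen_act x (\<lambda>J. c * f J) = (\<lambda>J. c * gen_act x f J)"
  by (cases x) (auto simp: fun_eq_iff split: list.split)

lemma word_act_Nil [simp]: "word_act 0 f = f" "word_act (Word []) f = f"
  by (simp_all add: word_act_def zero_word_def)

lemma word_act_Cons: "word_act (Word (x # l)) f = gen_act x (word_act (Word l) f)"
  by (simp add: word_act_def)

lemma word_act_plus: "word_act (v + w) f = word_act v (word_act w f)"
  by (simp add: word_act_def plus_word_def)

lemma word_act_add: "word_act w (\<lambda>J. f J + g J) = (\<lambda>J. word_act w f J + word_act w g J)"
proof -
  have "word_act (Word l) (\<lambda>J. f J + g J) = (\<lambda>J. word_act (Word l) f J + word_act (Word l) g J)" for l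
    by (induction l) (simp_all add: word_act_Cons gen_act_add)
  then show ?thesis by (cases w) simp
qed

lemma word_act_scale: "word_act w (\<lambda>J. c * f J) = (\<lambda>J. c * word_act w f J)"
proof -
  have "word_act (Word l) (\<lambda>J. c * f J) = (\<lambda>J. c * word_act (Word l) f J)" for l
    by (induction l) (simp_all add: word_act_Cons gen_act_scale)
  then show ?thesis by (cases w) simp
qed

lemma free_act_superset:
  assumes "finite K" "Poly_Mapping.keys a \<subseteq> K"
  shows "free_act a f J = (\<Sum>w\<in>K. Poly_Mapping.lookup a w * word_act w f J)"
  unfolding free_act_def using assms by (intro sum.mono_neutral_left) (auto simp: in_keys_iff)

lemma free_act_single: "free_act (Poly_Mapping.single w c) f = (\<lambda>J. c * word_act w f J)"
  by (rule ext, subst free_act_superset[of "{w}"]) auto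

lemma free_act_add: "free_act (a + b) f = (\<lambda>J. free_act a f J + free_act b f J)"
proof
  fix J
  define K where "K = Poly_Mapping.keys a \<union> Poly_Mapping.keys b"
  have "finite K" "Poly_Mapping.keys a \<subseteq> K" "Poly_Mapping.keys b \<subseteq> K" "Poly_Mapping.keys (a + b) \<subseteq> K"
    using Poly_Mapping.keys_add[of a b] by (auto simp: K_def)
  then show "free_act (a + b) f J = free_act a f J + free_act b f J"
    by (simp add: free_act_superset[of K] lookup_add distrib_right sum.distrib)
qed

lemma free_act_zero: "free_act 0 f = (\<lambda>J. 0)"
  using free_act_single[of 0 0 f] by simp

lemma free_act_diff: "free_act (a - b) f = (\<lambda>J. free_act a f J - free_act b f J)"
  using free_act_add[of "a - b" b f] by (simp add: fun_eq_iff)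

lemma free_act_sum: "free_act (\<Sum>i\<in>A. a i) f = (\<lambda>J. \<Sum>i\<in>A. free_act (a i) f J)"
  by (induction A rule: infinite_finite_induct) (simp_all add: free_act_zero free_act_add)

lemma free_act_plus_right: "free_act a (\<lambda>J. f J + g J) = (\<lambda>J. free_act a f J + free_act a g J)"
  by (induction a rule: free_induct) (simp_all add: free_act_single free_act_add word_act_add distrib_left add_ac)

lemma free_act_mult: "free_act (a * b) f = free_act a (free_act b f)"
proof (induction a rule: free_induct)
  case (single v c)
  show ?case
  proof (induction b rule: free_induct)
    case (single w d)
    then show ?case
      by (simp add: mult_single free_act_single word_act_plus word_act_scale mult.assoc)
  next
    case (add a b)
    then show ?case by (simp add: distrib_left free_act_add free_act_plus_right)
  qed
qed (simp add: distrib_right free_act_add)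

lemma free_act_one: "free_act 1 f = f"
  using free_act_single[of 0 1 f] by simp

lemma free_act_free_scale: "free_act (free_scale c a) f = (\<lambda>J. c * free_act a f J)"
  by (simp add: free_scale_def free_act_mult free_act_single)

lemma free_act_gen: "free_act (free_gen i) f = gen_act (Gen i) f"
  by (rule ext) (simp add: free_gen_def free_act_single word_act_Cons)

lemma free_act_gen_star: "free_act (free_star (free_gen i)) f = gen_act (Gen_star i) f"
  by (rule ext) (simp add: free_gen_def free_star_single word_star_def free_act_single word_act_Cons)

locale unit_tensor =
  fixes m :: nat and z :: "'n::finite list \<Rightarrow> complex"
  assumes m: "1 \<le> m" and z: "z \<in> unit_vectors m"
begin

text \<open>
  The carrier of a representation with a vector fixed by the isometry of z: the inductive limit of the
  tensor powers of \<open>\<complex>\<^sup>n\<close> along the isometric embeddings of degree k into degree k + m given by tensoring with z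
  on the right. An element of the limit is recorded by all its sufficiently late representatives at
  once, as one function on words of all lengths.
\<close>

definition tail_space :: "('n list \<Rightarrow> complex) set" where
  "tail_space = {f. \<exists>N. \<forall>J L. N \<le> length J \<longrightarrow> length L = m \<longrightarrow> f (J @ L) = f J * z L}"

lemma tail_space_add:
  assumes "f \<in> tail_space" "g \<in> tail_space"
  shows "(\<lambda>J. f J + g J) \<in> tail_space"
proof -
  obtain M N where "\<And>J L. M \<le> length J \<Longrightarrow> length L = m \<Longrightarrow> f (J @ L) = f J * z L"
    "\<And>J L. N \<le> length J \<Longrightarrow> length L = m \<Longrightarrow> g (J @ L) = g J * z L"
    using assms unfolding tail_space_def by blast
  then show ?thesis
    unfolding tail_space_def by (auto intro!: exI[of _ "max M N"] simp: distrib_right)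
qed

lemma tail_space_scale: "f \<in> tail_space \<Longrightarrow> (\<lambda>J. c * f J) \<in> tail_space"
  by (auto simp: tail_space_def mult.assoc)

lemma tail_space_gen_act:
  assumes "f \<in> tail_space"
  shows "gen_act x f \<in> tail_space"
proof -
  obtain N where N: "\<And>J L. N \<le> length J \<Longrightarrow> length L = m \<Longrightarrow> f (J @ L) = f J * z L"
    using assms unfolding tail_space_def by blast
  have "gen_act x f (J @ L) = gen_act x f J * z L" if J: "Suc N \<le> length J" and L: "length L = m" for J L
  proof (cases x)
    case (Gen i)
    then show ?thesis using J L N by (cases J) auto
  next
    case (Gen_star i)
    then show ?thesis using J L N[of "i # J"] by simp
  qed
  then show ?thesis unfolding tail_space_def by blast
qed

lemma tail_space_word_act: "f \<in> tail_space \<Longrightarrow> word_act w f \<in> tail_space"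
proof -
  assume "f \<in> tail_space"
  then have "word_act (Word l) f \<in> tail_space" for l
    by (induction l) (simp_all add: word_act_Cons tail_space_gen_act)
  then show ?thesis by (cases w) simp
qed

lemma tail_space_free_act: "f \<in> tail_space \<Longrightarrow> free_act a f \<in> tail_space"
  by (induction a rule: free_induct)
     (simp_all add: free_act_single free_act_add tail_space_word_act tail_space_scale tail_space_add)

definition layer :: "nat \<Rightarrow> ('n list \<Rightarrow> complex) \<Rightarrow> ('n list \<Rightarrow> complex) \<Rightarrow> complex" where
  "layer k f g = (\<Sum>J | length J = k. cnj (f J) * g J)"

text \<open>
  The inner product of two elements of the limit is read off from one representative in each residue
  class of degrees modulo m, so from m consecutive degrees; it does not depend on the position of
  the window once this is far enough.
\<close>

definition window :: "nat \<Rightarrow> ('n list \<Rightarrow> complex) \<Rightarrow> ('n list \<Rightarrow> complex) \<Rightarrow> complex" where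
  "window N f g = (\<Sum>k<m. layer (N + k) f g)"

definition ip :: "('n list \<Rightarrow> complex) \<Rightarrow> ('n list \<Rightarrow> complex) \<Rightarrow> complex" where
  "ip f g = lim (\<lambda>N. window N f g)"

definition nrm :: "('n list \<Rightarrow> complex) \<Rightarrow> real" where
  "nrm f = sqrt (Re (ip f f))"

lemma layer_periodic:
  assumes "\<And>J L. N \<le> length J \<Longrightarrow> length L = m \<Longrightarrow> f (J @ L) = f J * z L"
    and "\<And>J L. N \<le> length J \<Longrightarrow> length L = m \<Longrightarrow> g (J @ L) = g J * z L"
    and "N \<le> k"
  shows "layer (k + m) f g = layer k f g"
proof -
  have norm_z: "(\<Sum>L | length L = m. cnj (z L) * z L) = 1"
  proof -
    have "(\<Sum>L | length L = m. cnj (z L) * z L) = complex_of_real (\<Sum>L | length L = m. (cmod (z L))\<^sup>2)"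
      by (simp add: complex_norm_square mult.commute del: of_real_power)
    then show ?thesis using z unfolding unit_vectors_def by (simp del: of_real_sum of_real_power)
  qed
  have "layer (k + m) f g =
      (\<Sum>J | length J = k. \<Sum>L | length L = m. cnj (f J) * g J * (cnj (z L) * z L))"
    unfolding layer_def sum_lists_append
    using assms by (intro sum.cong refl) (simp add: mult_ac)
  then show ?thesis
    by (simp add: norm_z layer_def flip: sum_distrib_left)
qed

lemma window_const:
  assumes "\<And>J L. N \<le> length J \<Longrightarrow> length L = m \<Longrightarrow> f (J @ L) = f J * z L"
    and "\<And>J L. N \<le> length J \<Longrightarrow> length L = m \<Longrightarrow> g (J @ L) = g J * z L"
  shows "N \<le> M \<Longrightarrow> window M f g = window N f g"
proof (induction M rule: dec_induct)
  case (step M)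
  have "window (Suc M) f g + layer M f g = window M f g + layer (M + m) f g"
    unfolding window_def
    using sum.lessThan_Suc[of "\<lambda>k. layer (M + k) f g" m] sum.lessThan_Suc_shift[of "\<lambda>k. layer (M + k) f g" m]
    by (simp add: add.commute)
  then show ?case
    using step layer_periodic[of N f g M] assms by simp
qed simp

lemma ip_eq_window:
  assumes "\<And>J L. N \<le> length J \<Longrightarrow> length L = m \<Longrightarrow> f (J @ L) = f J * z L"
    and "\<And>J L. N \<le> length J \<Longrightarrow> length L = m \<Longrightarrow> g (J @ L) = g J * z L"
  shows "(\<lambda>M. window M f g) \<longlonglongrightarrow> window N f g" "ip f g = window N f g"
proof -
  show *: "(\<lambda>M. window M f g) \<longlonglongrightarrow> window N f g"
    by (rule tendsto_eventually, rule eventually_sequentiallyI[of N]) (rule window_const[OF assms])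
  then show "ip f g = window N f g"
    unfolding ip_def by (rule limI)
qed

lemma window_tendsto:
  assumes "f \<in> tail_space" "g \<in> tail_space"
  shows "(\<lambda>N. window N f g) \<longlonglongrightarrow> ip f g"
proof -
  obtain M N where MN: "\<And>J L. M \<le> length J \<Longrightarrow> length L = m \<Longrightarrow> f (J @ L) = f J * z L"
    "\<And>J L. N \<le> length J \<Longrightarrow> length L = m \<Longrightarrow> g (J @ L) = g J * z L"
    using assms unfolding tail_space_def by blast
  show ?thesis
    using ip_eq_window[of "max M N" f g] MN by simp
qed

lemma ip_add_right:
  assumes "f \<in> tail_space" "g \<in> tail_space" "h \<in> tail_space"
  shows "ip f (\<lambda>J. g J + h J) = ip f g + ip f h"
proof -
  have "window N f (\<lambda>J. g J + h J) = window N f g + window N f h" for N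
    by (simp add: window_def layer_def distrib_left sum.distrib)
  then show ?thesis
    using LIMSEQ_unique[OF window_tendsto[OF assms(1) tail_space_add[OF assms(2,3)]]]
      tendsto_add[OF window_tendsto[OF assms(1,2)] window_tendsto[OF assms(1,3)]] by simp
qed

lemma ip_scale_right:
  assumes "f \<in> tail_space" "g \<in> tail_space"
  shows "ip f (\<lambda>J. c * g J) = c * ip f g"
proof -
  have "window N f (\<lambda>J. c * g J) = c * window N f g" for N
    by (simp add: window_def layer_def sum_distrib_left mult_ac)
  then show ?thesis
    using LIMSEQ_unique[OF window_tendsto[OF assms(1) tail_space_scale[OF assms(2)]]]
      tendsto_mult_left[OF window_tendsto[OF assms]] by simp
qed

lemma ip_hermitian:
  assumes "f \<in> tail_space" "g \<in> tail_space"
  shows "ip g f = cnj (ip f g)"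
proof -
  have "window N g f = cnj (window N f g)" for N
    by (simp add: window_def layer_def mult.commute)
  then show ?thesis
    using LIMSEQ_unique[OF window_tendsto[OF assms(2,1)]] tendsto_cnj[OF window_tendsto[OF assms]] by simp
qed

lemma ip_add_left:
  assumes "f \<in> tail_space" "g \<in> tail_space" "h \<in> tail_space"
  shows "ip (\<lambda>J. f J + g J) h = ip f h + ip g h"
  using assms by (simp add: ip_hermitian[of h] ip_add_right tail_space_add)

lemma ip_scale_left:
  assumes "f \<in> tail_space" "g \<in> tail_space"
  shows "ip (\<lambda>J. c * f J) g = cnj c * ip f g"
  using assms by (simp add: ip_hermitian[of g] ip_scale_right tail_space_scale)

lemma ip_self:
  assumes "f \<in> tail_space"
  shows "ip f f = complex_of_real ((nrm f)\<^sup>2)" "0 \<le> nrm f"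
proof -
  have "window N f f \<in> \<real>\<^sub>\<ge>\<^sub>0" for N
  proof -
    have "window N f f = complex_of_real (\<Sum>k<m. \<Sum>J | length J = N + k. (cmod (f J))\<^sup>2)"
      by (simp add: window_def layer_def complex_norm_square mult.commute del: of_real_power)
    then show ?thesis by (simp add: sum_nonneg del: of_real_sum)
  qed
  then have "ip f f \<in> \<real>\<^sub>\<ge>\<^sub>0"
    by (rule closed_sequentially[OF closed_nonneg_Reals_complex _ window_tendsto[OF assms assms]])
  then show "ip f f = complex_of_real ((nrm f)\<^sup>2)" "0 \<le> nrm f"
    by (auto simp: nrm_def complex_nonneg_Reals_iff complex_eq_iff)
qed

lemma nrm_add_squared:
  assumes "f \<in> tail_space" "g \<in> tail_space"
  shows "(nrm (\<lambda>J. f J + c * g J))\<^sup>2 = (nrm f)\<^sup>2 + 2 * Re (c * ip f g) + (cmod c)\<^sup>2 * (nrm g)\<^sup>2"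
proof -
  note cg = tail_space_scale[OF assms(2), of c]
  have "complex_of_real ((nrm (\<lambda>J. f J + c * g J))\<^sup>2) = ip (\<lambda>J. f J + c * g J) (\<lambda>J. f J + c * g J)"
    by (simp only: ip_self(1)[OF tail_space_add[OF assms(1) cg]])
  also have "\<dots> = ip f f + (c * ip f g + cnj (c * ip f g)) + (c * cnj c) * ip g g"
    using assms cg ip_hermitian[OF assms]
    by (simp add: ip_add_left ip_add_right ip_scale_left ip_scale_right tail_space_add algebra_simps)
  also have "\<dots> = complex_of_real ((nrm f)\<^sup>2 + 2 * Re (c * ip f g) + (cmod c)\<^sup>2 * (nrm g)\<^sup>2)"
    unfolding complex_add_cnj ip_self(1)[OF assms(1)] ip_self(1)[OF assms(2)] complex_norm_square[symmetric]
    by simp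
  finally show ?thesis by (simp only: of_real_eq_iff)
qed

lemma ip_Cauchy_Schwarz:
  assumes "f \<in> tail_space" "g \<in> tail_space"
  shows "cmod (ip f g) \<le> nrm f * nrm g"
proof -
  have "(cmod (ip f g))\<^sup>2 \<le> (nrm f)\<^sup>2 * (nrm g)\<^sup>2"
  proof (rule quadratic_nonneg_imp_discriminant)
    show "0 \<le> (nrm f)\<^sup>2 + 2 * Re (c * ip f g) + (cmod c)\<^sup>2 * (nrm g)\<^sup>2" for c
      unfolding nrm_add_squared[OF assms, symmetric] by simp
  qed simp
  then show ?thesis
    using ip_self(2) assms by (auto intro: power2_le_imp_le simp: power_mult_distrib)
qed

lemma nrm_triangle:
  assumes "f \<in> tail_space" "g \<in> tail_space"
  shows "nrm (\<lambda>J. f J + g J) \<le> nrm f + nrm g"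
proof -
  have "(nrm (\<lambda>J. f J + g J))\<^sup>2 = (nrm f)\<^sup>2 + 2 * Re (ip f g) + (nrm g)\<^sup>2"
    using nrm_add_squared[OF assms, of 1] by simp
  also have "\<dots> \<le> (nrm f)\<^sup>2 + 2 * (nrm f * nrm g) + (nrm g)\<^sup>2"
    using order_trans[OF complex_Re_le_cmod ip_Cauchy_Schwarz[OF assms]] by simp
  finally have "(nrm (\<lambda>J. f J + g J))\<^sup>2 \<le> (nrm f + nrm g)\<^sup>2"
    by (simp add: power2_sum algebra_simps)
  then show ?thesis
    using ip_self(2) assms by (auto intro: power2_le_imp_le)
qed

lemma nrm_scale:
  assumes "f \<in> tail_space"
  shows "nrm (\<lambda>J. c * f J) = cmod c * nrm f"
proof -
  have "ip (\<lambda>J. c * f J) (\<lambda>J. c * f J) = (c * cnj c) * ip f f"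
    using assms by (simp add: ip_scale_left ip_scale_right tail_space_scale mult_ac)
  also have "\<dots> = complex_of_real ((cmod c * nrm f)\<^sup>2)"
    unfolding ip_self(1)[OF assms] complex_norm_square[symmetric] by (simp add: power_mult_distrib)
  finally show ?thesis
    unfolding nrm_def using ip_self(2)[OF assms] by (simp add: nrm_def)
qed

lemma nrm_eventually_zero:
  assumes "\<And>J. N \<le> length J \<Longrightarrow> f J = 0"
  shows "nrm f = 0"
proof -
  have "ip f f = window N f f"
    by (rule ip_eq_window) (use assms in auto)
  then show ?thesis
    using assms by (simp add: nrm_def window_def layer_def)
qed

text \<open>
  Prepending a letter maps the words of a window onto those words of the next window which start with it.
\<close>

lemma ip_gen_act:
  assumes f: "f \<in> tail_space" and g: "g \<in> tail_space"
  shows "ip (gen_act x f) g = ip f (gen_act (gen_star x) g)"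
proof -
  have creation: "ip (gen_act (Gen i) f) g = ip f (gen_act (Gen_star i) g)"
    if f: "f \<in> tail_space" and g: "g \<in> tail_space" for f g i
  proof -
    have "layer (Suc k) (gen_act (Gen i) f) g = layer k f (gen_act (Gen_star i) g)" for k
    proof -
      have "layer (Suc k) (gen_act (Gen i) f) g =
          (\<Sum>j\<in>UNIV. if j = i then \<Sum>L | length L = k. cnj (f L) * g (i # L) else 0)"
        unfolding layer_def sum_lists_Cons by (intro sum.cong refl) auto
      then show ?thesis by (simp add: layer_def)
    qed
    then have "window (Suc N) (gen_act (Gen i) f) g = window N f (gen_act (Gen_star i) g)" for N
      by (simp add: window_def)
    then show ?thesis
      using LIMSEQ_unique[OF LIMSEQ_Suc[OF window_tendsto]] window_tendsto f g tail_space_gen_act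
      by (metis (no_types, lifting) ext)
  qed
  show ?thesis
  proof (cases x)
    case (Gen i)
    then show ?thesis using creation[OF f g] by simp
  next
    case (Gen_star i)
    have "ip (gen_act x f) g = cnj (ip g (gen_act x f))"
      by (rule ip_hermitian[OF g tail_space_gen_act[OF f]])
    also have "ip g (gen_act x f) = ip (gen_act (Gen i) g) f"
      using creation[OF g f, of i] Gen_star by simp
    also have "cnj \<dots> = ip f (gen_act (gen_star x) g)"
      using ip_hermitian[OF tail_space_gen_act[OF g] f, of "Gen i"] Gen_star by simp
    finally show ?thesis .
  qed
qed

lemma ip_free_act:
  assumes f: "f \<in> tail_space" and g: "g \<in> tail_space"
  shows "ip (free_act a f) g = ip f (free_act (free_star a) g)"
proof -
  have word: "ip (word_act (Word l) f) g = ip f (word_act (word_star (Word l)) g)" if "g \<in> tail_space" for l g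
    using that
  proof (induction l arbitrary: g)
    case Nil
    then show ?case by (simp add: word_star_def)
  next
    case (Cons x l)
    have "word_star (Word (x # l)) = word_star (Word l) + Word [gen_star x]"
      by (simp add: word_star_def plus_word_def)
    then show ?case
      using Cons ip_gen_act[OF tail_space_word_act[OF f, of "Word l"] Cons.prems, of x]
      by (simp add: word_act_Cons word_act_plus tail_space_gen_act)
  qed
  show ?thesis
  proof (induction a rule: free_induct)
    case (single w c)
    then show ?case
      using word[OF g, of "letters w"] f g
      by (simp add: free_star_single free_act_single ip_scale_left ip_scale_right tail_space_word_act)
  next
    case (add a b)
    then show ?case
      using f g
      by (simp add: free_star_add free_act_add ip_add_left ip_add_right tail_space_free_act)
  qed
qed

lemma nrm_gen_act:
  assumes f: "f \<in> tail_space"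
  shows "nrm (gen_act x f) \<le> nrm f"
proof (cases x)
  case (Gen i)
  have "gen_act (Gen_star i) (gen_act (Gen i) f) = f" by (rule ext) simp
  then have "ip (gen_act x f) (gen_act x f) = ip f f"
    using ip_gen_act[OF f tail_space_gen_act[OF f], of x x] Gen by simp
  then show ?thesis by (simp add: nrm_def)
next
  case (Gen_star i)
  have isometric: "nrm (gen_act (Gen i) h) = nrm h" if h: "h \<in> tail_space" for h
  proof -
    have "gen_act (Gen_star i) (gen_act (Gen i) h) = h" by (rule ext) simp
    then have "ip (gen_act (Gen i) h) (gen_act (Gen i) h) = ip h h"
      using ip_gen_act[OF h tail_space_gen_act[OF h], of "Gen i" "Gen i"] by simp
    then show ?thesis by (simp add: nrm_def)
  qed
  let ?h = "gen_act x f"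
  have h: "?h \<in> tail_space" by (rule tail_space_gen_act[OF f])
  have "(nrm ?h)\<^sup>2 = cmod (ip ?h ?h)"
    unfolding ip_self(1)[OF h] norm_of_real by simp
  also have "ip ?h ?h = ip f (gen_act (Gen i) ?h)"
    using ip_gen_act[OF f h, of x] Gen_star by simp
  also have "cmod \<dots> \<le> nrm f * nrm (gen_act (Gen i) ?h)"
    by (rule ip_Cauchy_Schwarz[OF f tail_space_gen_act[OF h]])
  finally have "nrm ?h * nrm ?h \<le> nrm f * nrm ?h"
    by (simp add: isometric[OF h] power2_eq_square)
  then show ?thesis
    using ip_self(2)[OF h] ip_self(2)[OF f] by (cases "nrm ?h = 0") auto
qed

lemma free_act_bounded: "\<exists>C\<ge>0. \<forall>f\<in>tail_space. nrm (free_act a f) \<le> C * nrm f"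
proof (induction a rule: free_induct)
  case (single w c)
  have word: "nrm (word_act (Word l) f) \<le> nrm f" if "f \<in> tail_space" for l f
    by (induction l)
       (auto simp: word_act_Cons intro: order_trans[OF nrm_gen_act[OF tail_space_word_act[OF that]]])
  have "nrm (free_act (Poly_Mapping.single w c) f) \<le> cmod c * nrm f" if "f \<in> tail_space" for f
    using word[OF that, of "letters w"]
    by (simp add: free_act_single nrm_scale tail_space_word_act that mult_left_mono)
  then show ?case by (meson norm_ge_zero)
next
  case (add a b)
  then obtain C D where CD: "0 \<le> C" "\<And>f. f \<in> tail_space \<Longrightarrow> nrm (free_act a f) \<le> C * nrm f"
    "0 \<le> D" "\<And>f. f \<in> tail_space \<Longrightarrow> nrm (free_act b f) \<le> D * nrm f" by blast
  have "nrm (free_act (a + b) f) \<le> (C + D) * nrm f" if "f \<in> tail_space" for f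
    using nrm_triangle[OF tail_space_free_act[OF that] tail_space_free_act[OF that], of a b] CD(2,4)[OF that]
    by (simp add: free_act_add distrib_right)
  then show ?case using CD by (intro exI[of _ "C + D"]) auto
qed

text \<open>
  The operator norm of the representation, written as the best constant because the inner product is degenerate.
\<close>

definition op_norm :: "'n free \<Rightarrow> real" where
  "op_norm a = Inf {C. 0 \<le> C \<and> (\<forall>f\<in>tail_space. nrm (free_act a f) \<le> C * nrm f)}"

lemma op_norm_nonneg: "0 \<le> op_norm a"
  unfolding op_norm_def using free_act_bounded[of a] by (intro cInf_greatest) auto

lemma op_norm_least:
  "0 \<le> C \<Longrightarrow> (\<And>f. f \<in> tail_space \<Longrightarrow> nrm (free_act a f) \<le> C * nrm f) \<Longrightarrow> op_norm a \<le> C"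
  unfolding op_norm_def by (intro cInf_lower bdd_belowI[of _ 0]) auto

lemma op_norm_bound:
  assumes f: "f \<in> tail_space"
  shows "nrm (free_act a f) \<le> op_norm a * nrm f"
proof (cases "nrm f = 0")
  case True
  then show ?thesis using free_act_bounded[of a] f by fastforce
next
  case False
  then have pos: "nrm f > 0" using ip_self(2)[OF f] by simp
  then have "nrm (free_act a f) / nrm f \<le> op_norm a"
    unfolding op_norm_def using free_act_bounded[of a] f
    by (intro cInf_greatest) (auto simp: field_simps)
  then show ?thesis using pos by (simp add: field_simps)
qed

lemma op_norm_star_le: "op_norm (free_star a) \<le> op_norm a"
proof (rule op_norm_least[OF op_norm_nonneg])
  fix f assume f: "f \<in> tail_space"
  let ?h = "free_act (free_star a) f"
  have h: "?h \<in> tail_space" by (rule tail_space_free_act[OF f])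
  have "(nrm ?h)\<^sup>2 = cmod (ip ?h ?h)"
    unfolding ip_self(1)[OF h] norm_of_real by simp
  also have "ip ?h ?h = ip f (free_act a ?h)"
    using ip_free_act[OF f h, of "free_star a"] by simp
  also have "cmod \<dots> \<le> nrm f * nrm (free_act a ?h)"
    by (rule ip_Cauchy_Schwarz[OF f tail_space_free_act[OF h]])
  also have "\<dots> \<le> nrm f * (op_norm a * nrm ?h)"
    by (rule mult_left_mono[OF op_norm_bound[OF h] ip_self(2)[OF f]])
  finally have "nrm ?h * nrm ?h \<le> (op_norm a * nrm f) * nrm ?h"
    by (simp add: power2_eq_square mult_ac)
  then show "nrm ?h \<le> op_norm a * nrm f"
    using ip_self(2)[OF h] ip_self(2)[OF f] op_norm_nonneg[of a] by (cases "nrm ?h = 0") auto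
qed

text \<open>
  The operator norm of any *-representation is a C*-seminorm. The relation for the sum of the range projections holds
  up to functions supported on the empty word, and these have norm zero.
\<close>

lemma cuntz_seminorm_op_norm: "cuntz_seminorm op_norm"
  unfolding cuntz_seminorm_def
proof (intro conjI allI)
  fix a b :: "'n free" and c :: complex and i j :: 'n
  show "op_norm (a + b) \<le> op_norm a + op_norm b"
  proof (rule op_norm_least)
    fix f assume f: "f \<in> tail_space"
    show "nrm (free_act (a + b) f) \<le> (op_norm a + op_norm b) * nrm f"
      using nrm_triangle[OF tail_space_free_act[OF f] tail_space_free_act[OF f], of a b]
        op_norm_bound[OF f, of a] op_norm_bound[OF f, of b]
      by (simp add: free_act_add distrib_right)
  qed (simp add: op_norm_nonneg)
  show mult: "op_norm (a * b) \<le> op_norm a * op_norm b" for a b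
  proof (rule op_norm_least)
    fix f assume f: "f \<in> tail_space"
    have "nrm (free_act a (free_act b f)) \<le> op_norm a * (op_norm b * nrm f)"
      using op_norm_bound[OF tail_space_free_act[OF f], of a b] op_norm_bound[OF f, of b]
        mult_left_mono[OF _ op_norm_nonneg] order_trans by blast
    then show "nrm (free_act (a * b) f) \<le> op_norm a * op_norm b * nrm f"
      by (simp add: free_act_mult mult.assoc)
  qed (simp add: op_norm_nonneg)
  have scale: "op_norm (free_scale c a) \<le> cmod c * op_norm a" for c a
  proof (rule op_norm_least)
    fix f assume f: "f \<in> tail_space"
    show "nrm (free_act (free_scale c a) f) \<le> cmod c * op_norm a * nrm f"
      using op_norm_bound[OF f, of a]
      by (simp add: free_act_free_scale nrm_scale tail_space_free_act f mult.assoc mult_left_mono)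
  qed (simp add: op_norm_nonneg)
  show "op_norm (free_scale c a) = cmod c * op_norm a"
  proof (cases "c = 0")
    case True
    then show ?thesis
      using scale[of 0 a] op_norm_nonneg[of "free_scale 0 a"] by simp
  next
    case False
    then have "op_norm a \<le> cmod (inverse c) * op_norm (free_scale c a)"
      using scale[of "inverse c" "free_scale c a"] by (simp add: free_scale_simps)
    then show ?thesis
      using scale[of c a] False by (simp add: norm_inverse norm_divide field_simps)
  qed
  show "op_norm (free_star a * a) = (op_norm a)\<^sup>2"
  proof (rule antisym)
    show "op_norm (free_star a * a) \<le> (op_norm a)\<^sup>2"
      using order_trans[OF mult mult_right_mono[OF op_norm_star_le op_norm_nonneg]]
      by (simp add: power2_eq_square)
    have "op_norm a \<le> sqrt (op_norm (free_star a * a))"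
    proof (rule op_norm_least)
      fix f assume f: "f \<in> tail_space"
      let ?h = "free_act a f"
      have h: "?h \<in> tail_space" by (rule tail_space_free_act[OF f])
      have "(nrm ?h)\<^sup>2 = cmod (ip ?h ?h)"
        unfolding ip_self(1)[OF h] norm_of_real by simp
      also have "ip ?h ?h = ip f (free_act (free_star a * a) f)"
        using ip_free_act[OF f h] by (simp add: free_act_mult)
      also have "cmod \<dots> \<le> nrm f * nrm (free_act (free_star a * a) f)"
        by (rule ip_Cauchy_Schwarz[OF f tail_space_free_act[OF f]])
      also have "\<dots> \<le> nrm f * (op_norm (free_star a * a) * nrm f)"
        by (rule mult_left_mono[OF op_norm_bound[OF f] ip_self(2)[OF f]])
      also have "\<dots> = (sqrt (op_norm (free_star a * a)) * nrm f)\<^sup>2"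
        using op_norm_nonneg by (simp add: power_mult_distrib power2_eq_square[of "nrm f"])
      finally show "nrm ?h \<le> sqrt (op_norm (free_star a * a)) * nrm f"
        by (rule power2_le_imp_le) (simp add: op_norm_nonneg ip_self(2)[OF f])
    qed (simp add: op_norm_nonneg)
    then have "(op_norm a)\<^sup>2 \<le> (sqrt (op_norm (free_star a * a)))\<^sup>2"
      by (rule power_mono[OF _ op_norm_nonneg])
    then show "(op_norm a)\<^sup>2 \<le> op_norm (free_star a * a)"
      by (simp add: op_norm_nonneg)
  qed
  have zero: "op_norm b = 0" if "\<And>f J. 1 \<le> length J \<Longrightarrow> free_act b f J = 0" for b
  proof (rule antisym[OF op_norm_least op_norm_nonneg])
    fix f
    have "nrm (free_act b f) = 0" by (rule nrm_eventually_zero[OF that])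
    then show "nrm (free_act b f) \<le> 0 * nrm f" by simp
  qed simp
  show "op_norm (free_star (free_gen i) * free_gen j - (if i = j then 1 else 0)) = 0"
    by (rule zero) (simp add: free_act_diff free_act_mult free_act_gen free_act_gen_star free_act_one free_act_zero)
  show "op_norm ((\<Sum>i\<in>UNIV. free_gen i * free_star (free_gen i)) - 1) = 0"
  proof (rule zero)
    fix f :: "'n list \<Rightarrow> complex" and J :: "'n list" assume "1 \<le> length J"
    then obtain k K where J: "J = k # K" by (cases J) auto
    show "free_act ((\<Sum>i\<in>UNIV. free_gen i * free_star (free_gen i)) - 1) f J = 0"
      by (simp add: J free_act_diff free_act_sum free_act_mult free_act_gen free_act_gen_star free_act_one)
  qed
qed

text \<open>
  The class of the empty tensor in the limit: its representatives are the tensor powers of z, and 0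
  in the degrees that m does not divide (by the convention that a tensor vanishes on words of a
  wrong length). Prefixing it with z gives it back, so it is fixed by the isometry of z.
\<close>

definition vacuum :: "'n list \<Rightarrow> complex" where
  "vacuum J = tensor_power m z (length J div m) J"

lemma vacuum_append_left: "length K = m \<Longrightarrow> vacuum (K @ J) = z K * vacuum J"
  using m by (simp add: vacuum_def tensor_append)

lemma vacuum_append_right:
  assumes "length L = m"
  shows "vacuum (J @ L) = vacuum J * z L"
proof -
  have zt: "z \<in> tensor_space m" using z by (simp add: unit_vectors_def)
  define p where "p = length J div m"
  have "tensor_power m z (p + 1) = tensor (p * m) (tensor_power m z p) z"
    using tensor_power_add[of p m z 1] tensor_power_one[OF zt] by simp
  then have v: "vacuum (J @ L) = tensor (p * m) (tensor_power m z p) z (J @ L)"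
    using assms m by (simp add: vacuum_def p_def del: tensor_power.simps)
  show ?thesis
  proof (cases "length J = p * m")
    case True
    then show ?thesis using v by (simp add: tensor_append vacuum_def p_def)
  next
    case False
    then have "tensor_power m z p J = 0" "length (J @ L) \<noteq> p * m + m"
      using tensor_power_in_tensor_space[OF zt, of p] assms by (simp_all add: tensor_space_def)
    moreover have "tensor (p * m) (tensor_power m z p) z \<in> tensor_space (p * m + m)"
      by (intro tensor_in_tensor_space tensor_power_in_tensor_space zt)
    ultimately show ?thesis
      using v by (simp add: tensor_space_def vacuum_def flip: p_def)
  qed
qed

lemma vacuum_in_tail_space: "vacuum \<in> tail_space"
  unfolding tail_space_def using vacuum_append_right by blast

lemma ip_vacuum: "ip vacuum vacuum = 1"
proof -
  have "layer k vacuum vacuum = (if k = 0 then 1 else 0)" if "k < m" for k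
  proof (cases "k = 0")
    case True
    have "{J :: 'n list. length J = 0} = {[]}" by auto
    then show ?thesis using True by (simp add: layer_def vacuum_def)
  next
    case False
    then have "vacuum J = 0" if "length J = k" for J
      using that \<open>k < m\<close> by (auto simp: vacuum_def)
    then show ?thesis using False by (simp add: layer_def)
  qed
  then have "window 0 vacuum vacuum = (\<Sum>k<m. if k = 0 then 1 else 0)"
    by (simp add: window_def)
  also have "\<dots> = 1" using m by simp
  finally show ?thesis
    using ip_eq_window(2)[of 0 vacuum vacuum] vacuum_append_right by simp
qed

lemma nrm_vacuum: "nrm vacuum = 1"
  by (simp add: nrm_def ip_vacuum)

lemma vacuum_bound: "cmod (ip vacuum (free_act a vacuum)) \<le> cuntz_norm a"
proof -
  have "cmod (ip vacuum (free_act a vacuum)) \<le> op_norm a"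
    using ip_Cauchy_Schwarz[OF vacuum_in_tail_space tail_space_free_act[OF vacuum_in_tail_space]]
      op_norm_bound[OF vacuum_in_tail_space] order_trans
    by (metis mult.left_neutral mult.right_neutral nrm_vacuum)
  then show ?thesis
    using cuntz_norm_upper[OF cuntz_seminorm_op_norm] order_trans by blast
qed

text \<open>
  Stripping a word J of length m from the vacuum multiplies it by the coordinate of z at J.
\<close>

lemma vacuum_monomial:
  assumes "length J = m"
  shows "ip vacuum (free_act (Poly_Mapping.single (Word (map Gen J)) 1) vacuum) = cnj (z J)"
proof -
  let ?a = "Poly_Mapping.single (Word (map Gen J)) (1 :: complex)"
  have word: "word_act (Word (map Gen_star (rev J))) f = (\<lambda>K. f (J @ K))" for f :: "'n list \<Rightarrow> complex" and J
  proof (induction J arbitrary: f)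
    case (Cons i J)
    have "word_act (Word (map Gen_star (rev (i # J)))) f = word_act (Word (map Gen_star (rev J))) (gen_act (Gen_star i) f)"
      by (simp add: word_act_def)
    then show ?case unfolding Cons.IH by simp
  qed simp
  have "free_act (free_star ?a) vacuum = (\<lambda>K. z J * vacuum K)"
    using word[of J vacuum] vacuum_append_left[OF assms]
    by (simp add: free_star_single word_star_def free_act_single comp_def rev_map)
  moreover have "ip vacuum (free_act ?a vacuum) = ip (free_act (free_star ?a) vacuum) vacuum"
    using ip_free_act[OF vacuum_in_tail_space vacuum_in_tail_space, of "free_star ?a"] by simp
  ultimately show ?thesis
    by (simp add: ip_scale_left vacuum_in_tail_space ip_vacuum)
qed

end

text \<open>
  A functional on the free algebra that is bounded by the universal C*-seminorm extends to the
  completion by continuity, and positivity survives the limit.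
\<close>

lemma cuntz_state_extension:
  fixes \<phi> :: "'n::finite free \<Rightarrow> complex"
  assumes add: "\<And>a b. \<phi> (a + b) = \<phi> a + \<phi> b" and scale: "\<And>c a. \<phi> (free_scale c a) = c * \<phi> a"
    and pos: "\<And>a. \<phi> (free_star a * a) \<in> \<real>\<^sub>\<ge>\<^sub>0" and one: "\<phi> 1 = 1"
    and bound: "\<And>a. cmod (\<phi> a) \<le> cuntz_norm a"
  obtains \<omega> where "state \<omega>" "\<And>a. \<omega> (cuntz_of_free a) = \<phi> a"
proof -
  have "\<exists>X. (\<lambda>k. cuntz_of_free (X k)) \<longlonglongrightarrow> x" for x :: "'n cuntz"
    using cuntz_exhaust[of x] cuntz_of_free_tendsto by metis
  then obtain R where R: "\<And>x :: 'n cuntz. (\<lambda>k. cuntz_of_free (R x k)) \<longlonglongrightarrow> x" by metis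
  define \<omega> where "\<omega> x = lim (\<lambda>k. \<phi> (R x k))" for x
  have diff: "cmod (\<phi> a - \<phi> b) \<le> norm (cuntz_of_free a - cuntz_of_free b)" for a b
    using bound[of "a - b"] add[of "a - b" b] by (simp add: norm_cuntz_of_free flip: cuntz_of_free_diff)
  have lim_R: "(\<lambda>k. \<phi> (R x k)) \<longlonglongrightarrow> \<omega> x" for x
  proof -
    have "Cauchy (\<lambda>k. \<phi> (R x k))"
    proof (rule CauchyI)
      fix e :: real assume "e > 0"
      then obtain M where "\<And>m k. m \<ge> M \<Longrightarrow> k \<ge> M \<Longrightarrow>
          norm (cuntz_of_free (R x m) - cuntz_of_free (R x k)) < e"
        using CauchyD[OF LIMSEQ_imp_Cauchy[OF R[of x]]] by meson
      then show "\<exists>M. \<forall>m\<ge>M. \<forall>k\<ge>M. norm (\<phi> (R x m) - \<phi> (R x k)) < e"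
        using diff by (meson le_less_trans)
    qed
    then show ?thesis
      unfolding \<omega>_def using Cauchy_convergent convergent_LIMSEQ_iff by blast
  qed
  have lim: "(\<lambda>k. \<phi> (A k)) \<longlonglongrightarrow> \<omega> x" if "(\<lambda>k. cuntz_of_free (A k)) \<longlonglongrightarrow> x" for A x
  proof -
    have "(\<lambda>k. norm (cuntz_of_free (A k) - cuntz_of_free (R x k))) \<longlonglongrightarrow> 0"
      using tendsto_norm[OF tendsto_diff[OF that R[of x]]] by simp
    then have "(\<lambda>k. \<phi> (A k) - \<phi> (R x k)) \<longlonglongrightarrow> 0"
      by (rule Lim_null_comparison[OF always_eventually, rotated]) (simp add: diff)
    from tendsto_add[OF this lim_R[of x]] show ?thesis by simp
  qed
  have eq: "\<omega> (cuntz_of_free a) = \<phi> a" for a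
    using LIMSEQ_unique[OF lim[of "\<lambda>k. a" "cuntz_of_free a"] tendsto_const] by simp
  have "state \<omega>"
    unfolding state_def
  proof (intro conjI allI)
    fix x y and c
    show "\<omega> (x + y) = \<omega> x + \<omega> y"
      using LIMSEQ_unique[OF lim[of "\<lambda>k. R x k + R y k" "x + y"]
          tendsto_add[OF lim_R lim_R, of x y, folded add]] tendsto_add[OF R R]
      by (simp add: cuntz_of_free_simps)
    show "\<omega> (c *\<^sub>C x) = c * \<omega> x"
      using LIMSEQ_unique[OF lim[of "\<lambda>k. free_scale c (R x k)" "c *\<^sub>C x"]
          tendsto_mult_left[OF lim_R, of c x, folded scale]]
        bounded_linear.tendsto[OF bounded_linear_scaleC R, of c]
      by (simp add: cuntz_of_free_simps)
    have "(\<lambda>k. cuntz_of_free (free_star (R x k) * R x k)) \<longlonglongrightarrow> star x * x"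
      using tendsto_mult[OF bounded_linear.tendsto[OF bounded_linear_star R] R]
      by (simp add: cuntz_of_free_simps)
    from closed_sequentially[OF closed_nonneg_Reals_complex pos lim[OF this]]
    show "\<omega> (star x * x) \<in> \<real>\<^sub>\<ge>\<^sub>0" .
    show "\<omega> 1 = 1"
      using eq[of 1] one by (simp add: cuntz_of_free_simps)
  qed
  with eq that show thesis by blast
qed

lemma cuntz_monomial_eq_word: "cuntz_monomial J = cuntz_of_free (Poly_Mapping.single (Word (map Gen J)) 1)"
  by (simp add: cuntz_monomial_def cuntz_of_free_eq_free_eval free_eval_single word_eval_def comp_def)

text \<open>
  The vector state of the vacuum; its bound by the universal seminorm is the bound by one particular C*-seminorm.
\<close>

lemma sub_cuntz_state_exists:
  assumes "1 \<le> m" "z \<in> unit_vectors m"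
  shows "\<exists>\<omega>. sub_cuntz_state z \<omega>"
proof -
  interpret unit_tensor m z by unfold_locales (use assms in auto)
  note v = vacuum_in_tail_space and av = tail_space_free_act[OF vacuum_in_tail_space]
  have "ip vacuum (free_act (free_star a * a) vacuum) = ip (free_act a vacuum) (free_act a vacuum)" for a
    using ip_free_act[OF v av, of a a] by (simp add: free_act_mult)
  then have "ip vacuum (free_act (free_star a * a) vacuum) \<in> \<real>\<^sub>\<ge>\<^sub>0" for a
    unfolding ip_self(1)[OF av] by (simp del: of_real_power)
  then obtain \<omega> where "state \<omega>" "\<And>a. \<omega> (cuntz_of_free a) = ip vacuum (free_act a vacuum)"
    using cuntz_state_extension[of "\<lambda>a. ip vacuum (free_act a vacuum)"] vacuum_bound
    by (auto simp: free_act_add free_act_free_scale free_act_one ip_vacuum ip_add_right ip_scale_right v av)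
  then show ?thesis
    unfolding sub_cuntz_state_def using assms vacuum_monomial cuntz_monomial_eq_word by metis
qed


section \<open>The action of the unitary group\<close>

lemma adjoint_matrix_adjoint_matrix [simp]: "adjoint_matrix (adjoint_matrix g) = g"
  by (simp add: adjoint_matrix_def vec_eq_iff)

lemma unitary_adjoint: "unitary g \<Longrightarrow> unitary (adjoint_matrix g)"
  by (simp add: unitary_def)

lemma
  assumes "unitary g"
  shows unitary_columns: "(\<Sum>i\<in>UNIV. cnj (g $ i $ j) * g $ i $ k) = (if j = k then 1 else 0)"
    and unitary_rows: "(\<Sum>i\<in>UNIV. g $ j $ i * cnj (g $ k $ i)) = (if j = k then 1 else 0)"
proof -
  have "(adjoint_matrix g ** g) $ j $ k = mat 1 $ j $ k" "(g ** adjoint_matrix g) $ j $ k = mat 1 $ j $ k"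
    using assms by (simp_all add: unitary_def)
  then show "(\<Sum>i\<in>UNIV. cnj (g $ i $ j) * g $ i $ k) = (if j = k then 1 else 0)"
    "(\<Sum>i\<in>UNIV. g $ j $ i * cnj (g $ k $ i)) = (if j = k then 1 else 0)"
    by (simp_all add: matrix_matrix_mult_def adjoint_matrix_def mat_def)
qed

definition rotated_gen :: "complex^'n^'n \<Rightarrow> 'n::finite \<Rightarrow> 'n cuntz" where
  "rotated_gen g i = (\<Sum>j\<in>UNIV. (g $ j $ i) *\<^sub>C cuntz_gen j)"

lemma scaleC_sum_left: "(\<Sum>i\<in>A. c i) *\<^sub>C x = (\<Sum>i\<in>A. c i *\<^sub>C (x :: 'a::unital_cstar_algebra))"
  by (induction A rule: infinite_finite_induct) (simp_all add: scaleC_add_left)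

lemma cuntz_family_rotated_gen:
  assumes g: "unitary g"
  shows "cuntz_family (rotated_gen g)"
  unfolding cuntz_family_def
proof (intro conjI allI)
  fix i k
  have "star (rotated_gen g i) * rotated_gen g k =
      (\<Sum>j\<in>UNIV. \<Sum>l\<in>UNIV. (cnj (g $ j $ i) * g $ l $ k) *\<^sub>C (star (cuntz_gen j) * cuntz_gen l))"
    by (simp add: rotated_gen_def star_sum star_scaleC sum_product mult_scaleC_left mult_scaleC_right
        scaleC_scaleC mult.commute)
  also have "\<dots> = (\<Sum>j\<in>UNIV. \<Sum>l\<in>UNIV. if j = l then (cnj (g $ j $ i) * g $ j $ k) *\<^sub>C 1 else 0)"
    by (intro sum.cong refl) (simp add: star_cuntz_gen_mult)
  also have "\<dots> = (\<Sum>j\<in>UNIV. cnj (g $ j $ i) * g $ j $ k) *\<^sub>C 1"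
    by (simp add: scaleC_sum_left)
  finally show "star (rotated_gen g i) * rotated_gen g k = (if i = k then 1 else 0)"
    by (simp add: unitary_columns[OF g])
next
  have "(\<Sum>i\<in>UNIV. rotated_gen g i * star (rotated_gen g i)) =
      (\<Sum>i\<in>UNIV. \<Sum>j\<in>UNIV. \<Sum>l\<in>UNIV. (g $ j $ i * cnj (g $ l $ i)) *\<^sub>C (cuntz_gen j * star (cuntz_gen l)))"
    by (simp add: rotated_gen_def star_sum star_scaleC sum_product mult_scaleC_left mult_scaleC_right
        scaleC_scaleC mult.commute)
  also have "\<dots> = (\<Sum>j\<in>UNIV. \<Sum>i\<in>UNIV. \<Sum>l\<in>UNIV. (g $ j $ i * cnj (g $ l $ i)) *\<^sub>C (cuntz_gen j * star (cuntz_gen l)))"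
    by (rule sum.swap)
  also have "\<dots> = (\<Sum>j\<in>UNIV. \<Sum>l\<in>UNIV. \<Sum>i\<in>UNIV. (g $ j $ i * cnj (g $ l $ i)) *\<^sub>C (cuntz_gen j * star (cuntz_gen l)))"
    by (rule sum.cong[OF refl], rule sum.swap)
  also have "\<dots> = (\<Sum>j\<in>UNIV. \<Sum>l\<in>UNIV. if j = l then cuntz_gen j * star (cuntz_gen j) else 0)"
    by (intro sum.cong refl) (simp add: unitary_rows[OF g] flip: scaleC_sum_left)
  also have "\<dots> = 1"
    using cuntz_family_gen[where 'n = 'a] by (simp add: cuntz_family_def)
  finally show "(\<Sum>i\<in>UNIV. rotated_gen g i * star (rotated_gen g i)) = 1" .
qed

lemma star_hom_sum: "unital_star_hom \<phi> \<Longrightarrow> \<phi> (\<Sum>i\<in>A. f i) = (\<Sum>i\<in>A. \<phi> (f i))"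
  using star_hom_scaleC[of \<phi> 0 0]
  by (induction A rule: infinite_finite_induct) (simp_all add: star_hom_add)

lemma star_hom_comp: "unital_star_hom \<phi> \<Longrightarrow> unital_star_hom \<psi> \<Longrightarrow> unital_star_hom (\<lambda>x. \<phi> (\<psi> x))"
  by (simp add: unital_star_hom_def)

lemma star_hom_cuntz_eqI:
  fixes \<phi> \<psi> :: "'n::finite cuntz \<Rightarrow> 'a::unital_cstar_algebra"
  assumes "cuntz_family t" "unital_star_hom \<phi>" "unital_star_hom \<psi>"
    and "\<And>i. \<phi> (cuntz_gen i) = t i" "\<And>i. \<psi> (cuntz_gen i) = t i"
  shows "\<phi> = \<psi>"
  by (rule ex1E[OF cuntz_universal[OF assms(1)]]) (metis assms(2-))

text \<open>
  The composition fixes the generators because g times its adjoint is 1, so it is the identity by the universal property.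
\<close>

lemma rotations_inverse:
  fixes g :: "complex^'n::finite^'n"
  assumes g: "unitary g" and \<phi>: "unital_star_hom \<phi>" "\<And>i. \<phi> (cuntz_gen i) = rotated_gen g i"
    and \<psi>: "unital_star_hom \<psi>" "\<And>i. \<psi> (cuntz_gen i) = rotated_gen (adjoint_matrix g) i"
  shows "\<phi> (\<psi> x) = x"
proof -
  have "\<phi> (\<psi> (cuntz_gen i)) = cuntz_gen i" for i
  proof -
    have "\<phi> (\<psi> (cuntz_gen i)) = (\<Sum>j\<in>UNIV. \<Sum>l\<in>UNIV. (g $ l $ j * cnj (g $ i $ j)) *\<^sub>C cuntz_gen l)"
      unfolding \<psi>(2) rotated_gen_def
      by (simp add: star_hom_sum[OF \<phi>(1)] star_hom_scaleC[OF \<phi>(1)] \<phi>(2) rotated_gen_def scaleC_sum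
          scaleC_scaleC adjoint_matrix_def mult.commute)
    also have "\<dots> = (\<Sum>l\<in>UNIV. \<Sum>j\<in>UNIV. (g $ l $ j * cnj (g $ i $ j)) *\<^sub>C cuntz_gen l)"
      by (rule sum.swap)
    also have "\<dots> = (\<Sum>l\<in>UNIV. if l = i then cuntz_gen l else 0)"
      by (intro sum.cong refl) (simp add: unitary_rows[OF g] flip: scaleC_sum_left)
    finally show ?thesis by simp
  qed
  then have "(\<lambda>x. \<phi> (\<psi> x)) = (\<lambda>x. x)"
    by (intro star_hom_cuntz_eqI[OF cuntz_family_gen star_hom_comp[OF \<phi>(1) \<psi>(1)]])
       (simp_all add: unital_star_hom_def)
  then show ?thesis by (rule fun_cong)
qed

lemma
  fixes g :: "complex^'n::finite^'n"
  assumes g: "unitary g"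
  shows cuntz_aut_hom: "unital_star_hom (cuntz_aut g)"
    and cuntz_aut_gen: "cuntz_aut g (cuntz_gen i) = rotated_gen g i"
proof -
  obtain \<phi> :: "'n cuntz \<Rightarrow> 'n cuntz" where \<phi>: "unital_star_hom \<phi>" "\<And>i. \<phi> (cuntz_gen i) = rotated_gen g i"
    using cuntz_universal[OF cuntz_family_rotated_gen[OF g]] by blast
  obtain \<psi> :: "'n cuntz \<Rightarrow> 'n cuntz" where \<psi>: "unital_star_hom \<psi>"
      "\<And>i. \<psi> (cuntz_gen i) = rotated_gen (adjoint_matrix g) i"
    using cuntz_universal[OF cuntz_family_rotated_gen[OF unitary_adjoint[OF g]]] by blast
  have "\<phi> (\<psi> x) = x" "\<psi> (\<phi> x) = x" for x
    using rotations_inverse[OF g \<phi> \<psi>] rotations_inverse[OF unitary_adjoint[OF g] \<psi> \<phi>(1)] \<phi>(2) by simp_all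
  then have "bij \<phi>" by (intro o_bij[of \<psi>]) (simp_all add: fun_eq_iff)
  have "\<exists>!\<phi>. star_automorphism \<phi> \<and> (\<forall>i. \<phi> (cuntz_gen i) = rotated_gen g i)"
  proof (rule ex1I)
    show "star_automorphism \<phi> \<and> (\<forall>i. \<phi> (cuntz_gen i) = rotated_gen g i)"
      using \<phi> \<open>bij \<phi>\<close> by (simp add: star_automorphism_def)
    fix \<eta> :: "'n cuntz \<Rightarrow> 'n cuntz"
    assume "star_automorphism \<eta> \<and> (\<forall>i. \<eta> (cuntz_gen i) = rotated_gen g i)"
    then show "\<eta> = \<phi>"
      using \<phi> by (intro star_hom_cuntz_eqI[OF cuntz_family_rotated_gen[OF g]]) (simp_all add: star_automorphism_def)
  qed
  then have "star_automorphism (cuntz_aut g) \<and> (\<forall>i. cuntz_aut g (cuntz_gen i) = rotated_gen g i)"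
    unfolding cuntz_aut_def rotated_gen_def by (rule theI')
  then show "unital_star_hom (cuntz_aut g)" "cuntz_aut g (cuntz_gen i) = rotated_gen g i"
    by (auto simp: star_automorphism_def)
qed

lemma cuntz_aut_inverse:
  assumes "unitary g"
  shows "cuntz_aut g (cuntz_aut (adjoint_matrix g) x) = x"
  by (rule rotations_inverse[OF assms cuntz_aut_hom[OF assms] cuntz_aut_gen[OF assms]
        cuntz_aut_hom[OF unitary_adjoint[OF assms]] cuntz_aut_gen[OF unitary_adjoint[OF assms]]])

text \<open>
  The matrix of the tensor powers of \<open>gamma_op g\<close>, with columns indexed by K and rows by J. The same
  matrix describes the action of the automorphism on monomials, which is why the two actions match.
\<close>

definition tensor_matrix :: "complex^'n^'n \<Rightarrow> 'n::finite list \<Rightarrow> 'n list \<Rightarrow> complex" where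
  "tensor_matrix g K J = elementary_tensor (map (\<lambda>k. gamma_op g (axis k 1)) K) J"

lemma Gamma_op_tensor_matrix: "Gamma_op g z J = (\<Sum>K | length K = length J. z K * tensor_matrix g K J)"
  by (simp add: Gamma_op_def tensor_matrix_def)

lemma tensor_matrix_Nil: "tensor_matrix g [] [] = 1"
  by (simp add: tensor_matrix_def elementary_tensor_def)

lemma gamma_op_axis_nth: "gamma_op g (axis k 1) $ j = g $ j $ k"
  by (simp add: gamma_op_def matrix_vector_mult_def axis_def if_distrib cong: if_cong)

lemma tensor_matrix_Cons: "tensor_matrix g (k # K) (j # J) = g $ j $ k * tensor_matrix g K J"
  by (simp add: tensor_matrix_def elementary_tensor_def gamma_op_axis_nth prod.lessThan_Suc_shift
      del: prod.lessThan_Suc)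

lemma tensor_matrix_adjoint:
  "length K = length J \<Longrightarrow> tensor_matrix (adjoint_matrix g) K J = cnj (tensor_matrix g J K)"
  by (induction K J rule: list_induct2)
     (simp_all add: tensor_matrix_Nil tensor_matrix_Cons adjoint_matrix_def)

lemma tensor_matrix_orthonormal:
  assumes g: "unitary g"
  shows "length K = length L \<Longrightarrow>
    (\<Sum>J | length J = length L. cnj (tensor_matrix g K J) * tensor_matrix g L J) = (if K = L then 1 else 0)"
proof (induction K L rule: list_induct2)
  case Nil
  have "{J :: 'a list. length J = 0} = {[]}" by auto
  then show ?case by (simp add: tensor_matrix_Nil)
next
  case (Cons k K l L)
  have "(\<Sum>J | length J = length (l # L). cnj (tensor_matrix g (k # K) J) * tensor_matrix g (l # L) J) =
    (\<Sum>j\<in>UNIV. \<Sum>J | length J = length L. (cnj (g $ j $ k) * g $ j $ l) * (cnj (tensor_matrix g K J) * tensor_matrix g L J))"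
    by (simp add: sum_lists_Cons tensor_matrix_Cons mult_ac)
  also have "\<dots> = (if k = l then 1 else 0) * (if K = L then 1 else 0)"
    unfolding sum_product[symmetric] unitary_columns[OF g] Cons.IH ..
  finally show ?case by simp
qed

lemma Gamma_op_inverse:
  assumes g: "unitary g"
  shows "Gamma_op (adjoint_matrix g) (Gamma_op g z) = z"
proof
  fix J :: "'a list"
  have "Gamma_op (adjoint_matrix g) (Gamma_op g z) J =
      (\<Sum>K | length K = length J. \<Sum>L | length L = length J. z L * (cnj (tensor_matrix g J K) * tensor_matrix g L K))"
    by (simp add: Gamma_op_tensor_matrix tensor_matrix_adjoint sum_distrib_left sum_distrib_right mult_ac)
  also have "\<dots> = (\<Sum>L | length L = length J. z L * (\<Sum>K | length K = length J. cnj (tensor_matrix g J K) * tensor_matrix g L K))"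
    unfolding sum_distrib_left by (rule sum.swap)
  also have "\<dots> = (\<Sum>L | length L = length J. if J = L then z L else 0)"
  proof (rule sum.cong[OF refl])
    fix L :: "'a list" assume "L \<in> {L. length L = length J}"
    then have "length J = length L" by simp
    with tensor_matrix_orthonormal[OF g this]
    show "z L * (\<Sum>K | length K = length J. cnj (tensor_matrix g J K) * tensor_matrix g L K) = (if J = L then z L else 0)"
      by simp
  qed
  finally show "Gamma_op (adjoint_matrix g) (Gamma_op g z) J = z J" by simp
qed

lemma Gamma_op_unit_vectors:
  assumes g: "unitary g" and z: "z \<in> unit_vectors m"
  shows "Gamma_op g z \<in> unit_vectors m"
proof -
  have "Gamma_op g z \<in> tensor_space m"
    using z by (simp add: Gamma_op_tensor_matrix tensor_space_def unit_vectors_def)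
  have norm_square: "complex_of_real ((cmod w)\<^sup>2) = cnj w * w" for w
    by (metis complex_norm_square mult.commute)
  have "complex_of_real (\<Sum>J | length J = m. (cmod (Gamma_op g z J))\<^sup>2) =
      (\<Sum>J | length J = m. \<Sum>K | length K = m. \<Sum>L | length L = m.
        (cnj (z K) * z L) * (cnj (tensor_matrix g K J) * tensor_matrix g L J))"
    unfolding of_real_sum norm_square Gamma_op_tensor_matrix cnj_sum sum_product
    by (intro sum.cong) (auto simp: mult_ac)
  also have "\<dots> = (\<Sum>K | length K = m. \<Sum>J | length J = m. \<Sum>L | length L = m.
        (cnj (z K) * z L) * (cnj (tensor_matrix g K J) * tensor_matrix g L J))"
    by (rule sum.swap)
  also have "\<dots> = (\<Sum>K | length K = m. \<Sum>L | length L = m. (cnj (z K) * z L) *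
      (\<Sum>J | length J = m. cnj (tensor_matrix g K J) * tensor_matrix g L J))"
    unfolding sum_distrib_left by (rule sum.cong[OF refl], rule sum.swap)
  also have "\<dots> = (\<Sum>K | length K = m. \<Sum>L | length L = m. if K = L then complex_of_real ((cmod (z K))\<^sup>2) else 0)"
  proof (intro sum.cong refl)
    fix K L :: "'a list" assume "K \<in> {K. length K = m}" "L \<in> {L. length L = m}"
    then have "length K = length L" "length L = m" by auto
    with tensor_matrix_orthonormal[OF g this(1)]
    show "(cnj (z K) * z L) * (\<Sum>J | length J = m. cnj (tensor_matrix g K J) * tensor_matrix g L J) =
        (if K = L then complex_of_real ((cmod (z K))\<^sup>2) else 0)"
      by (simp add: complex_norm_square mult.commute del: of_real_power)
  qed
  also have "\<dots> = complex_of_real (\<Sum>K | length K = m. (cmod (z K))\<^sup>2)"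
    by simp
  finally have "(\<Sum>J | length J = m. (cmod (Gamma_op g z J))\<^sup>2) = (\<Sum>K | length K = m. (cmod (z K))\<^sup>2)"
    by (simp only: of_real_eq_iff)
  then show ?thesis
    using z \<open>Gamma_op g z \<in> tensor_space m\<close> by (simp add: unit_vectors_def)
qed

lemma cuntz_aut_monomial:
  assumes g: "unitary g"
  shows "cuntz_aut g (cuntz_monomial K) = (\<Sum>J | length J = length K. tensor_matrix g K J *\<^sub>C cuntz_monomial J)"
proof (induction K)
  case Nil
  have "{J :: 'a list. length J = 0} = {[]}" by auto
  then show ?case by (simp add: tensor_matrix_Nil star_hom_one[OF cuntz_aut_hom[OF g]])
next
  case (Cons k K)
  have "cuntz_aut g (cuntz_monomial (k # K)) =
     rotated_gen g k * (\<Sum>J | length J = length K. tensor_matrix g K J *\<^sub>C cuntz_monomial J)"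
    unfolding cuntz_monomial_Cons star_hom_mult[OF cuntz_aut_hom[OF g]] cuntz_aut_gen[OF g] Cons.IH ..
  then show ?case
    by (simp add: rotated_gen_def sum_product sum_lists_Cons tensor_matrix_Cons cuntz_monomial_Cons
        mult_scaleC_left mult_scaleC_right scaleC_scaleC mult.commute)
qed

lemma state_comp_hom: "state \<omega> \<Longrightarrow> unital_star_hom \<phi> \<Longrightarrow> state (\<omega> \<circ> \<phi>)"
  by (simp add: state_def unital_star_hom_def)

text \<open>
  The value at a monomial J involves the matrix of the adjoint of g in the entry (J, K) against the conjugate
  of z at K; this is the conjugate of the matrix of g in the entry (K, J) against z, so of
  \<open>Gamma_op g z\<close> at J.
\<close>

lemma sub_cuntz_state_cuntz_aut_dual:
  assumes g: "unitary g" and "sub_cuntz_state z \<omega>"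
  shows "sub_cuntz_state (Gamma_op g z) (cuntz_aut_dual g \<omega>)"
proof -
  obtain m where \<omega>: "state \<omega>" and m: "1 \<le> m" "z \<in> unit_vectors m"
    and val: "\<And>J. length J = m \<Longrightarrow> \<omega> (cuntz_monomial J) = cnj (z J)"
    using assms(2) unfolding sub_cuntz_state_def by blast
  note g' = unitary_adjoint[OF g]
  have "cuntz_aut_dual g \<omega> (cuntz_monomial J) = cnj (Gamma_op g z J)" if "length J = m" for J
    using that
    by (simp add: cuntz_aut_dual_def cuntz_aut_monomial[OF g'] state_sum[OF \<omega>] state_scaleC[OF \<omega>] val
        Gamma_op_tensor_matrix tensor_matrix_adjoint mult.commute)
  moreover have "state (cuntz_aut_dual g \<omega>)"
    unfolding cuntz_aut_dual_def by (rule state_comp_hom[OF \<omega> cuntz_aut_hom[OF g']])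
  ultimately show ?thesis
    unfolding sub_cuntz_state_def using m Gamma_op_unit_vectors[OF g] by blast
qed

lemma cuntz_aut_dual_inverse:
  assumes "unitary g"
  shows "cuntz_aut_dual g (cuntz_aut_dual (adjoint_matrix g) \<omega>) = \<omega>"
  using cuntz_aut_inverse[OF assms] by (simp add: cuntz_aut_dual_def fun_eq_iff)

theorem proposition1p10:
  fixes g :: "complex^'n::finite^'n::finite" and z :: "'n list \<Rightarrow> complex"
  assumes "2 \<le> CARD('n)" and "unitary g" and "z \<in> nonperiodic_vectors"
  shows "cuntz_aut_dual g (the_sub_cuntz_state z) = the_sub_cuntz_state (Gamma_op g z)"
proof -
  note g = assms(2)
  obtain m where m: "1 \<le> m" "z \<in> unit_vectors m" and np: "nonperiodic z"
    using assms(3) unfolding nonperiodic_vectors_def by auto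
  obtain \<omega> where \<omega>: "sub_cuntz_state z \<omega>"
    using sub_cuntz_state_exists[OF m] by blast
  have the_z: "the_sub_cuntz_state z = \<omega>"
    unfolding the_sub_cuntz_state_def by (rule the_equality[where P = "sub_cuntz_state z", OF \<omega>]) (rule sub_cuntz_state_unique[OF _ \<omega> np])
  have "the_sub_cuntz_state (Gamma_op g z) = cuntz_aut_dual g \<omega>"
    unfolding the_sub_cuntz_state_def
  proof (rule the_equality)
    show "sub_cuntz_state (Gamma_op g z) (cuntz_aut_dual g \<omega>)"
      by (rule sub_cuntz_state_cuntz_aut_dual[OF g \<omega>])
    fix \<eta> assume "sub_cuntz_state (Gamma_op g z) \<eta>"
    then have "sub_cuntz_state z (cuntz_aut_dual (adjoint_matrix g) \<eta>)"
      using sub_cuntz_state_cuntz_aut_dual[OF unitary_adjoint[OF g]] Gamma_op_inverse[OF g] by metis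
    then have "cuntz_aut_dual (adjoint_matrix g) \<eta> = \<omega>"
      by (rule sub_cuntz_state_unique[OF _ \<omega> np])
    then show "\<eta> = cuntz_aut_dual g \<omega>"
      using cuntz_aut_dual_inverse[OF g] by metis
  qed
  then show ?thesis by (simp add: the_z)
qed

end
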